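(* Let $\nu$ be a non-zero finite Borel measure on $(0,1)$. For all $m$ with $1<m\le 3$, $$\underline{F}_\nu\le \underline{h}_\nu^m\le \underline{s}_\nu\le\underline{h}_\nu\le\overline{h}_\nu=\overline{h}_\nu^m=\overline{s}_\nu=\overline{q}_\nu=\overline{F}_\nu .$$ In particular, $\overline{q}_\nu\le 1/2$, and the following hold: (i) if $\underline{s}_\nu=\overline{s}_\nu$ (common value denoted $s_\nu$), then $\underline{h}_\nu=\overline{h}_\nu=s_\nu$; (ii) if $\sup_{m>1}\underline{h}_\nu^m=\overline{h}_\nu$, then $\underline{s}_\nu=\overline{s}_\nu=\overline{h}_\nu$; (iii) if $\underline{F}_\nu=\overline{F}_\nu$, then equality holds everywhere in the displayed chain (for every $1<m\le 3$), and in particular $\sup_{m>1}\underline{h}_\nu^m=\overline{h}_\nu$; (iv) if $\underline{h}_\nu^m\ge 1/2$ for some $m>1$, then $\underline{s}_\nu=\overline{s}_\nu=1/2=\overline{h}_\nu$.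
   Context: $\Lambda$ is Lebesgue measure. A measure $\nu$ on $(0,1)$ is regarded as a measure on $[0,1]$ with no mass at the endpoints. Form and eigenvalue counting function. $H^1_0(0,1)$ is the space of functions $f:[0,1]\to\mathbb R$ with $f(x)=\int_{[0,x]}g\,d\Lambda$ for some $g\in L^2_\Lambda([0,1])$ and $f(0)=f(1)=0$; write $\nabla_\Lambda f:=g$. $C_\nu([0,1])$ is the set of continuous real functions on $[0,1]$ that are affine linear on every connected component of $[0,1]\setminus\operatorname{supp}\nu$. Put $\operatorname{dom}(\mathcal E_\nu):=H^1_0(0,1)\cap C_\nu([0,1])$ and $\mathcal E_\nu(f,g):=\int_{(0,1)}\nabla_\Lambda f\,\nabla_\Lambda g\,d\Lambda$. A number $\lambda$ is an eigenvalue of $\mathcal E_\nu$ if there is $f\in\operatorname{dom}(\mathcal E_\nu)\setminus\{0\}$ with $\mathcal E_\nu(f,g)=\lambda\int fg\,d\nu$ for all $g\in\operatorname{dom}(\mathcal E_\nu)$. $N_\nu(x)$ is the number of eigenvalues $\le x$ (with multiplicity). $\underline{s}_\nu:=\liminf_{x\to\infty}\frac{\log N_\nu(x)}{\log x}$, $\overline{s}_\nu:=\limsup_{x\to\infty}\frac{\log N_\nu(x)}{\log x}$ (lower/upper spectral dimension). Partition entropy. A $\nu$-partition is a finite family $\{(c_k,c_{k+1}]:k=1,\dots,n-1\}$, $n\ge2$, with $0=c_1<c_2<\dots<c_n=1$ and $\nu(\{c_k\})=0$ for all $k$; $\Pi$ is the set of all $\nu$-partitions. $\mathcal N^R(x):=\inf\{\operatorname{card}P:P\in\Pi,\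 \max_{C\in P}\nu(C)\Lambda(C)<1/x\}$; $\overline h_\nu:=\limsup_{x\to\infty}\frac{\log\mathcal N^R(x)}{\log x}$, $\underline h_\nu:=\liminf_{x\to\infty}\frac{\log\mathcal N^R(x)}{\log x}$. Reduced partition entropy. $\Pi_0$ is the set of finite families of pairwise disjoint subintervals of $[0,1]$ whose endpoints carry no $\nu$-atoms. For an interval $C$ and $m>1$, $\langle C\rangle_m\subset C$ is the interval of length $\Lambda(C)/m$ with the same midpoint as $C$ (and of the same open/closed type). $\mathcal N^L_m(x):=\sup\{\operatorname{card}P:P\in\Pi_0,\ \min_{C\in P}\nu(\langle C\rangle_m)\Lambda(\langle C\rangle_m)\ge\frac{4}{x(m-1)}\}$; $\underline h^m_\nu:=\liminf_{x\to\infty}\frac{\log\mathcal N^L_m(x)}{\log x}$, $\overline h^m_\nu:=\limsup_{x\to\infty}\frac{\log\mathcal N^L_m(x)}{\log x}$. $L^q$-spectrum. For $n\in\mathbb N$, $0\le k<2^n$ let $A^n_k:=(k2^{-n},(k+1)2^{-n}]$, $\mathcal D_{\nu,n}:=\{A^n_k:\nu(A^n_k)>0\}$, and for $q\in\mathbb R$ let $\beta^\nu_n(q):=\frac{1}{\log 2^n}\log\sum_{C\in\mathcal D_{\nu,n}}\nu(C)^q$. For all large $n$ there is a unique $q_n\ge0$ with $\beta_n^\nu(q_n)=q_n$; $\overline q_\nu:=\limsup_{n\to\infty}q_n$. Optimized coarse multifractal dimension. For $\alpha>0$, $\mathcal N_\alpha(n):=\operatorname{card}\{0\le k<2^n:\nu(A^n_k)\ge2^{-\alpha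 n}\}$; $\overline F_\nu(\alpha):=\limsup_n\frac{\log^+\mathcal N_\alpha(n)}{\log2^n}$, $\underline F_\nu(\alpha):=\liminf_n\frac{\log^+\mathcal N_\alpha(n)}{\log2^n}$, where $\log^+t=\max(\log t,0)$ and $\log^+0=0$; $\overline F_\nu:=\sup_{\alpha>0}\frac{\overline F_\nu(\alpha)}{1+\alpha}$, $\underline F_\nu:=\sup_{\alpha>0}\frac{\underline F_\nu(\alpha)}{1+\alpha}$. *)

theory Defs
  imports "HOL-Analysis.Analysis" "HOL-Library.Function_Algebras"
begin

text \<open>
  A finite Borel measure on \<open>(0,1)\<close>, regarded as a measure on \<open>[0,1]\<close> without mass at the
  endpoints, is represented by a finite measure on the Borel sets of the real line for which the
  complement of \<open>(0,1)\<close> is a null set.  In this way intervals such as \<open>(c,1]\<close> are measurable.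
\<close>

definition finite_measure_on_01 :: "real measure \<Rightarrow> bool" where
  "finite_measure_on_01 \<nu> \<longleftrightarrow>
     finite_measure \<nu> \<and> sets \<nu> = sets borel \<and> emeasure \<nu> (- {0<..<1}) = 0"

section \<open>The form and its eigenvalue counting function\<close>

definition supp :: "real measure \<Rightarrow> real set" where
  "supp \<nu> = {x \<in> {0..1}. \<forall>U. open U \<and> x \<in> U \<longrightarrow> 0 < emeasure \<nu> U}"

definition is_gradient :: "(real \<Rightarrow> real) \<Rightarrow> (real \<Rightarrow> real) \<Rightarrow> bool" where
  "is_gradient f g \<longleftrightarrow>
     set_borel_measurable lborel {0..1} g \<and>
     set_integrable lborel {0..1} (\<lambda>t. (g t)\<^sup>2) \<and>
     (\<forall>x\<in>{0..1}. f x = (LINT t:{0..x}|lborel. g t))"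

text \<open>The choice below is immaterial: gradients are unique up to Lebesgue null sets in \<open>[0,1]\<close>.\<close>

definition gradient :: "(real \<Rightarrow> real) \<Rightarrow> real \<Rightarrow> real" where
  "gradient f = (SOME g. is_gradient f g)"

text \<open>
  A function on \<open>[0,1]\<close> is represented by its extension by \<open>0\<close> to the real line, so that equality
  of functions, and linear (in)dependence, are those on \<open>[0,1]\<close>.
\<close>

definition H10 :: "(real \<Rightarrow> real) set" where
  "H10 = {f. (\<exists>g. is_gradient f g) \<and> f 0 = 0 \<and> f 1 = 0 \<and> (\<forall>x. x \<notin> {0..1} \<longrightarrow> f x = 0)}"

definition C_affine :: "real measure \<Rightarrow> (real \<Rightarrow> real) set" where
  "C_affine \<nu> = {f. continuous_on {0..1} f \<and>
     (\<forall>K \<in> components ({0..1} - supp \<nu>). \<exists>a b. \<forall>x\<in>K. f x = a * x + b)}"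

definition form_dom :: "real measure \<Rightarrow> (real \<Rightarrow> real) set" where
  "form_dom \<nu> = H10 \<inter> C_affine \<nu>"

definition form :: "(real \<Rightarrow> real) \<Rightarrow> (real \<Rightarrow> real) \<Rightarrow> real" where
  "form f g = (LINT t:{0<..<1}|lborel. gradient f t * gradient g t)"

text \<open>The functions satisfying the eigenvalue equation, including the zero function.\<close>

definition eigenspace :: "real measure \<Rightarrow> real \<Rightarrow> (real \<Rightarrow> real) set" where
  "eigenspace \<nu> l = {f \<in> form_dom \<nu>. \<forall>g \<in> form_dom \<nu>. form f g = l * (LINT x|\<nu>. f x * g x)}"

definition is_eigenvalue :: "real measure \<Rightarrow> real \<Rightarrow> bool" where
  "is_eigenvalue \<nu> l \<longleftrightarrow> (\<exists>f \<in> eigenspace \<nu> l. f \<noteq> (\<lambda>_. 0))"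

definition fun_scale :: "real \<Rightarrow> (real \<Rightarrow> real) \<Rightarrow> real \<Rightarrow> real" where
  "fun_scale c f = (\<lambda>x. c * f x)"

lemma vector_space_fun_scale: "vector_space fun_scale"
  by unfold_locales (auto simp: fun_scale_def fun_eq_iff algebra_simps)

definition eigen_multiplicity :: "real measure \<Rightarrow> real \<Rightarrow> nat" where
  "eigen_multiplicity \<nu> l = vector_space.dim fun_scale (eigenspace \<nu> l)"

text \<open>
  For finite \<open>\<nu>\<close> the form domain embeds compactly into \<open>L\<^sup>2(\<nu>)\<close>, so every eigenspace is
  finite-dimensional and there are only finitely many eigenvalues below any bound; hence the
  natural-number valued dimension and sum are the true ones.
\<close>

definition eigen_count :: "real measure \<Rightarrow> real \<Rightarrow> nat" where
  "eigen_count \<nu> x = (\<Sum>l \<in> {l. is_eigenvalue \<nu> l \<and> l \<le> x}. eigen_multiplicity \<nu> l)"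

section \<open>Spectral dimensions and partition entropies\<close>

text \<open>
  All counting functions used below are eventually positive when \<open>\<nu>\<close> is non-zero, so the
  value of \<open>ln 0\<close> does not matter.
\<close>

definition lower_exponent :: "(real \<Rightarrow> nat) \<Rightarrow> ereal" where
  "lower_exponent N = Liminf at_top (\<lambda>x. ereal (ln (real (N x)) / ln x))"

definition upper_exponent :: "(real \<Rightarrow> nat) \<Rightarrow> ereal" where
  "upper_exponent N = Limsup at_top (\<lambda>x. ereal (ln (real (N x)) / ln x))"

definition lower_spectral_dim :: "real measure \<Rightarrow> ereal" where
  "lower_spectral_dim \<nu> = lower_exponent (eigen_count \<nu>)"

definition upper_spectral_dim :: "real measure \<Rightarrow> ereal" where
  "upper_spectral_dim \<nu> = upper_exponent (eigen_count \<nu>)"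

definition nu_partitions :: "real measure \<Rightarrow> real set set set" where
  "nu_partitions \<nu> = {P. \<exists>(n::nat) c. 2 \<le> n \<and> c 1 = 0 \<and> c n = 1 \<and>
     (\<forall>k\<in>{1..<n}. c k < c (Suc k)) \<and> (\<forall>k\<in>{1..n}. measure \<nu> {c k} = 0) \<and>
     P = (\<lambda>k. {c k<..c (Suc k)}) ` {1..<n}}"

definition partition_count :: "real measure \<Rightarrow> real \<Rightarrow> nat" where
  "partition_count \<nu> x = Inf {card P |P. P \<in> nu_partitions \<nu> \<and>
     (\<forall>C\<in>P. measure \<nu> C * measure lborel C < 1 / x)}"

definition lower_entropy :: "real measure \<Rightarrow> ereal" where
  "lower_entropy \<nu> = lower_exponent (partition_count \<nu>)"

definition upper_entropy :: "real measure \<Rightarrow> ereal" where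
  "upper_entropy \<nu> = upper_exponent (partition_count \<nu>)"

definition interval_families :: "real measure \<Rightarrow> real set set set" where
  "interval_families \<nu> = {P. finite P \<and> disjoint P \<and>
     (\<forall>C\<in>P. is_interval C \<and> C \<noteq> {} \<and> C \<subseteq> {0..1} \<and>
        measure \<nu> {Inf C} = 0 \<and> measure \<nu> {Sup C} = 0)}"

text \<open>
  The homothety with ratio \<open>1/m\<close> about the midpoint maps an interval to the concentric interval
  of \<open>1/m\<close> times the length and of the same open/closed type.
\<close>

definition shrink :: "real \<Rightarrow> real set \<Rightarrow> real set" where
  "shrink m C = (let c = (Inf C + Sup C) / 2 in (\<lambda>x. c + (x - c) / m) ` C)"

text \<open>
  For \<open>x > 0\<close> and \<open>m > 1\<close> the cardinalities below are bounded (Cauchy--Schwarz), so the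
  supremum of natural numbers is a genuine one.
\<close>

definition reduced_count :: "real measure \<Rightarrow> real \<Rightarrow> real \<Rightarrow> nat" where
  "reduced_count \<nu> m x = Sup {card P |P. P \<in> interval_families \<nu> \<and>
     (\<forall>C\<in>P. measure \<nu> (shrink m C) * measure lborel (shrink m C) \<ge> 4 / (x * (m - 1)))}"

definition lower_reduced_entropy :: "real measure \<Rightarrow> real \<Rightarrow> ereal" where
  "lower_reduced_entropy \<nu> m = lower_exponent (reduced_count \<nu> m)"

definition upper_reduced_entropy :: "real measure \<Rightarrow> real \<Rightarrow> ereal" where
  "upper_reduced_entropy \<nu> m = upper_exponent (reduced_count \<nu> m)"

section \<open>The \<open>L\<^sup>q\<close>-spectrum and the coarse multifractal dimension\<close>

definition dyadic :: "nat \<Rightarrow> nat \<Rightarrow> real set" where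
  "dyadic n k = {real k / 2 ^ n <.. (real k + 1) / 2 ^ n}"

definition charged_dyadics :: "real measure \<Rightarrow> nat \<Rightarrow> real set set" where
  "charged_dyadics \<nu> n = {dyadic n k |k. k < 2 ^ n \<and> measure \<nu> (dyadic n k) > 0}"

definition Lq_beta :: "real measure \<Rightarrow> nat \<Rightarrow> real \<Rightarrow> real" where
  "Lq_beta \<nu> n q = ln (\<Sum>C\<in>charged_dyadics \<nu> n. measure \<nu> C powr q) / ln (2 ^ n)"

text \<open>The fixed point is unique for all large \<open>n\<close>, namely as soon as \<open>\<nu>(C) < 2\<^sup>n\<close> for all \<open>C\<close>.\<close>

definition q_fixed :: "real measure \<Rightarrow> nat \<Rightarrow> real" where
  "q_fixed \<nu> n = (THE q. 0 \<le> q \<and> Lq_beta \<nu> n q = q)"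

definition q_upper :: "real measure \<Rightarrow> ereal" where
  "q_upper \<nu> = limsup (\<lambda>n. ereal (q_fixed \<nu> n))"

definition log_plus :: "real \<Rightarrow> real" where
  "log_plus t = (if t > 0 then max (ln t) 0 else 0)"

definition coarse_count :: "real measure \<Rightarrow> real \<Rightarrow> nat \<Rightarrow> nat" where
  "coarse_count \<nu> \<alpha> n =
     card {k. k < 2 ^ n \<and> measure \<nu> (dyadic n k) \<ge> 2 powr (- \<alpha> * real n)}"

definition F_upper_at :: "real measure \<Rightarrow> real \<Rightarrow> ereal" where
  "F_upper_at \<nu> \<alpha> = limsup (\<lambda>n. ereal (log_plus (real (coarse_count \<nu> \<alpha> n)) / ln (2 ^ n)))"

definition F_lower_at :: "real measure \<Rightarrow> real \<Rightarrow> ereal" where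
  "F_lower_at \<nu> \<alpha> = liminf (\<lambda>n. ereal (log_plus (real (coarse_count \<nu> \<alpha> n)) / ln (2 ^ n)))"

definition F_upper :: "real measure \<Rightarrow> ereal" where
  "F_upper \<nu> = (SUP \<alpha>\<in>{0<..}. F_upper_at \<nu> \<alpha> / ereal (1 + \<alpha>))"

definition F_lower :: "real measure \<Rightarrow> ereal" where
  "F_lower \<nu> = (SUP \<alpha>\<in>{0<..}. F_lower_at \<nu> \<alpha> / ereal (1 + \<alpha>))"

end

theory Submission
  imports Defs "HOL-Complex_Analysis.Great_Picard"
begin

text \<open>
  For \<open>x > 0\<close> and \<open>m > 1\<close> the counting functions satisfy \<open>\<N>\<^sup>L\<^sub>m(x) \<le> N\<^sub>\<nu>(x) < \<N>\<^sup>R(x)\<close>.  For the upper bound, a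
  nontrivial combination of more eigenfunctions than there are interior division points vanishes at all of them, and
  on each cell \<open>C\<close> the Cauchy--Schwarz inequality bounds \<open>\<integral>f\<^sup>2 d\<nu>\<close> by \<open>\<nu>(C) \<Lambda>(C)\<close> times the energy of \<open>f\<close> on
  \<open>C\<close>.  For the lower bound, disjoint intervals carry trapezoidal functions with Rayleigh quotient \<open>\<le> x\<close>.  These need
  not be affine off the support, so the variational problem is posed on all of \<open>H\<^sup>1\<^sub>0\<close>: its maximisers
  are automatically affine off the support, hence belong to the domain of the form.

  Dyadic intervals close the circle of the upper dimensions: the tree of dyadic \<open>C\<close> with \<open>\<nu>(C) \<Lambda>(C) \<ge> 1/x\<close>
  yields \<open>h \<le> q\<close>; slicing \<open>\<Sum>\<nu>(C)\<^sup>q\<close> by the size of \<open>\<nu>(C)\<close> yields \<open>q \<le> F\<close>; well separated dyadic intervals of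
  large measure yield \<open>F \<le> h\<^sup>m\<close>, for the lower as well as for the upper limits.
\<close>

section \<open>Positive semidefinite forms on spaces of functions\<close>

text \<open>Two positive semidefinite forms, the energy \<open>form\<close> and
  \<open>nu_inner\<close>, live on the single space \<open>H10\<close>; the second is degenerate in
  general. Maximising it under fixed energy yields eigenfunctions, and the compactness this requires
  comes from the Hoelder bound of exponent 1/2. \<open>eigen_count\<close> returns junk where a
  dimension or the set of eigenvalues is infinite. Hence the comparison with partitions is first
  proved for arbitrary finite independent families of eigenfunctions; finiteness follows from it.
  The natural cutting points, dyadic or equally spaced, may be atoms, which
  \<open>nu_partitions\<close> and \<open>interval_families\<close> forbid. Partitions are repaired
  by moving points to the right, reduced families by choosing radii off a countable set. The
  denominator \<open>1 + \<alpha>\<close> in F reflects that a dyadic interval C of measure at least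
  \<open>2 powr (- \<alpha> * n)\<close> has measure times length at least
  \<open>2 powr (- (1 + \<alpha>) * n)\<close>, so it counts at x of order
  \<open>2 powr ((1 + \<alpha>) * n)\<close>. The bound 1/2 is the inequality of arithmetic and
  geometric means for measure and length.\<close>

locale psd_form =
  fixes V :: "(real \<Rightarrow> real) set" and B :: "(real \<Rightarrow> real) \<Rightarrow> (real \<Rightarrow> real) \<Rightarrow> real"
  assumes zero: "0 \<in> V"
    and add: "f \<in> V \<Longrightarrow> g \<in> V \<Longrightarrow> f + g \<in> V"
    and scale: "f \<in> V \<Longrightarrow> fun_scale c f \<in> V"
    and sym: "f \<in> V \<Longrightarrow> g \<in> V \<Longrightarrow> B f g = B g f"
    and add_left: "f \<in> V \<Longrightarrow> g \<in> V \<Longrightarrow> h \<in> V \<Longrightarrow> B (f + g) h = B f h + B g h"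
    and scale_left: "f \<in> V \<Longrightarrow> h \<in> V \<Longrightarrow> B (fun_scale c f) h = c * B f h"
    and nonneg: "f \<in> V \<Longrightarrow> 0 \<le> B f f"
begin

lemma add_right: "f \<in> V \<Longrightarrow> g \<in> V \<Longrightarrow> h \<in> V \<Longrightarrow> B h (f + g) = B h f + B h g"
  by (metis add add_left sym)

lemma scale_right: "f \<in> V \<Longrightarrow> h \<in> V \<Longrightarrow> B h (fun_scale c f) = c * B h f"
  by (metis scale scale_left sym)

lemma zero_left: "h \<in> V \<Longrightarrow> B 0 h = 0"
  using add_left[of 0 0 h] zero by simp

lemma diff: "f \<in> V \<Longrightarrow> g \<in> V \<Longrightarrow> f - g \<in> V"
proof -
  assume "f \<in> V" "g \<in> V"
  then have "f + fun_scale (-1) g \<in> V" by (intro add scale)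
  also have "f + fun_scale (-1) g = f - g" by (auto simp: fun_scale_def fun_eq_iff)
  finally show ?thesis .
qed

lemma diff_left: "f \<in> V \<Longrightarrow> g \<in> V \<Longrightarrow> h \<in> V \<Longrightarrow> B (f - g) h = B f h - B g h"
  using add_left[of "f - g" g h] by (simp add: diff)

lemma diff_right: "f \<in> V \<Longrightarrow> g \<in> V \<Longrightarrow> h \<in> V \<Longrightarrow> B h (f - g) = B h f - B h g"
  by (metis diff diff_left sym)

lemma quadratic_add:
  assumes "f \<in> V" "g \<in> V"
  shows "B (f + g) (f + g) = B f f + 2 * B f g + B g g"
  using assms by (simp add: add add_left add_right sym[of g f])

lemma parallelogram:
  assumes "f \<in> V" "g \<in> V"
  shows "B (f - g) (f - g) = 2 * B f f + 2 * B g g - B (f + g) (f + g)"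
  using assms by (simp add: quadratic_add diff diff_left diff_right sym[of g f])

text \<open>The quadratic t -> B(f + t g, f + t g) is nonnegative. With \<open>B g g = 0\<close> it
  is affine in t and stays nonnegative only if its slope \<open>2 * B f g\<close> vanishes;
  otherwise evaluate it at its minimum.\<close>

lemma Cauchy_Schwarz:
  assumes "f \<in> V" "g \<in> V"
  shows "(B f g)\<^sup>2 \<le> B f f * B g g"
proof -
  have q: "0 \<le> B f f + 2 * t * B f g + t\<^sup>2 * B g g" for t
    using nonneg[of "f + fun_scale t g"] assms
    by (simp add: quadratic_add add scale scale_left scale_right power2_eq_square)
  show ?thesis
  proof (cases "B g g = 0")
    case True
    have "B f g = 0"
    proof (rule ccontr)
      assume "B f g \<noteq> 0"
      \<comment> \<open>This t gives the quadratic the value -1.\<close>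
      then show False using q[of "- (B f f + 1) / (2 * B f g)"] True by (simp add: field_simps)
    qed
    then show ?thesis using nonneg assms by simp
  next
    case False
    then have "0 < B g g" using nonneg[OF assms(2)] by simp
    then show ?thesis using q[of "- B f g / B g g"]
      by (simp add: field_simps power2_eq_square)
  qed
qed

lemma sum_in:
  assumes "\<And>i. i \<in> I \<Longrightarrow> f i \<in> V"
  shows "(\<Sum>i\<in>I. fun_scale (a i) (f i)) \<in> V"
  using assms by (induction I rule: infinite_finite_induct) (auto simp: zero add scale)

lemma sum_left:
  assumes "\<And>i. i \<in> I \<Longrightarrow> f i \<in> V" "h \<in> V"
  shows "B (\<Sum>i\<in>I. fun_scale (a i) (f i)) h = (\<Sum>i\<in>I. a i * B (f i) h)"
  using assms
  by (induction I rule: infinite_finite_induct)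
    (auto simp: zero_left add_left scale_left sum_in scale)

lemma sum_right:
  assumes "\<And>i. i \<in> I \<Longrightarrow> f i \<in> V" "h \<in> V"
  shows "B h (\<Sum>i\<in>I. fun_scale (a i) (f i)) = (\<Sum>i\<in>I. a i * B h (f i))"
proof -
  have "B h (\<Sum>i\<in>I. fun_scale (a i) (f i)) = B (\<Sum>i\<in>I. fun_scale (a i) (f i)) h"
    using assms by (intro sym sum_in)
  also have "\<dots> = (\<Sum>i\<in>I. a i * B h (f i))"
    by (subst sum_left) (use assms sym in \<open>auto intro!: sum.cong\<close>)
  finally show ?thesis .
qed

lemma orthogonal_sum:
  assumes "\<And>i. i \<in> I \<Longrightarrow> f i \<in> V" and "\<And>i j. i \<in> I \<Longrightarrow> j \<in> I \<Longrightarrow> i \<noteq> j \<Longrightarrow> B (f i) (f j) = 0"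
  shows "B (\<Sum>i\<in>I. fun_scale (a i) (f i)) (\<Sum>i\<in>I. fun_scale (a i) (f i)) = (\<Sum>i\<in>I. (a i)\<^sup>2 * B (f i) (f i))"
proof (cases "finite I")
  case True
  have "B (f i) (\<Sum>i\<in>I. fun_scale (a i) (f i)) = a i * B (f i) (f i)" if "i \<in> I" for i
  proof -
    have "B (f i) (\<Sum>i\<in>I. fun_scale (a i) (f i)) = (\<Sum>j\<in>I. a j * B (f i) (f j))"
      using assms that by (intro sum_right) auto
    also have "\<dots> = (\<Sum>j\<in>I. if j = i then a i * B (f i) (f i) else 0)"
      using assms that by (intro sum.cong) auto
    finally show ?thesis using that True by simp
  qed
  then show ?thesis using assms
    by (subst sum_left) (auto intro!: sum.cong sum_in simp: power2_eq_square)
qed (simp add: zero_left zero)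

end

section \<open>Nontrivial solutions of homogeneous linear systems\<close>

lemma sum_fun_scale_apply: "(\<Sum>i\<in>I. fun_scale (a i) (f i)) x = (\<Sum>i\<in>I. a i * f i x)"
  by (induction I rule: infinite_finite_induct) (auto simp: fun_scale_def)

text \<open>Gaussian elimination, by induction on the number of equations. It later yields
  combinations of trial functions orthogonal to the eigenfunctions already found, and combinations
  of eigenfunctions vanishing at the interior division points.\<close>

lemma homogeneous_system_solution:
  fixes F :: "nat \<Rightarrow> nat \<Rightarrow> real"
  assumes "m < n"
  shows "\<exists>a. (\<exists>i<n. a i \<noteq> 0) \<and> (\<forall>k<m. (\<Sum>i<n. a i * F k i) = 0)"
  using assms
proof (induction m arbitrary: n F)
  case 0
  then show ?case by (intro exI[of _ "\<lambda>_. 1"]) auto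
next
  case (Suc m)
  show ?case
  proof (cases "\<exists>p<n. F m p \<noteq> 0")
    case False
    obtain a where a: "\<exists>i<n. a i \<noteq> 0" "\<And>k. k < m \<Longrightarrow> (\<Sum>i<n. a i * F k i) = 0"
      using Suc.IH[of n F] Suc.prems by auto
    then show ?thesis using False by (intro exI[of _ a]) (auto simp: less_Suc_eq)
  next
    case True
    then obtain p where p: "p < n" "F m p \<noteq> 0" by auto
    obtain n' where n': "n = Suc n'" using Suc.prems by (cases n) auto
    \<comment> \<open>\<open>s\<close> enumerates the columns other than the pivot column
      \<open>p\<close>.\<close>
    define s where "s i = (if i < p then i else Suc i)" for i
    have s: "inj_on s {..<n'}" "s ` {..<n'} = {..<n} - {p}"
    proof -
      show "inj_on s {..<n'}" by (auto simp: s_def inj_on_def)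
      show "s ` {..<n'} = {..<n} - {p}"
      proof (intro equalityI subsetI)
        fix x assume x: "x \<in> {..<n} - {p}"
        show "x \<in> s ` {..<n'}"
        proof (cases "x < p")
          case True
          then show ?thesis using p n' by (intro image_eqI[of _ _ x]) (auto simp: s_def)
        next
          case False
          then show ?thesis using p n' x by (intro image_eqI[of _ _ "x - 1"]) (auto simp: s_def)
        qed
      qed (use p n' in \<open>auto simp: s_def split: if_splits\<close>)
    qed
    \<comment> \<open>The system left after unknown \<open>p\<close> has been eliminated by means of
      equation \<open>m\<close>.\<close>
    define G where "G k i = F k (s i) - F k p * F m (s i) / F m p" for k i
    obtain b where b: "\<exists>i<n'. b i \<noteq> 0" "\<And>k. k < m \<Longrightarrow> (\<Sum>i<n'. b i * G k i) = 0"
      using Suc.IH[of n' G] Suc.prems n' by auto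
    define b' where "b' = b \<circ> the_inv_into {..<n'} s"
    have b': "b' (s i) = b i" if "i < n'" for i
      using that s by (auto simp: b'_def the_inv_into_f_f)
    define a where "a i = (if i = p then - (\<Sum>j<n'. b j * F m (s j)) / F m p else b' i)" for i
    have split: "(\<Sum>i<n. a i * F k i) = a p * F k p + (\<Sum>j<n'. b j * F k (s j))" for k
    proof -
      have "(\<Sum>i<n. a i * F k i) = a p * F k p + (\<Sum>i\<in>{..<n} - {p}. a i * F k i)"
        using p by (intro sum.remove) auto
      also have "(\<Sum>i\<in>{..<n} - {p}. a i * F k i) = (\<Sum>j<n'. a (s j) * F k (s j))"
        unfolding s(2)[symmetric] using s(1) by (simp add: sum.reindex)
      also have "\<dots> = (\<Sum>j<n'. b j * F k (s j))"
      proof (intro sum.cong)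
        fix j assume j: "j \<in> {..<n'}"
        then have "s j \<noteq> p" using s(2) by blast
        then show "a (s j) * F k (s j) = b j * F k (s j)" using j b' by (simp add: a_def)
      qed simp
      finally show ?thesis .
    qed
    have "(\<Sum>i<n. a i * F k i) = 0" if "k < Suc m" for k
    proof (cases "k = m")
      case True
      have "a p = - (\<Sum>j<n'. b j * F m (s j)) / F m p" by (simp add: a_def)
      then show ?thesis using p True split[of m] by simp
    next
      case False
      have "(\<Sum>i<n. a i * F k i) = (\<Sum>j<n'. b j * G k j)"
      proof -
        have "a p = - (\<Sum>j<n'. b j * F m (s j)) / F m p" by (simp add: a_def)
        then show ?thesis
          by (simp only: split) (simp add: G_def right_diff_distrib sum_subtractf sum_distrib_left
              sum_divide_distrib mult_ac)
      qed
      then show ?thesis using b(2)[of k] that False by simp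
    qed
    moreover have "\<exists>i<n. a i \<noteq> 0"
    proof -
      obtain i where i: "i < n'" "b i \<noteq> 0" using b by auto
      have "s i \<in> {..<n} - {p}" using s(2) i by blast
      then show ?thesis using i b'[of i] by (intro exI[of _ "s i"]) (auto simp: a_def)
    qed
    ultimately show ?thesis by blast
  qed
qed

section \<open>Square integrable functions on the unit interval\<close>

text \<open>These are functions rather than classes modulo null sets, so \<open>L2_inner\<close> is
  only semidefinite. Vanishing off [0,1] lets all integrals run over the whole line.\<close>

definition L2 :: "(real \<Rightarrow> real) set" where
  "L2 = {g. g \<in> borel_measurable borel \<and> integrable lborel (\<lambda>t. (g t)\<^sup>2) \<and> (\<forall>t. t \<notin> {0..1} \<longrightarrow> g t = 0)}"

definition L2_inner :: "(real \<Rightarrow> real) \<Rightarrow> (real \<Rightarrow> real) \<Rightarrow> real" where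
  "L2_inner g k = (\<integral>t. g t * k t \<partial>lborel)"

lemma integrable_L2_mult:
  assumes "g \<in> L2" "k \<in> L2"
  shows "integrable lborel (\<lambda>t. g t * k t)"
proof (rule Bochner_Integration.integrable_bound)
  show "integrable lborel (\<lambda>t. (g t)\<^sup>2 + (k t)\<^sup>2)" using assms by (auto simp: L2_def)
  show "(\<lambda>t. g t * k t) \<in> borel_measurable lborel" using assms by (auto simp: L2_def)
  have "\<bar>x * y\<bar> \<le> x\<^sup>2 + y\<^sup>2" for x y :: real
    using zero_le_power2[of "\<bar>x\<bar> - \<bar>y\<bar>"] zero_le_power2[of x] zero_le_power2[of y]
    by (simp add: power2_diff abs_mult; linarith)
  then show "AE t in lborel. norm (g t * k t) \<le> norm ((g t)\<^sup>2 + (k t)\<^sup>2)" by auto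
qed

interpretation L2: psd_form L2 L2_inner
proof
  show "0 \<in> L2" by (simp add: L2_def zero_fun_def)
  fix f g h :: "real \<Rightarrow> real" and c :: real
  assume f: "f \<in> L2"
  show "fun_scale c f \<in> L2"
    using f unfolding L2_def by (auto simp: fun_scale_def power_mult_distrib)
  show "0 \<le> L2_inner f f" by (simp add: L2_inner_def)
  { assume g: "g \<in> L2"
    have "(\<lambda>t. ((f + g) t)\<^sup>2) = (\<lambda>t. (f t)\<^sup>2 + 2 * (f t * g t) + (g t)\<^sup>2)"
      by (auto simp: fun_eq_iff power2_sum)
    then show "f + g \<in> L2" using f g integrable_L2_mult[OF f g]
      unfolding L2_def by (auto simp: plus_fun_def)
    show "L2_inner f g = L2_inner g f" by (simp add: L2_inner_def mult.commute)
    assume h: "h \<in> L2"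
    show "L2_inner (f + g) h = L2_inner f h + L2_inner g h"
      using integrable_L2_mult[OF f h] integrable_L2_mult[OF g h]
      by (simp add: L2_inner_def distrib_right) }
  assume h: "h \<in> L2"
  show "L2_inner (fun_scale c f) h = c * L2_inner f h"
    by (simp add: L2_inner_def fun_scale_def mult.assoc)
qed

lemma L2_mult_indicator:
  assumes "g \<in> L2" "A \<in> sets borel"
  shows "(\<lambda>t. indicator A t * g t) \<in> L2"
proof -
  have "integrable lborel (\<lambda>t. indicator A t *\<^sub>R (g t)\<^sup>2)"
    using assms by (intro integrable_mult_indicator) (auto simp: L2_def)
  moreover have "(\<lambda>t. (indicator A t * g t)\<^sup>2) = (\<lambda>t. indicator A t *\<^sub>R (g t)\<^sup>2)"
    by (auto simp: fun_eq_iff indicator_def)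
  ultimately show ?thesis using assms by (auto simp: L2_def)
qed

lemma indicator_L2:
  assumes "A \<in> sets borel" "A \<subseteq> {0..1}"
  shows "indicator A \<in> L2"
proof -
  have "emeasure lborel A \<le> emeasure lborel {0..1::real}" using assms by (intro emeasure_mono) auto
  also have "\<dots> < \<infinity>" by simp
  finally have "integrable lborel (indicator A :: real \<Rightarrow> real)" using assms by (intro integrable_real_indicator) auto
  moreover have "(\<lambda>t. (indicator A t)\<^sup>2) = (indicator A :: real \<Rightarrow> real)" by (auto simp: fun_eq_iff indicator_def)
  ultimately show ?thesis using assms by (auto simp: L2_def indicator_def)
qed

lemma integrable_L2:
  assumes "g \<in> L2"
  shows "integrable lborel g"
proof -
  have "(\<lambda>t. indicator {0..1} t * g t) = g"
  proof
    fix t show "indicator {0..1} t * g t = g t" using assms by (cases "t \<in> {0..1}") (auto simp: L2_def)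
  qed
  moreover have "integrable lborel (\<lambda>t. indicator {0..1} t * g t)"
    by (intro integrable_L2_mult indicator_L2 assms) auto
  ultimately show ?thesis by (simp only:)
qed

lemma integral_indicator_L2_sq_le:
  assumes "g \<in> L2" "A \<in> sets borel" "A \<subseteq> {0..1}"
  shows "(\<integral>t. indicator A t * g t \<partial>lborel)\<^sup>2 \<le> measure lborel A * (\<integral>t. indicator A t * (g t)\<^sup>2 \<partial>lborel)"
proof -
  have "(L2_inner (indicator A) (\<lambda>t. indicator A t * g t))\<^sup>2 \<le>
     L2_inner (indicator A) (indicator A) * L2_inner (\<lambda>t. indicator A t * g t) (\<lambda>t. indicator A t * g t)"
    using assms by (intro L2.Cauchy_Schwarz indicator_L2 L2_mult_indicator)
  moreover have "(\<lambda>t. indicator A t * (indicator A t * g t)) = (\<lambda>t. indicator A t * g t)"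
     "(\<lambda>t. indicator A t * g t * (indicator A t * g t)) = (\<lambda>t. indicator A t * (g t)\<^sup>2)"
     "(\<lambda>t. indicator A t * indicator A t) = (indicator A :: real \<Rightarrow> real)"
    by (auto simp: fun_eq_iff indicator_def power2_eq_square)
  ultimately show ?thesis using assms by (simp add: L2_inner_def)
qed

lemma integrable_indicator_L2: "g \<in> L2 \<Longrightarrow> A \<in> sets borel \<Longrightarrow> integrable lborel (\<lambda>t. indicator A t * g t)"
  by (intro integrable_L2 L2_mult_indicator)

lemma L2_inner_unit: "L2_inner (indicator {0..1}) (indicator {0..1}) = 1"
proof -
  have "(\<lambda>t. indicator {0..1} t * indicator {0..1} t) = (indicator {0..1} :: real \<Rightarrow> real)"
    by (auto simp: fun_eq_iff indicator_def)
  then show ?thesis by (simp add: L2_inner_def)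
qed

text \<open>Riesz-Fischer. On an interval of length 1 the L1 norm is at most the L2 norm, so a
  Cauchy sequence in L2 has a subsequence converging almost everywhere; Fatou's lemma then bounds
  the L2 distance to the pointwise limit.\<close>

lemma L2_inner_complete:
  assumes f: "\<And>n. f n \<in> L2"
    and cauchy: "\<And>e. 0 < e \<Longrightarrow> \<exists>N. \<forall>i\<ge>N. \<forall>j\<ge>N. L2_inner (f i - f j) (f i - f j) < e"
  shows "\<exists>g\<in>L2. (\<lambda>n. L2_inner (f n - g) (f n - g)) \<longlonglongrightarrow> 0"
proof -
  have [measurable]: "f n \<in> borel_measurable borel" for n using f by (auto simp: L2_def)
  have l1: "(LINT x|lborel. norm (f i x - f j x)) \<le> sqrt (L2_inner (f i - f j) (f i - f j))" for i j
  proof -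
    have d: "f i - f j \<in> L2" using f by (intro L2.diff)
    then have a: "(\<lambda>t. \<bar>(f i - f j) t\<bar>) \<in> L2" by (auto simp: L2_def)
    have "(L2_inner (indicator {0..1}) (\<lambda>t. \<bar>(f i - f j) t\<bar>))\<^sup>2 \<le>
      L2_inner (indicator {0..1}) (indicator {0..1}) * L2_inner (\<lambda>t. \<bar>(f i - f j) t\<bar>) (\<lambda>t. \<bar>(f i - f j) t\<bar>)"
      by (intro L2.Cauchy_Schwarz indicator_L2 a) auto
    moreover have "L2_inner (indicator {0..1}) (\<lambda>t. \<bar>(f i - f j) t\<bar>) = (LINT x|lborel. norm (f i x - f j x))"
      unfolding L2_inner_def
    proof (intro Bochner_Integration.integral_cong)
      fix x show "indicator {0..1} x * \<bar>(f i - f j) x\<bar> = norm (f i x - f j x)"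
        using f by (cases "x \<in> {0..1}") (auto simp: L2_def)
    qed simp
    moreover have "L2_inner (\<lambda>t. \<bar>(f i - f j) t\<bar>) (\<lambda>t. \<bar>(f i - f j) t\<bar>) = L2_inner (f i - f j) (f i - f j)"
      by (simp only: L2_inner_def abs_mult_self_eq)
    ultimately have "(LINT x|lborel. norm (f i x - f j x))\<^sup>2 \<le> L2_inner (f i - f j) (f i - f j)"
      by (simp add: L2_inner_unit)
    then show ?thesis by (rule real_le_rsqrt)
  qed
  have "\<exists>N. \<forall>i\<ge>N. \<forall>j\<ge>N. (LINT x|lborel. norm (f i x - f j x)) < e" if "e > 0" for e
  proof -
    obtain N where N: "\<forall>i\<ge>N. \<forall>j\<ge>N. L2_inner (f i - f j) (f i - f j) < e\<^sup>2"
      using cauchy[of "e\<^sup>2"] \<open>e > 0\<close> by auto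
    have "(LINT x|lborel. norm (f i x - f j x)) < e" if "i \<ge> N" "j \<ge> N" for i j
      using l1[of i j] N that real_less_lsqrt[of e "L2_inner (f i - f j) (f i - f j)"] \<open>e > 0\<close>
      by (smt (verit) real_sqrt_less_mono real_sqrt_unique)
    then show ?thesis by blast
  qed
  then obtain r where r: "strict_mono r" "AE x in lborel. Cauchy (\<lambda>i. f (r i) x)"
    using cauchy_L1_AE_cauchy_subseq[of lborel f, OF integrable_L2[OF f]] by blast
  \<comment> \<open>Off [0,1] the sequence is constantly 0, and so is this limit.\<close>
  define g where "g x = (if Cauchy (\<lambda>i. f (r i) x) then lim (\<lambda>i. f (r i) x) else 0)" for x
  have [measurable]: "g \<in> borel_measurable borel" unfolding g_def by measurable
  have lim: "AE x in lborel. (\<lambda>i. f (r i) x) \<longlonglongrightarrow> g x"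
    using r(2) by eventually_elim (auto simp: g_def Cauchy_convergent_iff convergent_LIMSEQ_iff)
  have g0: "g t = 0" if "t \<notin> {0..1}" for t
    using that f by (auto simp: g_def L2_def)
  have nn: "ennreal (L2_inner (f i - f j) (f i - f j)) = (\<integral>\<^sup>+x. ennreal ((f i x - f j x)\<^sup>2) \<partial>lborel)" for i j
    using integrable_L2_mult[OF L2.diff[OF f f] L2.diff[OF f f], of i j i j]
    by (subst nn_integral_eq_integral) (auto simp: L2_inner_def power2_eq_square)
  \<comment> \<open>The index \<open>i\<close> is fixed and \<open>j\<close> runs along the
    subsequence: late members are close to each other, hence to \<open>g\<close>.\<close>
  have fatou: "(\<integral>\<^sup>+x. ennreal ((f i x - g x)\<^sup>2) \<partial>lborel) \<le> ennreal e"
    if N: "\<forall>i\<ge>N. \<forall>j\<ge>N. L2_inner (f i - f j) (f i - f j) < e" "i \<ge> N" for e N i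
  proof -
    have "(\<integral>\<^sup>+x. ennreal ((f i x - g x)\<^sup>2) \<partial>lborel) = (\<integral>\<^sup>+x. liminf (\<lambda>j. ennreal ((f i x - f (r j) x)\<^sup>2)) \<partial>lborel)"
    proof (rule nn_integral_cong_AE)
      show "AE x in lborel. ennreal ((f i x - g x)\<^sup>2) = liminf (\<lambda>j. ennreal ((f i x - f (r j) x)\<^sup>2))"
        using lim
      proof eventually_elim
        case (elim x)
        then have "(\<lambda>j. ennreal ((f i x - f (r j) x)\<^sup>2)) \<longlonglongrightarrow> ennreal ((f i x - g x)\<^sup>2)"
          by (intro tendsto_intros tendsto_ennrealI)
          then show ?case by (rule lim_imp_Liminf[OF sequentially_bot, symmetric])
      qed
    qed
    also have "\<dots> \<le> liminf (\<lambda>j. \<integral>\<^sup>+x. ennreal ((f i x - f (r j) x)\<^sup>2) \<partial>lborel)"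
      by (intro nn_integral_liminf) measurable
    also have "\<dots> \<le> ennreal e"
    proof (intro Liminf_le)
      have "eventually (\<lambda>j. j \<ge> N) sequentially" by (rule eventually_ge_at_top)
      then show "eventually (\<lambda>j. (\<integral>\<^sup>+x. ennreal ((f i x - f (r j) x)\<^sup>2) \<partial>lborel) \<le> ennreal e) sequentially"
      proof eventually_elim
        case (elim j)
        then have "r j \<ge> N" using seq_suble[OF r(1), of j] by linarith
        then show ?case using N unfolding nn[symmetric] by (intro ennreal_leI) (auto intro: less_imp_le)
      qed
    qed simp
    finally show ?thesis .
  qed
  have dL2: "f i - g \<in> L2" "L2_inner (f i - g) (f i - g) \<le> e"
    if N: "\<forall>i\<ge>N. \<forall>j\<ge>N. L2_inner (f i - f j) (f i - f j) < e" "i \<ge> N" "0 < e" for e N i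
  proof -
    have int: "integrable lborel (\<lambda>t. (f i t - g t)\<^sup>2)"
      using fatou[OF N(1,2)] by (intro integrableI_bounded) (auto simp: le_less_trans[OF _ ennreal_less_top])
    then show "f i - g \<in> L2" using f g0 by (auto simp: L2_def fun_diff_def)
    have "ennreal (L2_inner (f i - g) (f i - g)) = (\<integral>\<^sup>+x. ennreal ((f i x - g x)\<^sup>2) \<partial>lborel)"
      using int by (subst nn_integral_eq_integral) (auto simp: L2_inner_def power2_eq_square)
    then show "L2_inner (f i - g) (f i - g) \<le> e" using fatou[OF N(1,2)] N(3) by (metis ennreal_le_iff less_imp_le)
  qed
  obtain N1 where "\<forall>i\<ge>N1. \<forall>j\<ge>N1. L2_inner (f i - f j) (f i - f j) < 1" using cauchy[of 1] by auto
  then have "f N1 - g \<in> L2" by (intro dL2) auto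
  \<comment> \<open>Square integrability of \<open>g\<close> is inherited from \<open>f N1\<close>
    and the difference \<open>f N1 - g\<close>.\<close>
  then have gL2: "g \<in> L2" using L2.diff[OF f[of N1], of "f N1 - g"] by simp
  have "(\<lambda>n. L2_inner (f n - g) (f n - g)) \<longlonglongrightarrow> 0"
  proof (rule LIMSEQ_I)
    fix e :: real assume e: "e > 0"
    then obtain N where N: "\<forall>i\<ge>N. \<forall>j\<ge>N. L2_inner (f i - f j) (f i - f j) < e / 2" using cauchy[of "e / 2"] by auto
    show "\<exists>N. \<forall>n\<ge>N. norm (L2_inner (f n - g) (f n - g) - 0) < e"
      using dL2(2)[OF N] e L2.nonneg[OF L2.diff[OF f gL2]] by (intro exI[of _ N]) (fastforce)
  qed
  then show ?thesis using gL2 by blast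
qed

section \<open>The Sobolev space and the form\<close>

text \<open>A normalisation of \<open>is_gradient\<close> in which the gradient itself belongs to
  \<open>L2\<close> and so vanishes off [0,1]. This trades set integrals for products with
  indicators.\<close>

definition has_gradient :: "(real \<Rightarrow> real) \<Rightarrow> (real \<Rightarrow> real) \<Rightarrow> bool" where
  "has_gradient f g \<longleftrightarrow> g \<in> L2 \<and> (\<forall>x\<in>{0..1}. f x = (\<integral>t. indicator {0..x} t * g t \<partial>lborel))"

lemma has_gradient_of_is_gradient:
  assumes "is_gradient f g"
  shows "has_gradient f (\<lambda>t. indicator {0..1} t * g t)"
proof -
  have "(indicator {0..1} t * g t)\<^sup>2 = indicator {0..1} t *\<^sub>R (g t)\<^sup>2" for t
    by (simp add: indicator_def)
  moreover have "(\<lambda>t. indicator {0..x} t * (indicator {0..1} t * g t)) = (\<lambda>t. indicator {0..x} t *\<^sub>R g t)"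
    if "x \<in> {0..1}" for x using that by (auto simp: indicator_def fun_eq_iff)
  ultimately show ?thesis using assms
    unfolding has_gradient_def is_gradient_def L2_def set_borel_measurable_def set_integrable_def
      set_lebesgue_integral_def by (auto simp del: real_scaleR_def) (auto)
qed

lemma is_gradient_of_has_gradient:
  assumes "has_gradient f g"
  shows "is_gradient f g"
proof -
  have "(\<lambda>t. indicator {0..1} t *\<^sub>R g t) \<in> L2"
    using L2_mult_indicator[of g "{0..1}"] assms by (auto simp: has_gradient_def)
  moreover have "integrable lborel (\<lambda>t. indicator {0..1} t *\<^sub>R (g t)\<^sup>2)"
    using assms by (intro integrable_mult_indicator) (auto simp: has_gradient_def L2_def)
  ultimately show ?thesis using assms
    unfolding has_gradient_def is_gradient_def L2_def set_borel_measurable_def set_integrable_def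
      set_lebesgue_integral_def by auto
qed

lemma has_gradient_increment:
  assumes f: "has_gradient f g" and xy: "0 \<le> x" "x \<le> y" "y \<le> 1"
  shows "f y - f x = (\<integral>t. indicator {x<..y} t * g t \<partial>lborel)"
proof -
  note int = integrable_indicator_L2[of g]
  have g: "g \<in> L2" using f by (simp add: has_gradient_def)
  have "f y = (\<integral>t. indicator {0..x} t * g t + indicator {x<..y} t * g t \<partial>lborel)"
    using f xy unfolding has_gradient_def
    by (auto intro!: Bochner_Integration.integral_cong simp: indicator_def)
  also have "\<dots> = f x + (\<integral>t. indicator {x<..y} t * g t \<partial>lborel)"
    using f xy by (subst Bochner_Integration.integral_add) (auto simp: int g has_gradient_def)
  finally show ?thesis by simp
qed

text \<open>All integrals of \<open>d\<close> over rays \<open>{x<..}\<close> vanish, so its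
  positive and negative parts are densities of measures that agree on rays and hence coincide;
  densities are unique almost everywhere.\<close>

lemma L2_AE_zero:
  assumes d: "d \<in> L2" and null: "\<And>x. x \<in> {0..1} \<Longrightarrow> (\<integral>t. indicator {0..x} t * d t \<partial>lborel) = 0"
  shows "AE t in lborel. d t = 0"
proof -
  have [measurable]: "d \<in> borel_measurable borel" using d by (simp add: L2_def)
  have int: "integrable lborel d" using d by (rule integrable_L2)
  have d0: "d t = 0" if "t \<notin> {0..1}" for t using d that by (simp add: L2_def)
  have total: "(\<integral>t. d t \<partial>lborel) = 0"
  proof -
    have "(\<integral>t. d t \<partial>lborel) = (\<integral>t. indicator {0..1} t * d t \<partial>lborel)"
      using d0 by (intro Bochner_Integration.integral_cong) (auto simp: indicator_def)
    then show ?thesis using null[of 1] by simp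
  qed
  have up: "(\<integral>t. indicator {x<..} t * d t \<partial>lborel) = 0" for x
  proof -
    have A: "indicator {x<..} t * d t = d t - indicator {0..x} t * d t" for t
      using d0[of t] by (auto simp: indicator_def)
    have B: "(\<integral>t. indicator {0..x} t * d t \<partial>lborel) = 0"
    proof -
      consider "x < 0" | "x \<in> {0..1}" | "1 < x" by force
      then show ?thesis
      proof cases
        case 3
        then have "(\<integral>t. indicator {0..x} t * d t \<partial>lborel) = (\<integral>t. d t \<partial>lborel)"
          by (intro Bochner_Integration.integral_cong refl) (use d0 in \<open>force simp: indicator_def\<close>)
        then show ?thesis by (simp add: total)
      qed (use null in auto)
    qed
    have "integrable lborel (\<lambda>t. indicator {0..x} t * d t)"
      using d by (intro integrable_indicator_L2) auto
    then show ?thesis unfolding A using int B total by simp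
  qed
  define p where "p t = max 0 (d t)" for t
  define n where "n t = max 0 (- d t)" for t
  have pn: "integrable lborel p" "integrable lborel n" unfolding p_def n_def using int by auto
  have ipn: "integrable lborel (\<lambda>t. indicator {x<..} t * p t)" "integrable lborel (\<lambda>t. indicator {x<..} t * n t)" for x
    using pn integrable_mult_indicator[of "{x<..}" lborel p] integrable_mult_indicator[of "{x<..}" lborel n]
    by auto
  have em: "emeasure (density lborel (\<lambda>t. ennreal (h t))) {x<..} = ennreal (\<integral>t. indicator {x<..} t * h t \<partial>lborel)"
    if "integrable lborel (\<lambda>t. indicator {x<..} t * h t)" "\<And>t. 0 \<le> h t" "h \<in> borel_measurable borel"
    for h :: "real \<Rightarrow> real" and x
  proof -
    have "emeasure (density lborel (\<lambda>t. ennreal (h t))) {x<..} = (\<integral>\<^sup>+t. ennreal (indicator {x<..} t * h t) \<partial>lborel)"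
      using that borel_open[OF open_greaterThan, of x]
      by (subst emeasure_density) (auto intro!: nn_integral_cong split: split_indicator)
    also have "\<dots> = ennreal (\<integral>t. indicator {x<..} t * h t \<partial>lborel)"
      using that by (intro nn_integral_eq_integral) auto
    finally show ?thesis .
  qed
  have eq: "(\<integral>t. indicator {x<..} t * p t \<partial>lborel) = (\<integral>t. indicator {x<..} t * n t \<partial>lborel)" for x
  proof -
    have "indicator {x<..} t * d t = indicator {x<..} t * p t - indicator {x<..} t * n t" for t
      by (auto simp: indicator_def p_def n_def)
    then show ?thesis using up[of x] ipn[of x] by simp
  qed
  have p: "\<And>t. 0 \<le> p t" "p \<in> borel_measurable borel" and n: "\<And>t. 0 \<le> n t" "n \<in> borel_measurable borel"
    by (auto simp: p_def[abs_def] n_def[abs_def])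
  have "density lborel (\<lambda>t. ennreal (p t)) = density lborel (\<lambda>t. ennreal (n t))"
    by (rule measure_eqI_lessThan) (use eq in \<open>auto simp: em[OF ipn(1) p] em[OF ipn(2) n]\<close>)
  then have "AE t in lborel. ennreal (p t) = ennreal (n t)"
    using p n by (intro sigma_finite_measure.density_unique[OF sigma_finite_lborel]) auto
  then show ?thesis by eventually_elim (auto simp: p n, auto simp: p_def n_def max_def split: if_splits)
qed

lemma has_gradient_unique:
  assumes "has_gradient f g" "has_gradient f g'"
  shows "AE t in lborel. g t = g' t"
proof -
  have g: "g \<in> L2" "g' \<in> L2" using assms by (auto simp: has_gradient_def)
  have "AE t in lborel. (g - g') t = 0"
  proof (rule L2_AE_zero)
    fix x :: real assume x: "x \<in> {0..1}"
    then show "(\<integral>t. indicator {0..x} t * (g - g') t \<partial>lborel) = 0"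
      using assms by (simp add: right_diff_distrib integrable_indicator_L2 g has_gradient_def)
  qed (use g in \<open>intro L2.diff\<close>)
  then show ?thesis by simp
qed

text \<open>\<open>gradient\<close> is an arbitrary choice, but gradients are unique almost
  everywhere, so any pair of them may be used to compute the form.\<close>

lemma form_eq:
  assumes "has_gradient f g" "has_gradient h k"
  shows "form f h = L2_inner g k"
proof -
  define G where "G f t = indicator {0..1} t * gradient f t" for f t
  have grad: "has_gradient f (G f)" if "has_gradient f g" for f g
    unfolding G_def[abs_def] gradient_def
    using that by (intro has_gradient_of_is_gradient) (metis is_gradient_of_has_gradient someI)
  have G: "G f \<in> L2" "G h \<in> L2" and gk: "g \<in> L2" "k \<in> L2"
    using assms grad by (auto simp: has_gradient_def)
  have "form f h = (\<integral>t. indicator {0<..<1} t * (G f t * G h t) \<partial>lborel)"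
    unfolding form_def set_lebesgue_integral_def
    by (intro Bochner_Integration.integral_cong) (auto simp: G_def indicator_def)
  also have "\<dots> = (\<integral>t. g t * k t \<partial>lborel)"
  proof (rule integral_cong_AE)
    \<comment> \<open>\<open>form\<close> integrates over the open interval while \<open>L2\<close>
      lives on the closed one; the two endpoints are a null set.\<close>
    have "AE t in lborel. t \<noteq> (0::real)" "AE t in lborel. t \<noteq> (1::real)" by (rule AE_lborel_singleton)+
    with has_gradient_unique[OF assms(1) grad[OF assms(1)]] has_gradient_unique[OF assms(2) grad[OF assms(2)]]
    show "AE t in lborel. indicator {0<..<1} t * (G f t * G h t) = g t * k t"
    proof eventually_elim
      case (elim t)
      then show ?case by (auto simp: indicator_def G_def)
    qed
  qed (use G gk in \<open>auto simp: L2_def\<close>)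
  finally show ?thesis by (simp add: L2_inner_def)
qed

lemma has_gradient_add:
  assumes "has_gradient f g" "has_gradient h k"
  shows "has_gradient (f + h) (g + k)"
proof -
  have g: "g \<in> L2" "k \<in> L2" using assms by (auto simp: has_gradient_def)
  show ?thesis using assms L2.add[OF g]
    by (auto simp: has_gradient_def distrib_left integrable_indicator_L2 g)
qed

lemma has_gradient_scale:
  assumes "has_gradient f g"
  shows "has_gradient (fun_scale c f) (fun_scale c g)"
  using assms L2.scale[of g c] by (simp add: has_gradient_def fun_scale_def mult.left_commute)

lemma H10_has_gradient: "f \<in> H10 \<Longrightarrow> \<exists>g. has_gradient f g"
  using has_gradient_of_is_gradient by (auto simp: H10_def)

lemma H10_I:
  "has_gradient f g \<Longrightarrow> f 1 = 0 \<Longrightarrow> (\<And>x. x \<notin> {0..1} \<Longrightarrow> f x = 0) \<Longrightarrow> f \<in> H10"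
proof -
  assume g: "has_gradient f g" "f 1 = 0" "\<And>x. x \<notin> {0..1} \<Longrightarrow> f x = 0"
  have "f 0 = (\<integral>t. indicator {0..0} t * g t \<partial>lborel)" using g by (auto simp: has_gradient_def)
  also have "\<dots> = (\<integral>t. 0 \<partial>(lborel :: real measure))"
  proof (rule integral_cong_AE)
    show "AE t in lborel. indicator {0..0} t * g t = 0"
      using AE_lborel_singleton[of 0] by eventually_elim auto
  qed (use g in \<open>auto simp: has_gradient_def L2_def\<close>)
  finally show ?thesis using g is_gradient_of_has_gradient[OF g(1)] by (auto simp: H10_def)
qed

lemma H10_outside: "f \<in> H10 \<Longrightarrow> x \<notin> {0<..<1} \<Longrightarrow> f x = 0"
  unfolding H10_def by (cases "x \<in> {0..1}") (auto simp: le_less)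

interpretation E: psd_form H10 form
proof
  show "0 \<in> H10"
    by (rule H10_I[of _ 0]) (use L2.zero in \<open>auto simp: has_gradient_def\<close>)
  fix f g h c
  assume f: "f \<in> H10"
  then obtain f' where f': "has_gradient f f'" using H10_has_gradient by auto
  show "fun_scale c f \<in> H10"
    by (rule H10_I[OF has_gradient_scale[OF f']]) (use f in \<open>auto simp: fun_scale_def H10_def\<close>)
  show "0 \<le> form f f" using form_eq[OF f' f'] L2.nonneg f' by (simp add: has_gradient_def)
  { assume g: "g \<in> H10"
    then obtain g' where g': "has_gradient g g'" using H10_has_gradient by auto
    show "f + g \<in> H10"
      by (rule H10_I[OF has_gradient_add[OF f' g']]) (use f g in \<open>auto simp: H10_def\<close>)
    show "form f g = form g f"
      using form_eq[OF f' g'] form_eq[OF g' f'] f' g' L2.sym by (simp add: has_gradient_def)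
    assume h: "h \<in> H10"
    then obtain h' where h': "has_gradient h h'" using H10_has_gradient by auto
    show "form (f + g) h = form f h + form g h"
      using f' g' h' form_eq[OF has_gradient_add[OF f' g'] h'] form_eq[OF f' h'] form_eq[OF g' h'] L2.add_left
      by (simp add: has_gradient_def) }
  assume h: "h \<in> H10"
  then obtain h' where h': "has_gradient h h'" using H10_has_gradient by auto
  show "form (fun_scale c f) h = c * form f h"
    using f' h' form_eq[OF has_gradient_scale[OF f'] h'] form_eq[OF f' h'] L2.scale_left
    by (simp add: has_gradient_def)
qed

lemma has_gradient_increment_sq_le:
  assumes f: "has_gradient f g" and xy: "0 \<le> x" "x \<le> y" "y \<le> 1"
  shows "(f y - f x)\<^sup>2 \<le> (y - x) * (\<integral>t. indicator {x<..y} t * (g t)\<^sup>2 \<partial>lborel)"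
proof -
  have "{x<..y} \<subseteq> {0..1}" "g \<in> L2" using assms by (auto simp: has_gradient_def)
  then show ?thesis
    unfolding has_gradient_increment[OF f xy]
    using integral_indicator_L2_sq_le[of g "{x<..y}"] xy by simp
qed

lemma form_self: "has_gradient f g \<Longrightarrow> form f f = (\<integral>t. (g t)\<^sup>2 \<partial>lborel)"
  using form_eq[of f g f g] by (simp add: L2_inner_def power2_eq_square)

lemma H10_holder:
  assumes f: "f \<in> H10"
  shows "(f y - f x)\<^sup>2 \<le> \<bar>y - x\<bar> * form f f"
proof -
  obtain g where g: "has_gradient f g" using f H10_has_gradient by auto
  have main: "(f y - f x)\<^sup>2 \<le> (y - x) * form f f" if "0 \<le> x" "x \<le> y" "y \<le> 1" for x y
  proof -
    have "(\<integral>t. indicator {x<..y} t * (g t)\<^sup>2 \<partial>lborel) \<le> (\<integral>t. (g t)\<^sup>2 \<partial>lborel)"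
    proof (rule integral_mono)
      show "integrable lborel (\<lambda>t. indicator {x<..y} t * (g t)\<^sup>2)"
        using integrable_mult_indicator[of "{x<..y}" lborel "\<lambda>t. (g t)\<^sup>2"] g
        by (auto simp: has_gradient_def L2_def)
    qed (use g in \<open>auto simp: has_gradient_def L2_def indicator_def\<close>)
    then show ?thesis
      using has_gradient_increment_sq_le[OF g that] that form_self[OF g]
      by (smt (verit) mult_left_mono)
  qed
  \<comment> \<open>Clamping to [0,1] is a contraction that leaves the values of \<open>f\<close>
    unchanged, so the bound extends to the whole line.\<close>
  define cl where "cl z = max 0 (min 1 z)" for z :: real
  have cl01: "0 \<le> cl z" "cl z \<le> 1" for z by (auto simp: cl_def)
  have fcl: "f (cl z) = f z" for z
  proof (cases "z \<in> {0..1}")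
    case False
    then have "cl z \<notin> {0<..<1}" "z \<notin> {0<..<1}" by (auto simp: cl_def)
    then show ?thesis using H10_outside[OF f] by simp
  qed (simp add: cl_def)
  have "(f (cl y) - f (cl x))\<^sup>2 \<le> \<bar>cl y - cl x\<bar> * form f f"
  proof (cases "cl x \<le> cl y")
    case True
    then show ?thesis using main[of "cl x" "cl y"] cl01[of x] cl01[of y] by simp
  next
    case False
    then show ?thesis
      using main[of "cl y" "cl x"] cl01[of x] cl01[of y] power2_commute[of "f (cl x)" "f (cl y)"] by simp
  qed
  also have "\<dots> \<le> \<bar>y - x\<bar> * form f f"
    using E.nonneg[OF f] by (intro mult_right_mono) (auto simp: cl_def)
  finally show ?thesis by (simp add: fcl)
qed

lemma H10_sup_bound:
  assumes f: "f \<in> H10"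
  shows "(f x)\<^sup>2 \<le> form f f"
proof (cases "x \<in> {0<..<1}")
  case True
  then have "(f x - f 0)\<^sup>2 \<le> \<bar>x - 0\<bar> * form f f" by (intro H10_holder f)
  also have "\<dots> \<le> 1 * form f f" using True E.nonneg[OF f] by (intro mult_right_mono) auto
  finally show ?thesis using H10_outside[OF f, of 0] by simp
next
  case False
  then show ?thesis using H10_outside[OF f] E.nonneg[OF f] by simp
qed

lemma form_eq_0_iff:
  assumes f: "f \<in> H10"
  shows "form f f = 0 \<longleftrightarrow> f = 0"
proof
  assume "form f f = 0"
  then show "f = 0" using H10_sup_bound[OF f] by (auto simp: fun_eq_iff)
qed (use E.zero_left[OF E.zero] in simp)

lemma H10_continuous:
  assumes f: "f \<in> H10"
  shows "continuous_on S f"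
proof (intro continuous_at_imp_continuous_on ballI)
  fix x
  have "((\<lambda>y. sqrt (\<bar>y - x\<bar> * form f f)) \<longlongrightarrow> sqrt (\<bar>x - x\<bar> * form f f)) (at x)"
    by (intro tendsto_intros)
  then have "((\<lambda>y. sqrt (\<bar>y - x\<bar> * form f f)) \<longlongrightarrow> 0) (at x)" by simp
  moreover have "\<bar>f y - f x\<bar> \<le> sqrt (\<bar>y - x\<bar> * form f f)" for y
    using H10_holder[OF f, of y x] by (intro real_le_rsqrt) auto
  ultimately have "((\<lambda>y. f y - f x) \<longlongrightarrow> 0) (at x)"
    by (intro Lim_null_comparison[of "\<lambda>y. f y - f x"]) auto
  then show "isCont f x" unfolding isCont_def by (simp add: LIM_zero_iff)
qed

lemma H10_measurable: "f \<in> H10 \<Longrightarrow> f \<in> borel_measurable borel"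
  by (intro borel_measurable_continuous_onI H10_continuous)

text \<open>The gradients converge in \<open>L2\<close>, and the primitive of their limit is the
  candidate. The boundary condition at 1 survives because the value at 1 is the inner product of the
  gradient with the indicator of [0,1].\<close>

lemma H10_complete:
  assumes f: "\<And>n. f n \<in> H10"
    and cauchy: "\<And>e. 0 < e \<Longrightarrow> \<exists>N. \<forall>i\<ge>N. \<forall>j\<ge>N. form (f i - f j) (f i - f j) < e"
  shows "\<exists>F\<in>H10. (\<lambda>n. form (f n - F) (f n - F)) \<longlonglongrightarrow> 0"
proof -
  obtain g where g: "\<And>n. has_gradient (f n) (g n)" using H10_has_gradient[OF f] by metis
  then have gL: "g n \<in> L2" for n by (simp add: has_gradient_def)
  have diffg: "has_gradient (u - v) (a - b)" if "has_gradient u a" "has_gradient v b" for u v a b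
  proof -
    have "u - v = u + fun_scale (-1) v" "a - b = a + fun_scale (-1) b" by (auto simp: fun_eq_iff fun_scale_def)
    then show ?thesis using has_gradient_add[OF that(1) has_gradient_scale[OF that(2), of "-1"]] by (simp only:)
  qed
  have "form (f i - f j) (f i - f j) = L2_inner (g i - g j) (g i - g j)" for i j
    by (intro form_eq diffg g)
  then obtain G where G: "G \<in> L2" "(\<lambda>n. L2_inner (g n - G) (g n - G)) \<longlonglongrightarrow> 0"
    using L2_inner_complete[of g, OF gL] cauchy by auto
  define F where "F x = (if x \<in> {0..1} then (\<integral>t. indicator {0..x} t * G t \<partial>lborel) else 0)" for x
  have gF: "has_gradient F G" using G by (simp add: has_gradient_def F_def)
  have lim1: "(\<lambda>n. (F 1)\<^sup>2) \<longlonglongrightarrow> 0"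
  proof (rule Lim_null_comparison[OF _ G(2)])
    have "(F 1)\<^sup>2 \<le> L2_inner (g n - G) (g n - G)" for n
    proof -
      have "F 1 = (\<integral>t. indicator {0..1} t * G t \<partial>lborel)" "0 = (\<integral>t. indicator {0..1} t * g n t \<partial>lborel)"
        using g[of n] f[of n] by (auto simp: F_def has_gradient_def H10_def)
      then have "- F 1 = L2_inner (indicator {0..1}) (g n - G)"
        unfolding L2_inner_def
        by (simp add: right_diff_distrib Bochner_Integration.integral_diff integrable_L2_mult indicator_L2 gL G)
      moreover have "(L2_inner (indicator {0..1}) (g n - G))\<^sup>2
          \<le> L2_inner (indicator {0..1}) (indicator {0..1}) * L2_inner (g n - G) (g n - G)"
        by (intro L2.Cauchy_Schwarz indicator_L2 L2.diff gL G) auto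
      ultimately show ?thesis by (metis L2_inner_unit mult_1 power2_minus)
    qed
    then show "eventually (\<lambda>n. norm ((F 1)\<^sup>2) \<le> L2_inner (g n - G) (g n - G)) sequentially" by simp
  qed
  then have "F 1 = 0" by (simp add: LIMSEQ_const_iff)
  then have "F \<in> H10" by (intro H10_I[OF gF]) (auto simp: F_def)
  moreover have "form (f n - F) (f n - F) = L2_inner (g n - G) (g n - G)" for n
    by (intro form_eq diffg g gF)
  ultimately show ?thesis using G(2) by (intro bexI[of _ F]) simp_all
qed

section \<open>Eigenfunctions by the variational principle\<close>

lemma psd_form_subspace:
  assumes "psd_form V B" "W \<subseteq> V" "0 \<in> W"
    and "\<And>f g. f \<in> W \<Longrightarrow> g \<in> W \<Longrightarrow> f + g \<in> W" "\<And>f c. f \<in> W \<Longrightarrow> fun_scale c f \<in> W"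
  shows "psd_form W B"
proof -
  interpret psd_form V B by fact
  show ?thesis
    using assms(2-) by unfold_locales (auto simp: subset_iff add_left scale_left nonneg intro: sym)
qed

section \<open>The inner product of L2(\<nu>) on the Sobolev space\<close>

locale measure_on_01 =
  fixes \<nu> :: "real measure"
  assumes finite_measure_on_01: "finite_measure_on_01 \<nu>"
begin

sublocale finite_measure \<nu>
  using finite_measure_on_01 by (simp add: finite_measure_on_01_def)

lemma sets_nu [simp, measurable_cong]: "sets \<nu> = sets borel"
  using finite_measure_on_01 by (simp add: finite_measure_on_01_def)

lemma space_nu [simp]: "space \<nu> = UNIV"
  using sets_eq_imp_space_eq[OF sets_nu] by simp

abbreviation mass :: real where "mass \<equiv> measure \<nu> UNIV"

definition nu_inner :: "(real \<Rightarrow> real) \<Rightarrow> (real \<Rightarrow> real) \<Rightarrow> real" where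
  "nu_inner f g = (\<integral>x. f x * g x \<partial>\<nu>)"

lemma H10_borel_nu: "f \<in> H10 \<Longrightarrow> f \<in> borel_measurable \<nu>"
  using H10_measurable measurable_cong_sets[OF sets_nu refl] by blast

lemma integrable_H10_mult:
  assumes f: "f \<in> H10" and g: "g \<in> H10"
  shows "integrable \<nu> (\<lambda>x. f x * g x)"
proof (rule integrable_const_bound[of _ "sqrt (form f f) * sqrt (form g g)"])
  have "\<bar>f x\<bar> \<le> sqrt (form f f)" "\<bar>g x\<bar> \<le> sqrt (form g g)" for x
    using H10_sup_bound[OF f, of x] H10_sup_bound[OF g, of x] by (auto intro!: real_le_rsqrt)
  then show "AE x in \<nu>. norm (f x * g x) \<le> sqrt (form f f) * sqrt (form g g)"
    using E.nonneg f g by (auto simp: abs_mult intro!: mult_mono)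
  show "(\<lambda>x. f x * g x) \<in> borel_measurable \<nu>"
    using H10_borel_nu f g by simp
qed

sublocale N: psd_form H10 nu_inner
proof
  fix f g h c assume f: "f \<in> H10"
  { assume g: "g \<in> H10"
    show "nu_inner f g = nu_inner g f" by (simp add: nu_inner_def mult.commute)
    assume h: "h \<in> H10"
    show "nu_inner (f + g) h = nu_inner f h + nu_inner g h"
      by (simp add: nu_inner_def distrib_right integrable_H10_mult f g h) }
  show "nu_inner (fun_scale c f) h = c * nu_inner f h"
    by (simp add: nu_inner_def fun_scale_def mult.assoc)
  show "0 \<le> nu_inner f f" by (simp add: nu_inner_def)
qed (auto intro: E.zero E.add E.scale)

lemma nu_inner_le_sup:
  assumes f: "f \<in> H10" and "\<And>x. (f x)\<^sup>2 \<le> c"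
  shows "nu_inner f f \<le> mass * c"
proof -
  have "nu_inner f f \<le> (\<integral>x. c \<partial>\<nu>)"
    unfolding nu_inner_def using assms integrable_H10_mult[OF f f]
    by (intro integral_mono) (auto simp: power2_eq_square)
  then show ?thesis by simp
qed

lemma nu_inner_le_form: "f \<in> H10 \<Longrightarrow> nu_inner f f \<le> mass * form f f"
  by (intro nu_inner_le_sup H10_sup_bound)

lemma form_tendsto:
  assumes h: "\<And>n. h n \<in> H10" "F \<in> H10" "g \<in> H10" and lim: "(\<lambda>n. form (h n - F) (h n - F)) \<longlonglongrightarrow> 0"
  shows "(\<lambda>n. form (h n) g) \<longlonglongrightarrow> form F g" "(\<lambda>n. nu_inner (h n) g) \<longlonglongrightarrow> nu_inner F g"
proof -
  have "(\<lambda>n. form (h n - F) g) \<longlonglongrightarrow> 0"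
  proof -
    have "(\<lambda>n. sqrt (form (h n - F) (h n - F) * form g g)) \<longlonglongrightarrow> sqrt (0 * form g g)"
      by (intro tendsto_intros lim)
    moreover have "\<bar>form (h n - F) g\<bar> \<le> sqrt (form (h n - F) (h n - F) * form g g)" for n
      using E.Cauchy_Schwarz[of "h n - F" g] h E.diff by (intro real_le_rsqrt) auto
    ultimately show ?thesis
      by (intro Lim_null_comparison[of "\<lambda>n. form (h n - F) g"]) auto
  qed
  then show "(\<lambda>n. form (h n) g) \<longlonglongrightarrow> form F g"
    using h by (simp add: E.diff_left LIM_zero_iff)
  have "(\<lambda>n. nu_inner (h n - F) g) \<longlonglongrightarrow> 0"
  proof -
    have "(\<lambda>n. sqrt (mass * form (h n - F) (h n - F) * nu_inner g g)) \<longlonglongrightarrow> sqrt (mass * 0 * nu_inner g g)"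
      by (intro tendsto_intros lim)
    moreover have "\<bar>nu_inner (h n - F) g\<bar> \<le> sqrt (mass * form (h n - F) (h n - F) * nu_inner g g)" for n
    proof -
      have d: "h n - F \<in> H10" using h E.diff by auto
      have "(nu_inner (h n - F) g)\<^sup>2 \<le> nu_inner (h n - F) (h n - F) * nu_inner g g"
        using N.Cauchy_Schwarz[OF d] h by auto
      also have "\<dots> \<le> mass * form (h n - F) (h n - F) * nu_inner g g"
        using nu_inner_le_form[OF d] N.nonneg h by (intro mult_right_mono) auto
      finally show ?thesis by (intro real_le_rsqrt) auto
    qed
    ultimately show ?thesis
      by (intro Lim_null_comparison[of "\<lambda>n. nu_inner (h n - F) g"]) auto
  qed
  then show "(\<lambda>n. nu_inner (h n) g) \<longlonglongrightarrow> nu_inner F g"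
    using h by (simp add: N.diff_left LIM_zero_iff)
qed

text \<open>Compactness of the embedding into L2(\<nu>): bounded energy gives a common Hoelder bound
  of exponent 1/2, so Arzela-Ascoli applies. Of the uniform convergence only the Cauchy property for
  \<open>nu_inner\<close> is kept.\<close>

lemma bounded_form_subsequence:
  assumes f: "\<And>n. f n \<in> H10" "\<And>n. form (f n) (f n) \<le> 1"
  shows "\<exists>s :: nat \<Rightarrow> nat. strict_mono s \<and>
    (\<forall>e>0. \<exists>N. \<forall>i\<ge>N. \<forall>j\<ge>N. nu_inner (f (s i) - f (s j)) (f (s i) - f (s j)) < e)"
proof -
  have "\<bar>f n x\<bar> \<le> 1" for n x
    using order_trans[OF H10_sup_bound[OF f(1)] f(2)] by (simp add: abs_square_le_1)
  moreover have "\<exists>d. 0 < d \<and> (\<forall>n y. y \<in> {0..1} \<and> \<bar>x - y\<bar> < d \<longrightarrow> \<bar>f n x - f n y\<bar> < e)" if e: "e > 0" for x e :: real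
  \<comment> \<open>With energy at most 1, an increment is at most the square root of the
    distance.\<close>
  proof (intro exI[of _ "e\<^sup>2"] conjI allI impI)
    fix n y assume y: "y \<in> {0..1} \<and> \<bar>x - y\<bar> < e\<^sup>2"
    have "(f n x - f n y)\<^sup>2 \<le> \<bar>x - y\<bar> * form (f n) (f n)" by (intro H10_holder f)
    also have "\<dots> \<le> \<bar>x - y\<bar> * 1" by (intro mult_left_mono f) auto
    also have "\<dots> < e\<^sup>2" using y by simp
    finally show "\<bar>f n x - f n y\<bar> < e" using e abs_le_square_iff[of e "f n x - f n y"] by auto
  qed (use e in auto)
  ultimately obtain g s where "continuous_on {0..1::real} g" and s: "strict_mono (s :: nat \<Rightarrow> nat)"
    "\<And>e. 0 < e \<Longrightarrow> \<exists>N. \<forall>n x. n \<ge> N \<and> x \<in> {0..1} \<longrightarrow> norm (f (s n) x - g x) < e"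
    using Arzela_Ascoli[of "{0..1::real}" f 1] unfolding real_norm_def by (metis compact_Icc)
  have "\<exists>N. \<forall>i\<ge>N. \<forall>j\<ge>N. nu_inner (f (s i) - f (s j)) (f (s i) - f (s j)) < e" if e: "e > 0" for e
  proof -
    \<comment> \<open>Late members differ by at most \<open>2 * d\<close>, which makes
      \<open>nu_inner\<close> of the difference at most \<open>mass * q < e\<close>; the summand 1
      takes care of mass 0.\<close>
    define q where "q = e / (mass + 1)"
    define d where "d = sqrt q / 2"
    have "q > 0" using e measure_nonneg[of \<nu> UNIV] by (auto simp: q_def intro!: divide_pos_pos add_nonneg_pos)
    then have d: "d > 0" "4 * d\<^sup>2 = q" by (auto simp: d_def power_divide)
    obtain N where N: "\<forall>n x. n \<ge> N \<and> x \<in> {0..1} \<longrightarrow> \<bar>f (s n) x - g x\<bar> < d" using s(2)[OF d(1)] by auto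
    have "nu_inner (f (s i) - f (s j)) (f (s i) - f (s j)) < e" if ij: "i \<ge> N" "j \<ge> N" for i j
    proof -
      have "\<bar>(f (s i) - f (s j)) x\<bar> \<le> 2 * d" for x
      proof (cases "x \<in> {0..1}")
        case True
        have "\<bar>f (s i) x - g x\<bar> < d" "\<bar>f (s j) x - g x\<bar> < d" using N True ij by auto
        then show ?thesis by simp
      next
        case False
        then show ?thesis using H10_outside[OF f(1), of x] d by auto
      qed
      then have "((f (s i) - f (s j)) x)\<^sup>2 \<le> (2 * d)\<^sup>2" for x
        using d by (subst abs_le_square_iff[symmetric]) simp
      then have "nu_inner (f (s i) - f (s j)) (f (s i) - f (s j)) \<le> mass * (2 * d)\<^sup>2"
        by (intro nu_inner_le_sup E.diff f)
      also have "\<dots> = mass * e / (mass + 1)" using d by (simp add: power_mult_distrib q_def)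
      also have "\<dots> < e"
        using e add_nonneg_pos[OF measure_nonneg[of \<nu> UNIV] zero_less_one]
        by (subst pos_divide_less_eq) (auto simp: algebra_simps)
      finally show ?thesis .
    qed
    then show ?thesis by blast
  qed
  with s(1) show ?thesis by blast
qed

text \<open>On the energy-orthogonal complement \<open>U\<close> of the \<open>u i\<close>, the
  quotient of \<open>nu_inner f f\<close> by \<open>form f f\<close> attains its supremum
  \<open>\<mu>\<close>, and a maximiser is an eigenfunction for \<open>1 / \<mu>\<close>. The trial
  function \<open>w\<close> ensures \<open>1 / \<mu> \<le> x\<close>.\<close>

lemma next_eigenfunction:
  assumes I: "finite I" and u: "\<And>i. i \<in> I \<Longrightarrow> u i \<in> H10"
    and orth: "\<And>i j. i \<in> I \<Longrightarrow> j \<in> I \<Longrightarrow> form (u i) (u j) = (if i = j then 1 else 0)"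
    and eig: "\<And>i g. i \<in> I \<Longrightarrow> g \<in> H10 \<Longrightarrow> form (u i) g = l i * nu_inner (u i) g"
    and w: "w \<in> H10" "w \<noteq> 0" "\<And>i. i \<in> I \<Longrightarrow> form (u i) w = 0" "form w w \<le> x * nu_inner w w"
    and x: "0 < x"
  shows "\<exists>f\<in>H10. \<exists>l\<le>x. form f f = 1 \<and> (\<forall>i\<in>I. form (u i) f = 0) \<and> (\<forall>g\<in>H10. form f g = l * nu_inner f g)"
proof -
  define U where "U = {f \<in> H10. \<forall>i\<in>I. form (u i) f = 0}"
  have UH: "f \<in> H10" if "f \<in> U" for f using that by (simp add: U_def)
  have U: "0 \<in> U" "\<And>f g. f \<in> U \<Longrightarrow> g \<in> U \<Longrightarrow> f + g \<in> U" "\<And>f c. f \<in> U \<Longrightarrow> fun_scale c f \<in> U"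
  proof -
    have "form (u i) 0 = 0" if "i \<in> I" for i
      using E.zero_left[of "u i"] E.sym[of "u i" 0] u[OF that] E.zero by simp
    then show "0 \<in> U" by (simp add: U_def E.zero)
  qed (auto simp: U_def E.add E.scale E.add_right E.scale_right u)
  define R where "R = {nu_inner f f |f. f \<in> U \<and> form f f = 1}"
  define \<mu> where "\<mu> = Sup R"
  have bdd: "bdd_above R"
    unfolding R_def by (intro bdd_aboveI[of _ mass]) (use nu_inner_le_form UH in fastforce)
  have normalize: "nu_inner f f / form f f \<in> R" if f: "f \<in> U" "f \<noteq> 0" for f
  proof -
    have p: "form f f > 0" using E.nonneg[OF UH[OF f(1)]] form_eq_0_iff[OF UH[OF f(1)]] f by simp
    define g where "g = fun_scale (1 / sqrt (form f f)) f"
    have "form g g = 1" "nu_inner g g = nu_inner f f / form f f"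
      using p UH[OF f(1)] by (simp_all add: g_def E.scale_left E.scale_right N.scale_left N.scale_right E.scale)
    moreover have "g \<in> U" using U(3) f by (simp add: g_def)
    ultimately show ?thesis unfolding R_def by (intro CollectI exI[of _ g]) simp
  qed
  have wU: "w \<in> U" using w by (simp add: U_def)
  have wp: "form w w > 0" using E.nonneg[OF w(1)] form_eq_0_iff[OF w(1)] w(2) by simp
  have "nu_inner w w / form w w \<le> \<mu>"
    unfolding \<mu>_def by (intro cSup_upper normalize bdd wU w(2))
  moreover have "1 / x \<le> nu_inner w w / form w w" using w(4) wp x by (simp add: field_simps)
  ultimately have \<mu>x: "1 / x \<le> \<mu>" by linarith
  then have \<mu>: "\<mu> > 0" using x by (smt (verit) zero_less_divide_1_iff)
  have ray: "nu_inner f f \<le> \<mu> * form f f" if f: "f \<in> U" for f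
  proof (cases "f = 0")
    case True
    then show ?thesis using E.zero_left[OF E.zero] N.zero_left[OF E.zero] by simp
  next
    case False
    have p: "form f f > 0" using E.nonneg[OF UH[OF f]] form_eq_0_iff[OF UH[OF f]] False by simp
    have "nu_inner f f / form f f \<le> \<mu>"
      unfolding \<mu>_def by (intro cSup_upper normalize bdd f False)
    then show ?thesis using p by (simp add: field_simps)
  qed
  have "\<exists>f. f \<in> U \<and> form f f = 1 \<and> \<mu> - 1 / (real n + 1) < nu_inner f f" for n
  proof -
    have "\<mu> - 1 / (real n + 1) < Sup R" unfolding \<mu>_def[symmetric] by simp
    then obtain r where "r \<in> R" "\<mu> - 1 / (real n + 1) < r"
      using less_cSup_iff[of R] normalize[OF wU w(2)] bdd by blast
    then show ?thesis by (auto simp: R_def)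
  qed
  then obtain f where f: "\<And>n. f n \<in> U" "\<And>n. form (f n) (f n) = 1"
    "\<And>n. \<mu> - 1 / (real n + 1) < nu_inner (f n) (f n)" by metis
  obtain s :: "nat \<Rightarrow> nat" where s: "strict_mono s"
    and sc: "\<And>e. 0 < e \<Longrightarrow> \<exists>N. \<forall>i\<ge>N. \<forall>j\<ge>N. nu_inner (f (s i) - f (s j)) (f (s i) - f (s j)) < e"
    using bounded_form_subsequence[of f, OF UH[OF f(1)]] f(2) by auto
  define h where "h n = f (s n)" for n
  have hU: "h n \<in> U" and h1: "form (h n) (h n) = 1" for n using f by (auto simp: h_def)
  have hH: "h n \<in> H10" for n using hU UH by auto
  have h\<mu>: "\<mu> - 1 / (real n + 1) < nu_inner (h n) (h n)" for n
  proof -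
    have "1 / (real (s n) + 1) \<le> 1 / (real n + 1)"
      using seq_suble[OF s, of n] by (intro divide_left_mono) auto
    then show ?thesis using f(3)[of "s n"] by (simp add: h_def)
  qed
  have hle: "nu_inner (h n) (h n) \<le> \<mu>" for n using ray[OF hU[of n]] h1[of n] by simp
  have hlim: "(\<lambda>n. \<mu> - nu_inner (h n) (h n)) \<longlonglongrightarrow> 0"
  proof (rule tendsto_sandwich[of "\<lambda>_. 0" _ _ "\<lambda>n. 1 / (real n + 1)"])
    show "(\<lambda>n. 1 / (real n + 1)) \<longlonglongrightarrow> 0"
      using LIMSEQ_inverse_real_of_nat by (simp add: inverse_eq_divide add.commute)
    show "\<forall>\<^sub>F n in sequentially. \<mu> - nu_inner (h n) (h n) \<le> 1 / (real n + 1)"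
      using h\<mu> by (intro always_eventually allI) (smt (verit))
  qed (use hle in auto)
  \<comment> \<open>sums of late members of the maximising sequence nearly maximise as well, so by the parallelogram law
    the sequence is Cauchy for the form\<close>
  have "\<exists>N. \<forall>i\<ge>N. \<forall>j\<ge>N. form (h i - h j) (h i - h j) < e" if e: "e > 0" for e
  proof -
    define d where "d = e * \<mu> / 5"
    have d: "d > 0" using e \<mu> by (simp add: d_def)
    obtain N1 where N1: "\<forall>i\<ge>N1. \<forall>j\<ge>N1. nu_inner (h i - h j) (h i - h j) < d"
      using sc[OF d] by (auto simp: h_def)
    obtain N2 where N2: "\<forall>n\<ge>N2. \<mu> - nu_inner (h n) (h n) < d"
      using order_tendstoD(2)[OF hlim d] by (auto simp: eventually_sequentially)
    have "form (h i - h j) (h i - h j) < e" if ij: "i \<ge> max N1 N2" "j \<ge> max N1 N2" for i j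
    proof -
      have "nu_inner (h i + h j) (h i + h j) = 2 * nu_inner (h i) (h i) + 2 * nu_inner (h j) (h j) - nu_inner (h i - h j) (h i - h j)"
        using N.parallelogram[OF hH[of i] hH[of j]] by simp
      also have "\<dots> > 4 * \<mu> - 5 * d"
      proof -
        have "nu_inner (h i - h j) (h i - h j) < d" "\<mu> - nu_inner (h i) (h i) < d" "\<mu> - nu_inner (h j) (h j) < d"
          using N1 N2 ij by auto
        then show ?thesis by linarith
      qed
      finally have "4 * \<mu> - 5 * d < \<mu> * form (h i + h j) (h i + h j)"
        using ray[OF U(2)[OF hU[of i] hU[of j]]] by linarith
      moreover have "\<mu> * form (h i - h j) (h i - h j) = 4 * \<mu> - \<mu> * form (h i + h j) (h i + h j)"
        using E.parallelogram[OF hH[of i] hH[of j]] h1 by (simp add: right_diff_distrib)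
      ultimately have "\<mu> * form (h i - h j) (h i - h j) < 5 * d" by linarith
      also have "\<dots> = \<mu> * e" by (simp add: d_def)
      finally show ?thesis using \<mu> by simp
    qed
    then show ?thesis by blast
  qed
  then obtain F where F: "F \<in> H10" "(\<lambda>n. form (h n - F) (h n - F)) \<longlonglongrightarrow> 0"
    using H10_complete[of h, OF hH] by auto
  note flim = form_tendsto[OF hH F(1) _ F(2)]
  have "(\<lambda>n. 1 - 2 * form (h n) F + form F F) \<longlonglongrightarrow> 1 - 2 * form F F + form F F"
    by (intro tendsto_intros flim F)
  moreover have "form (h n - F) (h n - F) = 1 - 2 * form (h n) F + form F F" for n
  proof -
    have "form (h n - F) (h n - F) = form (h n) (h n) - form F (h n) - (form (h n) F - form F F)"
      using hH[of n] F(1) by (simp add: E.diff E.diff_left E.diff_right)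
    then show ?thesis using E.sym[OF F(1) hH[of n]] h1[of n] by simp
  qed
  ultimately have "(\<lambda>n. form (h n - F) (h n - F)) \<longlonglongrightarrow> 1 - 2 * form F F + form F F" by (simp only:)
  then have F1: "form F F = 1" using LIMSEQ_unique[OF F(2)] by force
  have Forth: "form (u i) F = 0" if "i \<in> I" for i
  proof -
    have "form (h n) (u i) = 0" for n
      using hU[of n] that u hH E.sym by (auto simp: U_def)
    then have "form F (u i) = 0" using flim(1)[OF u[OF that]] by (simp add: LIMSEQ_const_iff)
    then show ?thesis using E.sym F(1) u that by simp
  qed
  \<comment> \<open>Maximality of \<open>\<mu>\<close> makes \<open>Q\<close> semidefinite on
    \<open>U\<close>. Since \<open>Q (h n) (h n)\<close> tends to 0, Cauchy-Schwarz puts the limit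
    \<open>F\<close> into the null space of \<open>Q\<close>, which is the eigenvalue equation
    tested on \<open>U\<close>.\<close>
  define Q where "Q f g = \<mu> * form f g - nu_inner f g" for f g
  interpret Q: psd_form U Q
  proof
    fix f g h c assume f: "f \<in> U"
    show "0 \<le> Q f f" using ray[OF f] by (simp add: Q_def)
    { assume g: "g \<in> U"
      show "Q f g = Q g f" using f g UH E.sym N.sym by (simp add: Q_def)
      assume h: "h \<in> U"
      show "Q (f + g) h = Q f h + Q g h"
        using f g h UH by (simp add: Q_def E.add_left N.add_left distrib_left) }
    assume h: "h \<in> U"
    show "Q (fun_scale c f) h = c * Q f h"
      using f h UH by (simp add: Q_def E.scale_left N.scale_left right_diff_distrib)
  qed (use U in auto)
  have QF: "Q F g = 0" if g: "g \<in> U" for g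
  proof -
    have "(\<lambda>n. Q (h n) g) \<longlonglongrightarrow> Q F g"
      unfolding Q_def by (intro tendsto_intros flim UH g)
    moreover have "(\<lambda>n. Q (h n) g) \<longlonglongrightarrow> 0"
    proof -
      have "(\<lambda>n. sqrt ((\<mu> - nu_inner (h n) (h n)) * Q g g)) \<longlonglongrightarrow> sqrt (0 * Q g g)"
        by (intro tendsto_intros hlim)
      moreover have "\<bar>Q (h n) g\<bar> \<le> sqrt ((\<mu> - nu_inner (h n) (h n)) * Q g g)" for n
      proof -
        have "(Q (h n) g)\<^sup>2 \<le> Q (h n) (h n) * Q g g" by (intro Q.Cauchy_Schwarz hU g)
        also have "Q (h n) (h n) = \<mu> - nu_inner (h n) (h n)" by (simp add: Q_def h1)
        finally show ?thesis by (intro real_le_rsqrt) simp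
      qed
      ultimately show ?thesis by (intro Lim_null_comparison[of "\<lambda>n. Q (h n) g"]) auto
    qed
    ultimately show ?thesis using LIMSEQ_unique by blast
  qed
  have nuF: "nu_inner F (u i) = 0" if "i \<in> I" for i
  proof -
    have "form (u i) (u i) = 1" using orth that by simp
    \<comment> \<open>Energy 1 forces a nonzero eigenvalue, so orthogonality in energy carries over
      to \<open>nu_inner\<close>.\<close>
    then have "l i \<noteq> 0" using eig[OF that u[OF that]] by auto
    moreover have "l i * nu_inner (u i) F = 0" using eig[OF that F(1)] Forth[OF that] by simp
    ultimately show ?thesis using N.sym F(1) u that by simp
  qed
  have "form F g = 1 / \<mu> * nu_inner F g" if g: "g \<in> H10" for g
  proof -
    \<comment> \<open>The energy projection of \<open>g\<close> onto the span of the
      \<open>u i\<close>. \<open>F\<close> is orthogonal to it in both forms, so the equation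
      extends from \<open>U\<close> to all of \<open>H10\<close>.\<close>
    define p where "p = (\<Sum>i\<in>I. fun_scale (form (u i) g) (u i))"
    have p: "p \<in> H10" unfolding p_def by (intro E.sum_in u)
    have "form (u j) p = form (u j) g" if "j \<in> I" for j
    proof -
      have "form (u j) p = (\<Sum>i\<in>I. form (u i) g * form (u j) (u i))"
        unfolding p_def by (intro E.sum_right u that)
      also have "\<dots> = (\<Sum>i\<in>I. if i = j then form (u i) g else 0)"
        using orth that by (intro sum.cong) auto
      finally show ?thesis using I that by simp
    qed
    then have "g - p \<in> U" using u g p by (simp add: U_def E.diff E.diff_right)
    then have "\<mu> * form F (g - p) = nu_inner F (g - p)" using QF by (simp add: Q_def)
    moreover have "form F p = 0"
      unfolding p_def using F(1) u Forth E.sym by (subst E.sum_right) auto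
    moreover have "nu_inner F p = 0"
      unfolding p_def using F(1) u nuF by (subst N.sum_right) auto
    ultimately show ?thesis using \<mu> F(1) g p by (simp add: E.diff_right N.diff_right field_simps)
  qed
  moreover have "1 / \<mu> \<le> x" using \<mu>x \<mu> x by (simp add: field_simps)
  ultimately show ?thesis using F(1) F1 Forth by blast
qed

abbreviation lincomb :: "nat \<Rightarrow> (nat \<Rightarrow> real) \<Rightarrow> (nat \<Rightarrow> real \<Rightarrow> real) \<Rightarrow> real \<Rightarrow> real" where
  "lincomb n a w \<equiv> (\<Sum>i<n. fun_scale (a i) (w i))"

text \<open>One half of the min-max principle: fewer than \<open>n\<close> eigenfunctions impose
  fewer than \<open>n\<close> linear conditions on the span of the \<open>w i\<close>, so a nonzero
  trial function orthogonal to all of them remains for \<open>next_eigenfunction\<close>.\<close>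

lemma eigenfunctions_exist:
  fixes n m :: nat
  assumes w: "\<And>i. i < n \<Longrightarrow> w i \<in> H10"
    and indep: "\<And>a. \<exists>i<n. a i \<noteq> 0 \<Longrightarrow> lincomb n a w \<noteq> 0"
    and ray: "\<And>a. form (lincomb n a w) (lincomb n a w)
      \<le> x * nu_inner (lincomb n a w) (lincomb n a w)"
    and x: "0 < x" and m: "m \<le> n"
  shows "\<exists>u l. (\<forall>i<m. u i \<in> H10 \<and> l i \<le> x \<and> (\<forall>g\<in>H10. form (u i) g = l i * nu_inner (u i) g))
     \<and> (\<forall>i<m. \<forall>j<m. form (u i) (u j) = (if i = j then 1 else 0))"
  using m
proof (induction m)
  case (Suc m)
  then obtain u l where
      "\<forall>i<m. u i \<in> H10 \<and> l i \<le> x \<and> (\<forall>g\<in>H10. form (u i) g = l i * nu_inner (u i) g)"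
      "\<forall>i<m. \<forall>j<m. form (u i) (u j) = (if i = j then 1 else 0)"
    using Suc_leD by blast
  then have u: "\<And>i. i < m \<Longrightarrow> u i \<in> H10" "\<And>i. i < m \<Longrightarrow> l i \<le> x"
      "\<And>i g. i < m \<Longrightarrow> g \<in> H10 \<Longrightarrow> form (u i) g = l i * nu_inner (u i) g"
      "\<And>i j. i < m \<Longrightarrow> j < m \<Longrightarrow> form (u i) (u j) = (if i = j then 1 else 0)"
    by auto
  obtain a where a: "\<exists>i<n. a i \<noteq> 0" "\<And>k. k < m \<Longrightarrow> (\<Sum>i<n. a i * form (u k) (w i)) = 0"
    using homogeneous_system_solution[of m n "\<lambda>k i. form (u k) (w i)"] Suc.prems by auto
  define v where "v = lincomb n a w"
  have v: "v \<in> H10" unfolding v_def using w by (intro E.sum_in) auto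
  have "form (u k) v = 0" if "k < m" for k
    unfolding v_def using w u that a by (subst E.sum_right) auto
  moreover have "v \<noteq> 0" "form v v \<le> x * nu_inner v v" unfolding v_def using indep a ray by auto
  ultimately obtain f l' where f: "f \<in> H10" "l' \<le> x" "form f f = 1" "\<forall>i<m. form (u i) f = 0"
      "\<forall>g\<in>H10. form f g = l' * nu_inner f g"
    using next_eigenfunction[of "{..<m}" u l v x] u v x by auto
  have f': "form f (u i) = 0" if "i < m" for i using f(4) u(1) f(1) that E.sym by simp
  show ?case
    by (intro exI[of _ "u(m := f)"] exI[of _ "l(m := l')"])
      (use u f f' in \<open>auto simp: less_Suc_eq\<close>)
qed simp

section \<open>Eigenfunctions are affine off the support\<close>

text \<open>The support is defined pointwise; compactness turns null neighbourhoods of single points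
  into a finite null cover.\<close>

lemma null_off_supp:
  assumes "{a..b} \<inter> supp \<nu> = {}" "{a..b} \<subseteq> {0..1}"
  shows "emeasure \<nu> {a..b} = 0"
proof -
  have "\<exists>U. open U \<and> x \<in> U \<and> emeasure \<nu> U = 0" if "x \<in> {a..b}" for x
  proof -
    have "x \<notin> supp \<nu>" "x \<in> {0..1}" using assms that by blast+
    then show ?thesis by (auto simp: supp_def not_gr_zero)
  qed
  then obtain U where U: "\<And>x. x \<in> {a..b} \<Longrightarrow> open (U x) \<and> x \<in> U x \<and> emeasure \<nu> (U x) = 0" by metis
  have "compact {a..b}" by simp
  then obtain D where D: "D \<subseteq> {a..b}" "finite D" "{a..b} \<subseteq> (\<Union>x\<in>D. U x)"
    by (rule compactE_image[of _ "{a..b}" U]) (use U in auto)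
  have "emeasure \<nu> {a..b} \<le> emeasure \<nu> (\<Union>x\<in>D. U x)"
    using D U by (intro emeasure_mono) (auto intro!: borel_open open_UN)
  also have "\<dots> \<le> (\<Sum>x\<in>D. emeasure \<nu> (U x))"
    using D U by (intro emeasure_subadditive_finite) auto
  also have "\<dots> = 0" using D U by (intro sum.neutral) auto
  finally show ?thesis by simp
qed

text \<open>Test the equation with \<open>h\<close>, the difference of \<open>f\<close> and its
  chord over [a,b], extended by 0. It lives where \<nu> has no mass, so \<open>form f h = 0\<close>.
  The constant slope of the chord pairs to 0 with the gradient of \<open>h\<close>, hence
  \<open>form h h = 0\<close>.\<close>

lemma eigenfunction_affine_interval:
  assumes f: "f \<in> H10" and eig: "\<And>g. g \<in> H10 \<Longrightarrow> form f g = l * nu_inner f g"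
    and ab: "0 \<le> a" "a < b" "b \<le> 1" and off: "{a..b} \<inter> supp \<nu> = {}" and x: "x \<in> {a..b}"
  shows "f x = f a + (x - a) * ((f b - f a) / (b - a))"
proof -
  obtain g where g: "has_gradient f g" using f H10_has_gradient by auto
  then have gL: "g \<in> L2" by (simp add: has_gradient_def)
  define s where "s = (f b - f a) / (b - a)"
  define k where "k t = indicator {a<..b} t * (g t - s)" for t
  define h where "h x = (if x \<in> {a..b} then f x - f a - (x - a) * s else 0)" for x
  have kL: "k \<in> L2"
  proof -
    have "(\<lambda>t. indicator {a<..b} t * (g - fun_scale s (indicator {0..1})) t) \<in> L2"
      by (intro L2_mult_indicator L2.diff L2.scale indicator_L2 gL) auto
    also have "(\<lambda>t. indicator {a<..b} t * (g - fun_scale s (indicator {0..1})) t) = k"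
      using ab by (auto simp: k_def fun_eq_iff fun_scale_def indicator_def)
    finally show ?thesis .
  qed
  note int = integrable_indicator_L2[OF gL]
  have ints: "integrable lborel (\<lambda>t. s * indicator {a<..y} t)" for y
    by (intro integrable_mult_right integrable_real_indicator) (cases "a \<le> y"; simp)+
  have prim: "(\<integral>t. indicator {a<..y} t * (g t - s) \<partial>lborel) = f y - f a - (y - a) * s"
    if "a \<le> y" "y \<le> b" for y
  proof -
    have "(\<integral>t. indicator {a<..y} t * (g t - s) \<partial>lborel) = (\<integral>t. indicator {a<..y} t * g t - s * indicator {a<..y} t \<partial>lborel)"
      by (intro Bochner_Integration.integral_cong) (auto simp: algebra_simps)
    also have "\<dots> = (f y - f a) - s * (y - a)"
      using that ab by (subst Bochner_Integration.integral_diff[OF int ints])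
        (auto simp: has_gradient_increment[OF g])
    finally show ?thesis by simp
  qed
  have hb: "f b - f a - (b - a) * s = 0" using ab by (simp add: s_def)
  have hk: "has_gradient h k"
    unfolding has_gradient_def
  proof (intro conjI ballI kL)
    fix y :: real assume y: "y \<in> {0..1}"
    consider "y < a" | "a \<le> y" "y \<le> b" | "b < y" by linarith
    then show "h y = (\<integral>t. indicator {0..y} t * k t \<partial>lborel)"
    proof cases
      case 1
      then have "(\<lambda>t. indicator {0..y} t * k t) = (\<lambda>_. 0)" by (auto simp: k_def indicator_def)
      then show ?thesis using 1 by (simp add: h_def)
    next
      case 2
      then have "(\<lambda>t. indicator {0..y} t * k t) = (\<lambda>t. indicator {a<..y} t * (g t - s))"
        using ab by (auto simp: k_def indicator_def fun_eq_iff)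
      then show ?thesis using 2 prim[of y] by (simp add: h_def)
    next
      case 3
      then have "(\<lambda>t. indicator {0..y} t * k t) = (\<lambda>t. indicator {a<..b} t * (g t - s))"
        using ab by (auto simp: k_def indicator_def fun_eq_iff)
      then show ?thesis using 3 prim[of b] hb ab by (simp add: h_def)
    qed
  qed
  have hH: "h \<in> H10"
  proof (rule H10_I[OF hk])
    show "h 1 = 0" using hb ab H10_outside[OF f, of 1] by (auto simp: h_def)
  qed (use ab in \<open>auto simp: h_def\<close>)
  have "nu_inner f h = 0"
  proof -
    have "{a..b} \<in> null_sets \<nu>"
      using null_off_supp[OF off] ab by (auto simp: null_sets_def)
    then have "AE x in \<nu>. x \<notin> {a..b}" by (rule AE_not_in)
    then have "AE x in \<nu>. f x * h x = 0" by eventually_elim (auto simp: h_def)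
    then show ?thesis unfolding nu_inner_def by (rule integral_eq_zero_AE)
  qed
  then have "form f h = 0" using eig[OF hH] by simp
  then have gk: "(\<integral>t. g t * k t \<partial>lborel) = 0" using form_eq[OF g hk] by (simp add: L2_inner_def)
  \<comment> \<open>On \<open>{a<..b}\<close> the function \<open>k\<close> equals
    \<open>g - s\<close>, elsewhere 0; hence \<open>k\<^sup>2 = g * k - s * k\<close>.\<close>
  have "form h h = (\<integral>t. g t * k t - s * k t \<partial>lborel)"
    unfolding form_self[OF hk]
    by (intro Bochner_Integration.integral_cong) (auto simp: k_def indicator_def power2_eq_square algebra_simps)
  also have "\<dots> = 0 - s * (\<integral>t. k t \<partial>lborel)"
    using integrable_L2_mult[OF gL kL] integrable_L2[OF kL] gk by simp
  also have "(\<integral>t. k t \<partial>lborel) = 0" using prim[of b] hb ab by (simp add: k_def)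
  finally have "h = 0" using form_eq_0_iff[OF hH] by simp
  then have "h x = 0" by simp
  then show ?thesis using x by (simp add: h_def s_def)
qed

text \<open>The form domain is contained in \<open>H10\<close>, so only affinity is at stake. A
  component of the complement of the support need not be compact; affinity is known on compact
  subintervals and is spread by comparison with one fixed chord.\<close>

lemma eigenfunction_in_eigenspace:
  assumes f: "f \<in> H10" and eig: "\<And>g. g \<in> H10 \<Longrightarrow> form f g = l * nu_inner f g"
  shows "f \<in> eigenspace \<nu> l"
proof -
  have "\<exists>a b. \<forall>x\<in>K. f x = a * x + b" if K: "K \<in> components ({0..1} - supp \<nu>)" for K
  proof (cases "\<exists>p\<in>K. \<exists>q\<in>K. p < q")
    case False
    then show ?thesis
    proof (cases "K = {}")
      case False
      then obtain p where "p \<in> K" by auto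
      then have "K = {p}" using \<open>\<not> (\<exists>p\<in>K. \<exists>q\<in>K. p < q)\<close> by (auto simp: not_less) (metis order_antisym)
      then show ?thesis by (intro exI[of _ 0] exI[of _ "f p"]) auto
    qed simp
  next
    case True
    then obtain p q where pq: "p \<in> K" "q \<in> K" "p < q" by auto
    have sub: "K \<subseteq> {0..1} - supp \<nu>" and conn: "is_interval K"
      using K in_components_subset in_components_connected is_interval_connected_1 by blast+
    have line: "f z = f y + (z - y) * ((f w - f y) / (w - y))" if "y \<in> K" "w \<in> K" "y < w" "z \<in> {y..w}" for y z w
    proof -
      have "{y..w} \<subseteq> K" using conn that(1,2) unfolding is_interval_1 by (meson atLeastAtMost_iff subsetI)
      then have "{y..w} \<inter> supp \<nu> = {}" using sub by blast
      moreover have "0 \<le> y" "w \<le> 1" using that(1,2) sub by auto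
      ultimately show ?thesis using that(3,4) by (intro eigenfunction_affine_interval[OF f eig])
    qed
    \<comment> \<open>Slope of the fixed chord over [p,q]. For \<open>x\<close> beyond it, the chord
      of the longer interval passes through the same two points and so has the same slope.\<close>
    define m where "m = (f q - f p) / (q - p)"
    have "f x = m * x + (f p - m * p)" if x: "x \<in> K" for x
    proof -
      consider "x < p" | "p \<le> x" "x \<le> q" | "q < x" by linarith
      then show ?thesis
      proof cases
        case 1
        define r where "r = (f q - f x) / (q - x)"
        have "f p = f x + (p - x) * r" using line[of x q p] x pq 1 by (auto simp: r_def)
        moreover have "f q = f x + (q - x) * r" using pq 1 by (simp add: r_def)
        ultimately have "f q - f p = r * (q - p)" "f x = f p - (p - x) * r" by (auto simp: algebra_simps)
        then have "m = r" using pq by (simp add: m_def)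
        then show ?thesis using \<open>f x = f p - (p - x) * r\<close> by (simp add: algebra_simps)
      next
        case 2
        then have "f x = f p + (x - p) * m" using line[of p q x] pq by (auto simp: m_def)
        then show ?thesis by (simp add: algebra_simps)
      next
        case 3
        define r where "r = (f x - f p) / (x - p)"
        have "f q = f p + (q - p) * r" using line[of p x q] x pq 3 by (auto simp: r_def)
        moreover have "f x = f p + (x - p) * r" using pq 3 by (simp add: r_def)
        ultimately have "m = r" using pq by (simp add: m_def)
        then show ?thesis using \<open>f x = f p + (x - p) * r\<close> by (simp add: algebra_simps)
      qed
    qed
    then show ?thesis by blast
  qed
  then have "f \<in> form_dom \<nu>" using f H10_continuous[OF f] by (auto simp: form_dom_def C_affine_def)
  then show ?thesis using eig by (auto simp: eigenspace_def form_dom_def nu_inner_def)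
qed

end

section \<open>Eigenvalue counting and partitions\<close>

interpretation fs: vector_space fun_scale
  by (rule vector_space_fun_scale)

lemma form_dom_subset_H10: "form_dom \<nu> \<subseteq> H10"
  by (simp add: form_dom_def)

lemma form_dom_subspace:
  "0 \<in> form_dom \<nu>" "f \<in> form_dom \<nu> \<Longrightarrow> g \<in> form_dom \<nu> \<Longrightarrow> f + g \<in> form_dom \<nu>"
  "f \<in> form_dom \<nu> \<Longrightarrow> fun_scale c f \<in> form_dom \<nu>"
proof -
  show "0 \<in> form_dom \<nu>"
    unfolding form_dom_def C_affine_def
    using E.zero H10_continuous[OF E.zero] by (auto intro!: exI[of _ 0])
next
  assume f: "f \<in> form_dom \<nu>"
  then have f': "f \<in> H10" "f \<in> C_affine \<nu>" by (auto simp: form_dom_def)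
  have "\<exists>a b. \<forall>x\<in>K. fun_scale c f x = a * x + b" if K: "K \<in> components ({0..1} - supp \<nu>)" for K
  proof -
    obtain a b where "\<forall>x\<in>K. f x = a * x + b" using f' K unfolding C_affine_def by blast
    then show ?thesis by (intro exI[of _ "c * a"] exI[of _ "c * b"]) (simp add: fun_scale_def algebra_simps)
  qed
  moreover have "fun_scale c f \<in> H10" using f' E.scale by blast
  ultimately show "fun_scale c f \<in> form_dom \<nu>"
    using H10_continuous unfolding form_dom_def C_affine_def by blast
  assume g: "g \<in> form_dom \<nu>"
  then have g': "g \<in> H10" "g \<in> C_affine \<nu>" by (auto simp: form_dom_def)
  have "\<exists>a b. \<forall>x\<in>K. (f + g) x = a * x + b" if K: "K \<in> components ({0..1} - supp \<nu>)" for K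
  proof -
    obtain a b where "\<forall>x\<in>K. f x = a * x + b" using f' K unfolding C_affine_def by blast
    moreover obtain a' b' where "\<forall>x\<in>K. g x = a' * x + b'" using g' K unfolding C_affine_def by blast
    ultimately show ?thesis by (intro exI[of _ "a + a'"] exI[of _ "b + b'"]) (simp add: algebra_simps)
  qed
  moreover have "f + g \<in> H10" using f' g' E.add by blast
  ultimately show "f + g \<in> form_dom \<nu>"
    using H10_continuous unfolding form_dom_def C_affine_def by blast
qed

lemma sum_indicator_Ioc:
  fixes c :: "nat \<Rightarrow> real"
  assumes "m \<le> n" "\<And>k. k \<in> {m..<n} \<Longrightarrow> c k < c (Suc k)"
  shows "(\<Sum>k\<in>{m..<n}. indicator {c k<..c (Suc k)} t) = (indicator {c m<..c n} t :: real) \<and> c m \<le> c n"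
  using assms
proof (induction n rule: dec_induct)
  case (step k)
  then have k: "c k < c (Suc k)" "c m \<le> c k" "(\<Sum>k\<in>{m..<k}. indicator {c k<..c (Suc k)} t) = (indicator {c m<..c k} t :: real)"
    by auto
  have "(\<Sum>k\<in>{m..<Suc k}. indicator {c k<..c (Suc k)} t) = (indicator {c m<..c k} t + indicator {c k<..c (Suc k)} t :: real)"
    using step(1) k(3) by (simp add: sum.atLeastLessThan_Suc)
  also have "\<dots> = indicator {c m<..c (Suc k)} t" using k by (auto simp: indicator_def)
  finally show ?case using k by simp
qed simp

context measure_on_01
begin

lemma eigenspaceD:
  assumes "f \<in> eigenspace \<nu> l"
  shows "f \<in> form_dom \<nu>" "f \<in> H10" "g \<in> form_dom \<nu> \<Longrightarrow> form f g = l * nu_inner f g"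
  using assms by (auto simp: eigenspace_def nu_inner_def form_dom_def)

lemma psd_form_eigenspace: "psd_form (eigenspace \<nu> l) form"
proof (rule psd_form_subspace[OF E.psd_form_axioms])
  show "eigenspace \<nu> l \<subseteq> H10" by (auto dest: eigenspaceD)
  show "0 \<in> eigenspace \<nu> l"
    using form_dom_subspace(1)[of \<nu>] form_dom_subset_H10[of \<nu>] E.zero_left
    by (auto simp: eigenspace_def)
  fix f c assume f: "f \<in> eigenspace \<nu> l"
  note f' = eigenspaceD[OF f]
  have d: "g \<in> form_dom \<nu> \<Longrightarrow> g \<in> H10" for g using form_dom_subset_H10 by auto
  show "fun_scale c f \<in> eigenspace \<nu> l"
    using f' d form_dom_subspace(3)
    by (auto simp: eigenspace_def E.scale_left N.scale_left mult.left_commute simp flip: nu_inner_def)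
  fix g assume g: "g \<in> eigenspace \<nu> l"
  note g' = eigenspaceD[OF g]
  show "f + g \<in> eigenspace \<nu> l"
    using f' g' d form_dom_subspace(2)
    by (auto simp: eigenspace_def E.add_left N.add_left distrib_left simp del: plus_fun_apply simp flip: nu_inner_def)
qed

text \<open>Strictness is what later contradicts \<open>form G G \<le> x * nu_inner G G\<close>. It
  comes from a cell of positive energy or, if no cell has any, from
  \<open>nu_inner f f = 0 < form f f\<close>.\<close>

lemma H10_le_on_vanishing_partition:
  assumes n: "2 \<le> (n::nat)" and c: "c 1 = 0" "c n = 1" "\<And>k. k \<in> {1..<n} \<Longrightarrow> c k < c (Suc k)"
    and small: "\<And>k. k \<in> {1..<n} \<Longrightarrow> measure \<nu> {c k<..c (Suc k)} * (c (Suc k) - c k) < 1 / x"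
    and x: "0 < x" and f: "f \<in> H10" "f \<noteq> 0" and vanish: "\<And>k. k \<in> {1..n} \<Longrightarrow> f (c k) = 0"
  shows "x * nu_inner f f < form f f"
proof -
  obtain g where g: "has_gradient f g" using f H10_has_gradient by auto
  have gL: "g \<in> L2" using g by (simp add: has_gradient_def)
  define A where "A k = {c k<..c (Suc k)}" for k
  define e where "e k = (\<integral>t. indicator (A k) t * (g t)\<^sup>2 \<partial>lborel)" for k
  have e0: "0 \<le> e k" for k by (simp add: e_def)
  have int: "integrable lborel (\<lambda>t. indicator B t * (g t)\<^sup>2)" if "B \<in> sets borel" for B
    using integrable_mult_indicator[of B lborel "\<lambda>t. (g t)\<^sup>2"] gL that by (auto simp: L2_def)
  have range: "0 \<le> c k" "c k \<le> 1" if "k \<in> {1..n}" for k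
    using sum_indicator_Ioc[of 1 k c] sum_indicator_Ioc[of k n c] c that by auto
  have sum_ind: "(\<Sum>k\<in>{1..<n}. indicator (A k) t) = (indicator {0<..1} t :: real)" for t
    using sum_indicator_Ioc[of 1 n c t] c n by (auto simp: A_def)
  have sum_e: "(\<Sum>k\<in>{1..<n}. e k) \<le> form f f"
  proof -
    have "(\<Sum>k\<in>{1..<n}. e k) = (\<integral>t. (\<Sum>k\<in>{1..<n}. indicator (A k) t * (g t)\<^sup>2) \<partial>lborel)"
      unfolding e_def by (rule Bochner_Integration.integral_sum[symmetric]) (auto intro!: int simp: A_def)
    also have "\<dots> = (\<integral>t. indicator {0<..1} t * (g t)\<^sup>2 \<partial>lborel)"
      by (simp only: sum_ind sum_distrib_right[symmetric])
    also have "\<dots> \<le> (\<integral>t. (g t)\<^sup>2 \<partial>lborel)"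
      using gL by (intro integral_mono int) (auto simp: L2_def indicator_def)
    finally show ?thesis using form_self[OF g] by simp
  qed
  have pointwise: "(f t)\<^sup>2 \<le> (c (Suc k) - c k) * e k" if k: "k \<in> {1..<n}" and t: "t \<in> A k" for k t
  proof -
    have ck: "0 \<le> c k" "c (Suc k) \<le> 1" "c k < c (Suc k)" using range[of k] range[of "Suc k"] c k by auto
    have "(f t - f (c k))\<^sup>2 \<le> (t - c k) * (\<integral>s. indicator {c k<..t} s * (g s)\<^sup>2 \<partial>lborel)"
      using t ck by (intro has_gradient_increment_sq_le[OF g]) (auto simp: A_def)
    also have "\<dots> \<le> (c (Suc k) - c k) * e k"
      unfolding e_def using t ck
      by (intro mult_mono integral_mono int) (auto simp: A_def indicator_def)
    finally show ?thesis using vanish[of k] k by simp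
  qed
  have "nu_inner f f \<le> (\<integral>t. (\<Sum>k\<in>{1..<n}. indicator (A k) t * ((c (Suc k) - c k) * e k)) \<partial>\<nu>)"
    unfolding nu_inner_def
  proof (rule integral_mono)
    show "integrable \<nu> (\<lambda>t. \<Sum>k\<in>{1..<n}. indicator (A k) t * ((c (Suc k) - c k) * e k))"
      by (intro Bochner_Integration.integrable_sum integrable_mult_left integrable_real_indicator)
        (auto simp: A_def less_top[symmetric])
    fix t
    show "f t * f t \<le> (\<Sum>k\<in>{1..<n}. indicator (A k) t * ((c (Suc k) - c k) * e k))"
    proof (cases "t \<in> {0<..1}")
      case True
      then have "f t * f t = (\<Sum>k\<in>{1..<n}. indicator (A k) t * (f t)\<^sup>2)"
        unfolding sum_distrib_right[symmetric] sum_ind by (simp add: power2_eq_square)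
      also have "\<dots> \<le> (\<Sum>k\<in>{1..<n}. indicator (A k) t * ((c (Suc k) - c k) * e k))"
        using pointwise by (intro sum_mono) (auto simp: indicator_def)
      finally show ?thesis .
    next
      case False
      then have "f t = 0" using H10_outside[OF f(1), of t] by force
      moreover have "0 \<le> (c (Suc k) - c k) * e k" if "k \<in> {1..<n}" for k using c that e0[of k] by (simp add: less_imp_le)
      ultimately show ?thesis by (auto intro!: sum_nonneg simp: indicator_def)
    qed
  qed (use integrable_H10_mult f in auto)
  also have "\<dots> = (\<Sum>k\<in>{1..<n}. measure \<nu> (A k) * (c (Suc k) - c k) * e k)"
    by (subst Bochner_Integration.integral_sum)
      (auto simp: A_def less_top[symmetric] mult.assoc intro!: integrable_mult_left integrable_real_indicator)
  finally have nu: "nu_inner f f \<le> (\<Sum>k\<in>{1..<n}. measure \<nu> (A k) * (c (Suc k) - c k) * e k)" .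
  have pos: "form f f > 0" using form_eq_0_iff[OF f(1)] E.nonneg[OF f(1)] f by simp
  show ?thesis
  proof (cases "\<exists>k\<in>{1..<n}. e k > 0")
    case True
    have "(\<Sum>k\<in>{1..<n}. measure \<nu> (A k) * (c (Suc k) - c k) * e k) < (\<Sum>k\<in>{1..<n}. 1 / x * e k)"
    proof (rule sum_strict_mono_ex1)
      show "\<forall>k\<in>{1..<n}. measure \<nu> (A k) * (c (Suc k) - c k) * e k \<le> 1 / x * e k"
        using small e0 unfolding A_def by (intro ballI mult_right_mono) (simp_all add: less_imp_le)
      show "\<exists>k\<in>{1..<n}. measure \<nu> (A k) * (c (Suc k) - c k) * e k < 1 / x * e k"
        using True small unfolding A_def by (metis mult_strict_right_mono)
    qed simp
    also have "\<dots> \<le> 1 / x * form f f"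
      using sum_e x by (simp add: divide_right_mono flip: sum_divide_distrib)
    finally have "nu_inner f f < 1 / x * form f f" using nu by linarith
    then show ?thesis using x by (simp add: field_simps)
  next
    case False
    then have "\<And>k. k \<in> {1..<n} \<Longrightarrow> e k = 0" using e0 by (metis less_eq_real_def)
    then have "nu_inner f f \<le> 0" using nu by simp
    then have "nu_inner f f = 0" using N.nonneg[OF f(1)] by simp
    then show ?thesis using pos by simp
  qed
qed

text \<open>Formulated for arbitrary finite families because \<open>eigen_count\<close> is
  meaningful only once finiteness is known, and finiteness is derived from this bound. Functions
  from different eigenspaces are orthogonal in both forms, so the Rayleigh bound passes to all
  combinations.\<close>

lemma eigen_family_bound:
  assumes P: "P \<in> nu_partitions \<nu>" "\<And>C. C \<in> P \<Longrightarrow> measure \<nu> C * measure lborel C < 1 / x" and x: "0 < x"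
    and L: "finite L" "\<And>l. l \<in> L \<Longrightarrow> l \<le> x"
    and B: "\<And>l. l \<in> L \<Longrightarrow> B l \<subseteq> eigenspace \<nu> l" "\<And>l. l \<in> L \<Longrightarrow> finite (B l)" "\<And>l. l \<in> L \<Longrightarrow> fs.independent (B l)"
  shows "(\<Sum>l\<in>L. card (B l)) < card P"
proof (rule ccontr)
  assume "\<not> (\<Sum>l\<in>L. card (B l)) < card P"
  then have big: "card P \<le> (\<Sum>l\<in>L. card (B l))" by simp
  obtain n :: nat and c where nc: "2 \<le> n" "c 1 = 0" "c n = 1" "\<And>k. k \<in> {1..<n} \<Longrightarrow> c k < c (Suc k)"
      "P = (\<lambda>k. {c k<..c (Suc k)}) ` {1..<n}"
    using P(1) unfolding nu_partitions_def by auto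
  have mono: "c k < c j" if "k < j" "1 \<le> k" "j \<le> n" for j k
  proof -
    have "c (Suc k) \<le> c j" using sum_indicator_Ioc[of "Suc k" j c] nc(4) that by auto
    then show ?thesis using nc(4)[of k] that by auto
  qed
  have "inj_on (\<lambda>k. {c k<..c (Suc k)}) {1..<n}"
  proof (rule inj_onI)
    fix j k assume jk: "j \<in> {1..<n}" "k \<in> {1..<n}" "{c j<..c (Suc j)} = {c k<..c (Suc k)}"
    then have "c j = c k" using nc(4)[of j] nc(4)[of k] by (metis Ioc_inj less_le_not_le)
    then show "j = k" using mono[of j k] mono[of k j] jk by (cases j k rule: linorder_cases) auto
  qed
  then have cardP: "card P = n - 1" by (simp add: nc(5) card_image)
  \<comment> \<open>Indexing by pairs of eigenvalue and function makes the cardinality the sum over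
    the eigenvalues.\<close>
  define T where "T = Sigma L B"
  have "finite T" "card T = (\<Sum>l\<in>L. card (B l))" using L B by (auto simp: T_def card_SigmaI)
  then obtain T' where T': "T' \<subseteq> T" "card T' = n - 1" "finite T'"
    using big cardP by (metis finite_subset obtain_subset_with_card_n)
  then obtain \<phi> where \<phi>: "bij_betw \<phi> {..<n - 1} T'"
    using ex_bij_betw_nat_finite[of T'] by (auto simp: atLeast0LessThan)
  \<comment> \<open>Of the division points \<open>c 1, ..., c n\<close> the ends are 0 and 1, where
    functions in \<open>H10\<close> vanish. The \<open>n - 2\<close> interior ones, written
    \<open>c (k + 2)\<close>, are the conditions on \<open>n - 1\<close> functions.\<close>
  have "n - 2 < n - 1" using nc(1) by simp
  from homogeneous_system_solution[OF this, of "\<lambda>k i. snd (\<phi> i) (c (k + 2))"]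
  obtain b where b: "\<exists>i<n-1. b i \<noteq> 0" "\<And>k. k < n - 2 \<Longrightarrow> (\<Sum>i<n-1. b i * snd (\<phi> i) (c (k + 2))) = 0"
    by blast
  define a where "a p = (if p \<in> T' then b (the_inv_into {..<n - 1} \<phi> p) else 0)" for p
  have a\<phi>: "a (\<phi> i) = b i" if "i < n - 1" for i
    using that \<phi> by (auto simp: a_def bij_betw_def the_inv_into_f_f)
  define F where "F l = (\<Sum>f\<in>B l. fun_scale (a (l, f)) f)" for l
  define G where "G = (\<Sum>l\<in>L. fun_scale 1 (F l))"
  have G_apply: "G t = (\<Sum>i<n-1. b i * snd (\<phi> i) t)" for t
  proof -
    have "G t = (\<Sum>l\<in>L. \<Sum>f\<in>B l. a (l, f) * f t)"
      by (simp only: G_def F_def sum_fun_scale_apply mult_1)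
    also have "\<dots> = (\<Sum>p\<in>T. a p * snd p t)"
      unfolding T_def using L B by (subst sum.Sigma) (auto simp: case_prod_beta)
    also have "\<dots> = (\<Sum>p\<in>T'. a p * snd p t)"
      using T' \<open>finite T\<close> by (intro sum.mono_neutral_right) (auto simp: a_def)
    also have "\<dots> = (\<Sum>i<n-1. a (\<phi> i) * snd (\<phi> i) t)"
      using \<phi> by (rule sum.reindex_bij_betw[symmetric])
    also have "\<dots> = (\<Sum>i<n-1. b i * snd (\<phi> i) t)" by (simp add: a\<phi>)
    finally show ?thesis .
  qed
  have FE: "F l \<in> eigenspace \<nu> l" if "l \<in> L" for l
    unfolding F_def using B(1)[OF that] by (intro psd_form.sum_in[OF psd_form_eigenspace]) auto
  note FE' = eigenspaceD[OF FE]
  have orth: "nu_inner (F l) (F k) = 0" "form (F l) (F k) = 0" if "l \<in> L" "k \<in> L" "l \<noteq> k" for l k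
  proof -
    have H: "F l \<in> H10" "F k \<in> H10" using FE' that by auto
    have "form (F l) (F k) = l * nu_inner (F l) (F k)" "form (F k) (F l) = k * nu_inner (F k) (F l)"
      using FE' that by auto
    then have "(l - k) * nu_inner (F l) (F k) = 0"
      using E.sym[OF H] N.sym[OF H] by (auto simp: left_diff_distrib)
    then show "nu_inner (F l) (F k) = 0" using that by simp
    then show "form (F l) (F k) = 0" using \<open>form (F l) (F k) = _\<close> by simp
  qed
  have GH: "G \<in> H10" unfolding G_def by (intro E.sum_in FE')
  have GE: "form G G = (\<Sum>l\<in>L. form (F l) (F l))"
    unfolding G_def by (subst E.orthogonal_sum) (use FE' orth in auto)
  have GN: "nu_inner G G = (\<Sum>l\<in>L. nu_inner (F l) (F l))"
    unfolding G_def by (subst N.orthogonal_sum) (use FE' orth in auto)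
  have "form (F l) (F l) \<le> x * nu_inner (F l) (F l)" if l: "l \<in> L" for l
    using FE'(3)[OF l FE'(1)[OF l]] L(2)[OF l] N.nonneg[OF FE'(2)[OF l]] by (simp add: mult_right_mono)
  then have Gx: "form G G \<le> x * nu_inner G G" unfolding GE GN sum_distrib_left by (rule sum_mono)
  have "G = 0"
  proof (rule ccontr)
    assume "G \<noteq> 0"
    have "x * nu_inner G G < form G G"
    proof (rule H10_le_on_vanishing_partition[of n c])
      fix k assume k: "k \<in> {1..<n}"
      then have "{c k<..c (Suc k)} \<in> P" using nc(5) by blast
      then show "measure \<nu> {c k<..c (Suc k)} * (c (Suc k) - c k) < 1 / x"
        using P(2)[of "{c k<..c (Suc k)}"] nc(4)[OF k] by (simp add: less_imp_le)
    next
      fix k assume k: "k \<in> {1..n}"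
      consider "k = 1" | "k = n" | "k - 2 < n - 2" "k = (k - 2) + 2" using k by fastforce
      then show "G (c k) = 0"
      proof cases
        case 3
        then show ?thesis using b(2)[of "k - 2"] G_apply by metis
      qed (use nc H10_outside[OF GH] in auto)
    qed (use nc x GH \<open>G \<noteq> 0\<close> in auto)
    then show False using Gx by simp
  qed
  \<comment> \<open>The energies of the orthogonal components \<open>F l\<close> add up to 0, so
    every component vanishes, which violates the independence of a single
    \<open>B l\<close>.\<close>
  then have "form G G = 0" using E.zero_left[OF E.zero] by simp
  then have "(\<Sum>l\<in>L. form (F l) (F l)) = 0" using GE by simp
  moreover have "0 \<le> form (F l) (F l)" if "l \<in> L" for l using E.nonneg[OF FE'(2)[OF that]] .
  ultimately have F00: "form (F l) (F l) = 0" if "l \<in> L" for l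
    using sum_nonneg_0[OF L(1), of "\<lambda>l. form (F l) (F l)"] that by blast
  have F0: "F l = 0" if "l \<in> L" for l
    by (rule iffD1[OF form_eq_0_iff[OF FE'(2)[OF that]] F00[OF that]])
  obtain i where i: "i < n - 1" "b i \<noteq> 0" using b(1) by auto
  then have "\<phi> i \<in> T'" using \<phi> by (auto simp: bij_betw_def)
  then obtain l f where lf: "\<phi> i = (l, f)" "l \<in> L" "f \<in> B l" using T'(1) by (auto simp: T_def)
  have "a (l, f) \<noteq> 0" using a\<phi>[OF i(1)] i(2) lf by simp
  then have "\<exists>v\<in>B l. a (l, v) \<noteq> 0" using lf(3) by blast
  with F0[OF lf(2), unfolded F_def]
  have "(\<exists>v\<in>B l. a (l, v) \<noteq> 0) \<and> (\<Sum>v\<in>B l. fun_scale (a (l, v)) v) = 0" by (rule conjI[rotated])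
  then have "fs.dependent (B l)"
    by (intro iffD2[OF fs.dependent_finite[OF B(2)[OF lf(2)]]] exI[of _ "\<lambda>v. a (l, v)"])
  then show False using B(3)[OF lf(2)] by simp
qed

text \<open>Infinitely many eigenvalues up to \<open>x\<close>, or an infinite-dimensional
  eigenspace among them, would supply \<open>card P\<close> independent eigenfunctions, against
  \<open>eigen_family_bound\<close>. So the sum and the dimensions in \<open>eigen_count\<close> are
  genuine.\<close>

lemma eigen_count_bounds:
  assumes P: "P \<in> nu_partitions \<nu>" "\<And>C. C \<in> P \<Longrightarrow> measure \<nu> C * measure lborel C < 1 / x" and x: "0 < x"
  shows "eigen_count \<nu> x < card P"
    and "finite L \<Longrightarrow> (\<And>l. l \<in> L \<Longrightarrow> l \<le> x) \<Longrightarrow> (\<And>l. l \<in> L \<Longrightarrow> B l \<subseteq> eigenspace \<nu> l) \<Longrightarrow>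
      (\<And>l. l \<in> L \<Longrightarrow> finite (B l)) \<Longrightarrow> (\<And>l. l \<in> L \<Longrightarrow> fs.independent (B l)) \<Longrightarrow>
      (\<Sum>l\<in>L. card (B l)) \<le> eigen_count \<nu> x"
proof -
  define S where "S = {l. is_eigenvalue \<nu> l \<and> l \<le> x}"
  have indep1: "fs.independent {f}" if "f \<noteq> 0" for f
    using that by simp
  have finS: "finite S"
  proof (rule ccontr)
    assume "infinite S"
    then obtain L where L: "L \<subseteq> S" "finite L" "card L = card P"
      using infinite_arbitrarily_large by blast
    have "\<exists>f\<in>eigenspace \<nu> l. f \<noteq> 0" if "l \<in> S" for l
      using that by (auto simp: S_def is_eigenvalue_def zero_fun_def)
    then obtain f where f: "\<And>l. l \<in> S \<Longrightarrow> f l \<in> eigenspace \<nu> l \<and> f l \<noteq> 0" by metis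
    have "(\<Sum>l\<in>L. card {f l}) < card P"
      using L f by (intro eigen_family_bound[OF P x]) (auto simp: S_def intro!: indep1)
    then show False using L by simp
  qed
  have basis: "\<exists>B. B \<subseteq> eigenspace \<nu> l \<and> finite B \<and> fs.independent B \<and> eigenspace \<nu> l \<subseteq> fs.span B
     \<and> card B = eigen_multiplicity \<nu> l" if l: "l \<le> x" for l
  proof -
    obtain B where B: "B \<subseteq> eigenspace \<nu> l" "fs.independent B" "eigenspace \<nu> l \<subseteq> fs.span B"
      using fs.maximal_independent_subset by blast
    have "finite B"
    proof (rule ccontr)
      assume "infinite B"
      then obtain B' where B': "B' \<subseteq> B" "finite B'" "card B' = card P"
        using infinite_arbitrarily_large by blast
      then have "fs.independent B'" using fs.independent_mono B by blast
      then have "(\<Sum>l\<in>{l}. card B') < card P"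
        using B B' l by (intro eigen_family_bound[OF P x]) auto
      then show False using B' by simp
    qed
    moreover have "card B = eigen_multiplicity \<nu> l"
      unfolding eigen_multiplicity_def by (intro fs.basis_card_eq_dim B)
    ultimately show ?thesis using B by blast
  qed
  obtain D where D: "\<And>l. l \<le> x \<Longrightarrow> D l \<subseteq> eigenspace \<nu> l \<and> finite (D l) \<and> fs.independent (D l)
     \<and> eigenspace \<nu> l \<subseteq> fs.span (D l) \<and> card (D l) = eigen_multiplicity \<nu> l"
    using basis by metis
  have count: "eigen_count \<nu> x = (\<Sum>l\<in>S. card (D l))"
    unfolding eigen_count_def S_def[symmetric] by (intro sum.cong) (use D in \<open>auto simp: S_def\<close>)
  have "(\<Sum>l\<in>S. card (D l)) < card P"
    by (rule eigen_family_bound[OF P x finS]) (use D in \<open>auto simp: S_def\<close>)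
  then show "eigen_count \<nu> x < card P" by (simp add: count)
  assume L: "finite L" "\<And>l. l \<in> L \<Longrightarrow> l \<le> x" and B: "\<And>l. l \<in> L \<Longrightarrow> B l \<subseteq> eigenspace \<nu> l"
      "\<And>l. l \<in> L \<Longrightarrow> finite (B l)" "\<And>l. l \<in> L \<Longrightarrow> fs.independent (B l)"
  have le: "card (B l) \<le> card (D l)" if "l \<in> L" for l
    using D[OF L(2)[OF that]] B[OF that] fs.independent_span_bound[of "D l" "B l"] by blast
  \<comment> \<open>An independent set does not contain 0, so a nonempty \<open>B l\<close> makes
    \<open>l\<close> an eigenvalue.\<close>
  have zero: "card (B l) = 0" if "l \<in> L - S" for l
  proof (rule ccontr)
    assume "card (B l) \<noteq> 0"
    then obtain f where f: "f \<in> B l" by fastforce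
    then have "f \<noteq> 0" using B that fs.dependent_zero by blast
    then have "is_eigenvalue \<nu> l" using B(1) that f by (auto simp: is_eigenvalue_def zero_fun_def)
    then show False using that L(2) by (auto simp: S_def)
  qed
  have "(\<Sum>l\<in>L. card (B l)) = (\<Sum>l\<in>L \<inter> S. card (B l))"
    using L zero by (intro sum.mono_neutral_right) auto
  also have "\<dots> \<le> (\<Sum>l\<in>L \<inter> S. card (D l))" using le by (intro sum_mono) auto
  also have "\<dots> \<le> (\<Sum>l\<in>S. card (D l))" using finS by (intro sum_mono2) auto
  finally show "(\<Sum>l\<in>L. card (B l)) \<le> eigen_count \<nu> x" by (simp add: count)
qed

section \<open>Partitions with division points off the atoms\<close>

lemma atoms_countable: "countable {x. measure \<nu> {x} \<noteq> 0}"
  using countable_support by simp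

lemma exists_nonatom:
  assumes "a < (b::real)"
  shows "\<exists>x. a < x \<and> x < b \<and> measure \<nu> {x} = 0"
proof -
  have "uncountable ({a<..<b} - {x. measure \<nu> {x} \<noteq> 0})"
    using assms by (intro uncountable_minus_countable uncountable_open_interval[THEN iffD2] atoms_countable)
  then have "{a<..<b} - {x. measure \<nu> {x} \<noteq> 0} \<noteq> {}" by (metis countable_empty)
  then show ?thesis by auto
qed

lemma measure_endpoints: "measure \<nu> {0} = 0" "measure \<nu> {1} = 0"
proof -
  have *: "emeasure \<nu> (- {0<..<1}) = 0" using finite_measure_on_01 by (simp add: finite_measure_on_01_def)
  have "emeasure \<nu> {y} = 0" if "y \<notin> {0<..<1}" for y
    using emeasure_mono[of "{y}" "- {0<..<1}" \<nu>] that * by auto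
  then show "measure \<nu> {0} = 0" "measure \<nu> {1} = 0" by (auto simp: measure_def)
qed

text \<open>Right continuity of \<open>b \<mapsto> \<nu> {a<..b}\<close> leaves room to move the division points off the atoms.\<close>

lemma perturbed_partition:
  assumes n: "1 \<le> (n::nat)" and c: "c 0 = 0" "c n = 1" "\<And>k. k < n \<Longrightarrow> c k < c (Suc k)"
    and small: "\<And>k. k < n \<Longrightarrow> measure \<nu> {c k<..c (Suc k)} * (c (Suc k) - c k) < t"
  shows "\<exists>P\<in>nu_partitions \<nu>. card P \<le> n \<and> (\<forall>C\<in>P. measure \<nu> C * measure lborel C < t)"
proof -
  define e where "e i = 1 / (real i + 1)" for i :: nat
  have e: "e \<longlonglongrightarrow> 0" using LIMSEQ_inverse_real_of_nat unfolding e_def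
    by (simp add: inverse_eq_divide add.commute)
  have ep: "e i > 0" for i by (simp add: e_def)
  have "eventually (\<lambda>i. measure \<nu> {c k<..c (Suc k) + e i} * (c (Suc k) + e i - c k) < t) sequentially"
    if k: "k < n" for k
  proof (rule order_tendstoD(2)[OF _ small[OF k]])
    have "(\<lambda>i. measure \<nu> {c k<..c (Suc k) + e i}) \<longlonglongrightarrow> measure \<nu> (\<Inter>i. {c k<..c (Suc k) + e i})"
    proof (rule finite_Lim_measure_decseq)
      have "{c k<..c (Suc k) + e (Suc i)} \<subseteq> {c k<..c (Suc k) + e i}" for i
        using frac_le[of 1 1 "real i + 1" "real (Suc i) + 1"] by (auto simp: e_def)
      then show "decseq (\<lambda>i. {c k<..c (Suc k) + e i})" by (intro decseq_SucI)
    qed auto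
    also have "(\<Inter>i. {c k<..c (Suc k) + e i}) = {c k<..c (Suc k)}"
    proof (intro equalityI subsetI)
      fix y assume y: "y \<in> (\<Inter>i. {c k<..c (Suc k) + e i})"
      have "y \<le> c (Suc k) + 0"
        by (rule LIMSEQ_le_const[OF tendsto_add[OF tendsto_const e]]) (use y in auto)
      then show "y \<in> {c k<..c (Suc k)}" using y by auto
    qed (use ep in \<open>auto intro: add_increasing2 less_imp_le\<close>)
    finally have "(\<lambda>i. measure \<nu> {c k<..c (Suc k) + e i} * (c (Suc k) + e i - c k)) \<longlonglongrightarrow>
        measure \<nu> {c k<..c (Suc k)} * (c (Suc k) + 0 - c k)"
      by (intro tendsto_intros e)
    then show "(\<lambda>i. measure \<nu> {c k<..c (Suc k) + e i} * (c (Suc k) + e i - c k)) \<longlonglongrightarrow>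
        measure \<nu> {c k<..c (Suc k)} * (c (Suc k) - c k)" by simp
  qed
  then have "eventually (\<lambda>i. \<forall>k\<in>{..<n}. measure \<nu> {c k<..c (Suc k) + e i} * (c (Suc k) + e i - c k) < t) sequentially"
    by (intro eventually_ball_finite) auto
  \<comment> \<open>Shifts shorter than every cell keep the division points in order.\<close>
  moreover have "eventually (\<lambda>i. \<forall>k\<in>{..<n}. e i < c (Suc k) - c k) sequentially"
    using c by (intro eventually_ball_finite ballI order_tendstoD(2)[OF e]) auto
  ultimately obtain i where i: "\<And>k. k < n \<Longrightarrow> measure \<nu> {c k<..c (Suc k) + e i} * (c (Suc k) + e i - c k) < t"
      "\<And>k. k < n \<Longrightarrow> e i < c (Suc k) - c k"
    using eventually_happens'[OF sequentially_bot eventually_conj] by (metis (no_types, lifting) lessThan_iff)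
  obtain d0 where d0: "\<And>k. c k < d0 k \<and> d0 k < c k + e i \<and> measure \<nu> {d0 k} = 0"
    using exists_nonatom[of "c k" "c k + e i" for k] ep[of i] by (metis less_add_same_cancel1)
  \<comment> \<open>Interior points move right by less than \<open>e i\<close>, so the new cell
    \<open>k\<close> stays inside \<open>{c k<..c (Suc k) + e i}\<close>; the ends 0 and 1 carry no
    mass and stay.\<close>
  define d where "d k = (if k = 0 then 0 else if k = n then 1 else d0 k)" for k
  have d: "c k \<le> d k" "d k \<le> c k + e i" "measure \<nu> {d k} = 0" if "k \<le> n" for k
    using d0[of k] ep[of i] c measure_endpoints that by (auto simp: d_def)
  have d_mono: "d k < d (Suc k)" if k: "k < n" for k
  proof -
    have "d k < c (Suc k)" using d(2)[of k] i(2)[OF k] k by auto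
    then show ?thesis using d(1)[of "Suc k"] k by auto
  qed
  \<comment> \<open>\<open>nu_partitions\<close> numbers its points from 1, while \<open>d\<close>
    starts at 0.\<close>
  define P where "P = (\<lambda>k. {d (k - 1)<..d (Suc k - 1)}) ` {1..<n + 1}"
  have "P \<in> nu_partitions \<nu>"
    unfolding nu_partitions_def
  proof (intro CollectI exI[of _ "n + 1"] exI[of _ "\<lambda>k. d (k - 1)"] conjI ballI)
    fix k assume "k \<in> {1..<n + 1}"
    then show "d (k - 1) < d (Suc k - 1)" using d_mono[of "k - 1"] by auto
  next
    fix k assume "k \<in> {1..n + 1}"
    then show "measure \<nu> {d (k - 1)} = 0" using d(3)[of "k - 1"] by auto
  qed (use n in \<open>auto simp: d_def P_def\<close>)
  moreover have "card P \<le> n"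
    unfolding P_def using card_image_le[of "{1..<n + 1}" "\<lambda>k. {d (k - 1)<..d (Suc k - 1)}"] by simp
  moreover have "measure \<nu> C * measure lborel C < t" if C: "C \<in> P" for C
  proof -
    obtain k where k: "k < n" "C = {d k<..d (Suc k)}"
      using C by (auto simp: P_def) (metis Suc_le_D Suc_less_eq diff_Suc_1 less_Suc_eq_le One_nat_def)
    have "measure \<nu> C * measure lborel C \<le> measure \<nu> {c k<..c (Suc k) + e i} * (c (Suc k) + e i - c k)"
    proof (rule mult_mono)
      show "measure \<nu> C \<le> measure \<nu> {c k<..c (Suc k) + e i}"
        using d(1)[of k] d(2)[of "Suc k"] k by (intro finite_measure_mono) auto
      show "measure lborel C \<le> c (Suc k) + e i - c k"
        using d(1)[of k] d(2)[of "Suc k"] d_mono[of k] k by (auto simp: less_imp_le)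
    qed auto
    also have "\<dots> < t" using i k by auto
    finally show ?thesis .
  qed
  ultimately show ?thesis by blast
qed

lemma partition_exists:
  assumes "0 < t"
  shows "\<exists>P\<in>nu_partitions \<nu>. \<forall>C\<in>P. measure \<nu> C * measure lborel C < t"
proof -
  obtain n0 :: nat where n0: "mass / t < real n0" using reals_Archimedean2 by blast
  define n where "n = n0 + 1"
  have n: "mass / t < real n" "n \<ge> 1" using n0 by (auto simp: n_def)
  have "\<exists>P\<in>nu_partitions \<nu>. card P \<le> n \<and> (\<forall>C\<in>P. measure \<nu> C * measure lborel C < t)"
  proof (rule perturbed_partition[where c = "\<lambda>k. real k / real n"])
    fix k assume "k < n"
    show "real k / real n < real (Suc k) / real n" using n by (simp add: divide_strict_right_mono)
    have eq: "real (Suc k) / real n - real k / real n = 1 / real n" by (simp flip: diff_divide_distrib)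
    have "measure \<nu> {real k / real n<..real (Suc k) / real n} * (1 / real n) \<le> mass * (1 / real n)"
      by (intro mult_right_mono finite_measure_mono) auto
    also have "\<dots> < t" using n assms by (simp add: field_simps)
    finally show "measure \<nu> {real k / real n<..real (Suc k) / real n} * (real (Suc k) / real n - real k / real n) < t"
      unfolding eq .
  qed (use n in auto)
  then show ?thesis by blast
qed

lemma partition_count_attained:
  assumes "0 < x"
  shows "\<exists>P\<in>nu_partitions \<nu>. card P = partition_count \<nu> x \<and> (\<forall>C\<in>P. measure \<nu> C * measure lborel C < 1 / x)"
proof -
  let ?S = "{card P |P. P \<in> nu_partitions \<nu> \<and> (\<forall>C\<in>P. measure \<nu> C * measure lborel C < 1 / x)}"
  have "?S \<noteq> {}" using partition_exists[of "1 / x"] assms by auto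
  then have "partition_count \<nu> x \<in> ?S" unfolding partition_count_def by (rule Inf_nat_def1)
  then show ?thesis by auto
qed

lemma partition_count_le:
  assumes "P \<in> nu_partitions \<nu>" "\<forall>C\<in>P. measure \<nu> C * measure lborel C < 1 / x"
  shows "partition_count \<nu> x \<le> card P"
  unfolding partition_count_def by (rule cInf_lower) (use assms in auto)

lemma eigen_count_less_partition_count:
  assumes "0 < x"
  shows "eigen_count \<nu> x < partition_count \<nu> x"
  using partition_count_attained[OF assms] eigen_count_bounds(1)[OF _ _ assms] by metis

text \<open>The orthonormal eigenfunctions found on \<open>H10\<close> belong to the eigenspaces of
  the restricted form by \<open>eigenfunction_in_eigenspace\<close>; sorted by eigenvalue they are
  admissible in \<open>eigen_count_bounds\<close>.\<close>

lemma eigen_count_ge: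
  assumes x: "0 < x" and w: "\<And>i. i < (n::nat) \<Longrightarrow> w i \<in> H10"
    and indep: "\<And>a. \<exists>i<n. a i \<noteq> 0 \<Longrightarrow> lincomb n a w \<noteq> 0"
    and ray: "\<And>a. form (lincomb n a w) (lincomb n a w)
      \<le> x * nu_inner (lincomb n a w) (lincomb n a w)"
  shows "n \<le> eigen_count \<nu> x"
proof -
  obtain u l where ul: "\<forall>i<n. u i \<in> H10 \<and> l i \<le> x \<and> (\<forall>g\<in>H10. form (u i) g = l i * nu_inner (u i) g)"
      "\<forall>i<n. \<forall>j<n. form (u i) (u j) = (if i = j then 1 else 0)"
    using eigenfunctions_exist[OF w indep ray x order_refl] by blast
  define B where "B k = u ` {i. i < n \<and> l i = k}" for k
  have inj: "inj_on u {..<n}"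
    by (rule inj_onI) (use ul(2) in \<open>metis lessThan_iff zero_neq_one\<close>)
  obtain P where P: "P \<in> nu_partitions \<nu>" "\<And>C. C \<in> P \<Longrightarrow> measure \<nu> C * measure lborel C < 1 / x"
    using partition_exists[of "1 / x"] x by auto
  have BH: "B k \<subseteq> H10" for k using ul by (auto simp: B_def)
  have "(\<Sum>k\<in>l ` {..<n}. card (B k)) \<le> eigen_count \<nu> x"
  proof (rule eigen_count_bounds(2)[OF P x])
    fix k assume k: "k \<in> l ` {..<n}"
    show "k \<le> x" using k ul by auto
    show "B k \<subseteq> eigenspace \<nu> k"
      using ul by (auto simp: B_def intro!: eigenfunction_in_eigenspace)
    show fin: "finite (B k)" by (simp add: B_def)
    show "fs.independent (B k)"
    proof
      assume "fs.dependent (B k)"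
      then obtain a v where a: "v \<in> B k" "a v \<noteq> 0" "(\<Sum>v\<in>B k. fun_scale (a v) v) = 0"
        using fs.dependent_finite[OF fin] by blast
      have vv: "form v' v = (if v' = v then 1 else 0)" if "v' \<in> B k" for v'
        using a(1) that ul(2) by (auto simp: B_def)
      \<comment> \<open>Pairing the vanishing combination with \<open>v\<close> isolates the
        coefficient \<open>a v\<close>.\<close>
      have "0 = form (\<Sum>v\<in>B k. fun_scale (a v) v) v"
        using a BH E.zero_left by auto
      also have "\<dots> = (\<Sum>v'\<in>B k. a v' * form v' v)"
        using a BH by (intro E.sum_left) auto
      also have "\<dots> = (\<Sum>v'\<in>B k. if v' = v then a v else 0)"
        by (intro sum.cong) (auto simp: vv)
      also have "\<dots> = a v" using a fin by simp
      finally show False using a by simp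
    qed
  qed simp_all
  also have "(\<Sum>k\<in>l ` {..<n}. card (B k)) = (\<Sum>k\<in>l ` {..<n}. card {i\<in>{..<n}. l i = k})"
  proof (intro sum.cong refl)
    fix k
    have "inj_on u {i. i < n \<and> l i = k}" using inj by (rule inj_on_subset) auto
    then show "card (B k) = card {i\<in>{..<n}. l i = k}" by (simp add: B_def card_image)
  qed
  also have "\<dots> = card {..<n}" using sum.image_gen[of "{..<n}" "\<lambda>_. 1::nat" l] by simp
  finally show ?thesis by simp
qed

end

section \<open>Trapezoidal test functions\<close>

text \<open>Zero up to \<open>a\<close>, linear up to the value 1 at \<open>p\<close>, constant
  until \<open>q\<close>, then down to 0 at \<open>b\<close>, provided \<open>b - q = p - a\<close>.
  Each clamped term is the primitive of an indicator, from which the gradient is read off.\<close>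

definition trapezoid :: "real \<Rightarrow> real \<Rightarrow> real \<Rightarrow> real \<Rightarrow> real \<Rightarrow> real" where
  "trapezoid a p q b t = (max 0 (min t p - a) - max 0 (min t b - q)) / (p - a)"

definition trapezoid_gradient :: "real \<Rightarrow> real \<Rightarrow> real \<Rightarrow> real \<Rightarrow> real \<Rightarrow> real" where
  "trapezoid_gradient a p q b t = (indicator {a<..p} t - indicator {q<..b} t) / (p - a)"

lemma integral_indicator_Ioc:
  fixes u v x :: real
  assumes "0 \<le> u" "u \<le> v" "0 \<le> x"
  shows "(\<integral>t. indicator {0..x} t * indicator {u<..v} t \<partial>lborel) = max 0 (min x v - u)"
proof -
  have eq: "(\<lambda>t. indicator {0..x} t * indicator {u<..v} t) = (indicator {u<..min x v} :: real \<Rightarrow> real)"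
    using assms by (auto simp: fun_eq_iff indicator_def)
  show ?thesis unfolding eq by (cases "u \<le> min x v") auto
qed

context
  fixes a p q b :: real
  assumes abpq: "0 \<le> a" "a < p" "p \<le> q" "q < b" "b \<le> 1" "b - q = p - a"
begin

lemma trapezoid_gradient_in_L2: "trapezoid_gradient a p q b \<in> L2"
proof -
  have "fun_scale (1 / (p - a)) (indicator {a<..p} - indicator {q<..b}) \<in> L2"
    using abpq by (intro L2.scale L2.diff indicator_L2) auto
  also have "fun_scale (1 / (p - a)) (indicator {a<..p} - indicator {q<..b}) = trapezoid_gradient a p q b"
    by (auto simp: trapezoid_gradient_def fun_scale_def fun_eq_iff)
  finally show ?thesis .
qed

lemma trapezoid_has_gradient: "has_gradient (trapezoid a p q b) (trapezoid_gradient a p q b)"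
  unfolding has_gradient_def
proof (intro conjI trapezoid_gradient_in_L2 ballI)
  fix x :: real assume x: "x \<in> {0..1}"
  have int: "integrable lborel (\<lambda>t. indicator {0..x} t * indicator {u<..v} t :: real)" if "0 \<le> u" "v \<le> 1" for u v :: real
    using that by (intro integrable_L2 L2_mult_indicator indicator_L2) auto
  have "(\<integral>t. indicator {0..x} t * trapezoid_gradient a p q b t \<partial>lborel) =
    (\<integral>t. (indicator {0..x} t * indicator {a<..p} t - indicator {0..x} t * indicator {q<..b} t) / (p - a) \<partial>lborel)"
    by (simp add: trapezoid_gradient_def right_diff_distrib)
  also have "\<dots> = trapezoid a p q b x"
    using abpq x by (simp add: int integral_indicator_Ioc trapezoid_def)
  finally show "trapezoid a p q b x = (\<integral>t. indicator {0..x} t * trapezoid_gradient a p q b t \<partial>lborel)" ..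
qed

lemma trapezoid_outside: "t \<notin> {a<..<b} \<Longrightarrow> trapezoid a p q b t = 0"
  using abpq by (auto simp: trapezoid_def max_def min_def)

lemma trapezoid_plateau: "t \<in> {p..q} \<Longrightarrow> trapezoid a p q b t = 1"
  using abpq by (auto simp: trapezoid_def max_def min_def)

lemma trapezoid_in_H10: "trapezoid a p q b \<in> H10"
  by (rule H10_I[OF trapezoid_has_gradient]) (use abpq in \<open>auto intro!: trapezoid_outside\<close>)

lemma form_trapezoid: "form (trapezoid a p q b) (trapezoid a p q b) = 2 / (p - a)"
proof -
  have eq: "(trapezoid_gradient a p q b t)\<^sup>2 = (indicator {a<..p} t + indicator {q<..b} t) / (p - a)\<^sup>2" for t
    using abpq by (auto simp: trapezoid_gradient_def indicator_def power_divide)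
  have "form (trapezoid a p q b) (trapezoid a p q b) = ((p - a) + (b - q)) / (p - a)\<^sup>2"
    unfolding form_self[OF trapezoid_has_gradient] eq using abpq
    by (simp add: Bochner_Integration.integral_add integrable_real_indicator)
  also have "\<dots> = 2 * (p - a) / (p - a)\<^sup>2" using abpq by simp
  also have "\<dots> = 2 / (p - a)"
  proof -
    have *: "2 * d / d\<^sup>2 = 2 / d" if "0 < d" for d :: real using that by (simp add: power2_eq_square)
    show ?thesis by (rule *) (use abpq in simp)
  qed
  finally show ?thesis .
qed

end

lemma form_trapezoids_disjoint:
  assumes abpq: "0 \<le> a" "a < p" "p \<le> q" "q < b" "b \<le> 1" "b - q = p - a"
    and abpq': "0 \<le> a'" "a' < p'" "p' \<le> q'" "q' < b'" "b' \<le> 1" "b' - q' = p' - a'"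
    and disj: "{a<..<b} \<inter> {a'<..<b'} = {}"
  shows "form (trapezoid a p q b) (trapezoid a' p' q' b') = 0"
proof -
  have d: "{a<..b} \<inter> {a'<..b'} = {}"
  proof (rule ccontr)
    assume "{a<..b} \<inter> {a'<..b'} \<noteq> {}"
    \<comment> \<open>Overlapping half-open intervals share more than a right end, so their
      interiors meet.\<close>
    then have "max a a' < min b b'" by auto
    then obtain t where "max a a' < t" "t < min b b'" using dense by blast
    then have "t \<in> {a<..<b} \<inter> {a'<..<b'}" by auto
    then show False using disj by blast
  qed
  have z: "trapezoid_gradient a p q b t * trapezoid_gradient a' p' q' b' t = 0" for t
  proof -
    have "t \<notin> {a<..b} \<or> t \<notin> {a'<..b'}" using d by blast
    then show ?thesis using abpq abpq' by (auto simp: trapezoid_gradient_def indicator_def)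
  qed
  then show ?thesis
    unfolding form_eq[OF trapezoid_has_gradient[OF abpq] trapezoid_has_gradient[OF abpq']] L2_inner_def z by simp
qed

lemma shrink_subset:
  assumes "bdd_below C" "bdd_above C" "0 < m"
  shows "shrink m C \<subseteq> {(Inf C + Sup C) / 2 - (Sup C - Inf C) / (2 * m)..(Inf C + Sup C) / 2 + (Sup C - Inf C) / (2 * m)}"
proof
  fix y assume "y \<in> shrink m C"
  then obtain x where x: "x \<in> C" "y = (Inf C + Sup C) / 2 + (x - (Inf C + Sup C) / 2) / m"
    by (auto simp: shrink_def Let_def)
  have "Inf C \<le> x" "x \<le> Sup C" using x assms cInf_lower cSup_upper by auto
  then have "(x - (Inf C + Sup C) / 2) / m \<le> ((Sup C - Inf C) / 2) / m"
    "- ((Sup C - Inf C) / 2) / m \<le> (x - (Inf C + Sup C) / 2) / m"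
    using assms(3) by (auto intro!: divide_right_mono simp: field_simps)
  then show "y \<in> {(Inf C + Sup C) / 2 - (Sup C - Inf C) / (2 * m)..(Inf C + Sup C) / 2 + (Sup C - Inf C) / (2 * m)}"
    by (simp add: x(2))
qed

lemma interval_open_core:
  fixes C :: "real set"
  assumes "is_interval C" "C \<noteq> {}" "bdd_below C" "bdd_above C"
  shows "{Inf C<..<Sup C} \<subseteq> C"
proof
  fix t assume t: "t \<in> {Inf C<..<Sup C}"
  then obtain x y where "x \<in> C" "x < t" "y \<in> C" "t < y"
    using cInf_less_iff[of C t] less_cSup_iff[of C t] assms by auto
  then show "t \<in> C" using assms(1) unfolding is_interval_1 by (meson less_imp_le)
qed

context measure_on_01
begin

lemma nu_inner_trapezoids_disjoint:
  assumes abpq: "0 \<le> a" "a < p" "p \<le> q" "q < b" "b \<le> 1" "b - q = p - a"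
    and abpq': "0 \<le> a'" "a' < p'" "p' \<le> q'" "q' < b'" "b' \<le> 1" "b' - q' = p' - a'"
    and disj: "{a<..<b} \<inter> {a'<..<b'} = {}"
  shows "nu_inner (trapezoid a p q b) (trapezoid a' p' q' b') = 0"
proof -
  have z: "trapezoid a p q b t * trapezoid a' p' q' b' t = 0" for t
  proof -
    have "t \<notin> {a<..<b} \<or> t \<notin> {a'<..<b'}" using disj by blast
    then show ?thesis using trapezoid_outside[OF abpq] trapezoid_outside[OF abpq'] by auto
  qed
  show ?thesis unfolding nu_inner_def z by simp
qed

lemma measure_le_nu_inner_trapezoid:
  assumes abpq: "0 \<le> a" "a < p" "p \<le> q" "q < b" "b \<le> 1" "b - q = p - a"
  shows "measure \<nu> {p..q} \<le> nu_inner (trapezoid a p q b) (trapezoid a p q b)"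
proof -
  have "measure \<nu> {p..q} = (\<integral>t. indicator {p..q} t \<partial>\<nu>)" by simp
  also have "\<dots> \<le> nu_inner (trapezoid a p q b) (trapezoid a p q b)"
    unfolding nu_inner_def
  proof (rule integral_mono)
    show "integrable \<nu> (indicator {p..q} :: real \<Rightarrow> real)"
      by (rule integrable_real_indicator) (auto simp: less_top[symmetric])
    show "integrable \<nu> (\<lambda>t. trapezoid a p q b t * trapezoid a p q b t)"
      by (intro integrable_H10_mult trapezoid_in_H10 abpq)
  qed (use trapezoid_plateau[OF abpq] in \<open>auto simp: indicator_def\<close>)
  finally show ?thesis .
qed

text \<open>Origin of the constant 4: with \<open>r C\<close> half the length of
  \<open>shrink m C\<close>, the trapezoid with plateau \<open>{p C..q C}\<close> has ramps of width
  \<open>(m - 1) * r C\<close> and energy \<open>2 / ((m - 1) * r C)\<close>. Its Rayleigh quotient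
  is at most \<open>x\<close> as soon as the measure of the plateau times \<open>2 * r C\<close> is
  at least \<open>4 / (x * (m - 1))\<close>.\<close>

lemma card_interval_family_le:
  assumes P: "P \<in> interval_families \<nu>" and m: "1 < m" and x: "0 < x"
    and big: "\<And>C. C \<in> P \<Longrightarrow> measure \<nu> (shrink m C) * measure lborel (shrink m C) \<ge> 4 / (x * (m - 1))"
  shows "card P \<le> eigen_count \<nu> x"
proof -
  define r where "r C = (Sup C - Inf C) / (2 * m)" for C :: "real set"
  define p where "p C = (Inf C + Sup C) / 2 - r C" for C :: "real set"
  define q where "q C = (Inf C + Sup C) / 2 + r C" for C :: "real set"
  define f where "f C = trapezoid (Inf C) (p C) (q C) (Sup C)" for C
  have CP: "is_interval C" "C \<noteq> {}" "C \<subseteq> {0..1}" if "C \<in> P" for C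
    using P that by (auto simp: interval_families_def)
  have bdd: "bdd_below C" "bdd_above C" if "C \<in> P" for C
    using CP(3)[OF that] by (auto intro: bdd_below_mono bdd_above_mono)
  have shr: "shrink m C \<subseteq> {p C..q C}" if "C \<in> P" for C
    using shrink_subset[OF bdd[OF that], of m] m by (simp add: p_def q_def r_def)
  have le: "Inf C \<le> Sup C" "0 \<le> Inf C" "Sup C \<le> 1" if "C \<in> P" for C
    using CP[OF that] bdd[OF that] by (auto intro!: cInf_le_cSup cInf_greatest cSup_least)
  have prod: "measure \<nu> {p C..q C} * (2 * r C) \<ge> 4 / (x * (m - 1))" if C: "C \<in> P" for C
  proof -
    have "0 \<le> r C" using le[OF C] m by (simp add: r_def)
    have "measure \<nu> (shrink m C) * measure lborel (shrink m C) \<le> measure \<nu> {p C..q C} * measure lborel {p C..q C}"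
    proof (intro mult_mono)
      show "measure \<nu> (shrink m C) \<le> measure \<nu> {p C..q C}"
        using emeasure_mono[OF shr[OF C], of \<nu>] by (simp add: measure_def enn2real_mono less_top[symmetric])
      show "measure lborel (shrink m C) \<le> measure lborel {p C..q C}"
        using emeasure_mono[OF shr[OF C], of lborel] unfolding measure_def
        by (intro enn2real_mono) (auto simp: emeasure_lborel_Icc_eq)
    qed auto
    also have "measure lborel {p C..q C} = 2 * r C" using \<open>0 \<le> r C\<close> by (simp add: p_def q_def)
    finally show ?thesis using big[OF C] by simp
  qed
  have c0: "0 < 4 / (x * (m - 1))" using x m by simp
  \<comment> \<open>A degenerate interval would make the product 0.\<close>
  have lt: "Inf C < Sup C" if C: "C \<in> P" for C
  proof (rule ccontr)
    assume "\<not> Inf C < Sup C"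
    then have "r C = 0" using le[OF C] by (simp add: r_def)
    then show False using prod[OF C] c0 by simp
  qed
  have rC: "0 < r C" "2 * m * r C = Sup C - Inf C" if "C \<in> P" for C
    using lt[OF that] m by (auto simp: r_def)
  have trap: "0 \<le> Inf C" "Inf C < p C" "p C \<le> q C" "q C < Sup C" "Sup C \<le> 1" "Sup C - q C = p C - Inf C"
    "p C - Inf C = (m - 1) * r C" if C: "C \<in> P" for C
  proof -
    have d: "p C - Inf C = (m - 1) * r C" "Sup C - q C = (m - 1) * r C"
      using rC(2)[OF C] by (auto simp: p_def q_def field_simps)
    moreover have "0 < (m - 1) * r C" using m rC[OF C] by simp
    ultimately show "Inf C < p C" "q C < Sup C" by linarith+
    show "p C \<le> q C" using rC[OF C] by (simp add: p_def q_def)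
    show "0 \<le> Inf C" "Sup C \<le> 1" using le[OF C] by auto
    show "Sup C - q C = p C - Inf C" "p C - Inf C = (m - 1) * r C" using d by auto
  qed
  have disj: "{Inf C<..<Sup C} \<inter> {Inf D<..<Sup D} = {}" if "C \<in> P" "D \<in> P" "C \<noteq> D" for C D
  proof -
    have "C \<inter> D = {}" using P that by (auto simp: interval_families_def disjoint_def)
    then show ?thesis
      using interval_open_core[OF CP(1,2) bdd, of C] interval_open_core[OF CP(1,2) bdd, of D] that by blast
  qed
  have fH: "f C \<in> H10" if "C \<in> P" for C
    unfolding f_def by (rule trapezoid_in_H10[OF trap(1-6)[OF that]])
  have ortho: "form (f C) (f D) = 0" "nu_inner (f C) (f D) = 0" if "C \<in> P" "D \<in> P" "C \<noteq> D" for C D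
    unfolding f_def
    by (rule form_trapezoids_disjoint[OF trap(1-6)[OF that(1)] trap(1-6)[OF that(2)] disj[OF that]]
          nu_inner_trapezoids_disjoint[OF trap(1-6)[OF that(1)] trap(1-6)[OF that(2)] disj[OF that]])+
  have nu_ge: "2 / (x * ((m - 1) * r C)) \<le> nu_inner (f C) (f C)" if C: "C \<in> P" for C
  proof -
    have "2 / (x * ((m - 1) * r C)) \<le> measure \<nu> {p C..q C}"
      using prod[OF C] rC[OF C] x m by (simp add: field_simps)
    also have "\<dots> \<le> nu_inner (f C) (f C)"
      unfolding f_def by (rule measure_le_nu_inner_trapezoid[OF trap(1-6)[OF C]])
    finally show ?thesis .
  qed
  have nu_pos: "0 < nu_inner (f C) (f C)" if C: "C \<in> P" for C
  proof -
    have "0 < 2 / (x * ((m - 1) * r C))" using x m rC[OF C] by simp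
    then show ?thesis using nu_ge[OF C] by linarith
  qed
  have ray: "form (f C) (f C) \<le> x * nu_inner (f C) (f C)" if C: "C \<in> P" for C
  proof -
    have "form (f C) (f C) = 2 / ((m - 1) * r C)"
      unfolding f_def form_trapezoid[OF trap(1-6)[OF C]] trap(7)[OF C] ..
    also have "\<dots> = x * (2 / (x * ((m - 1) * r C)))" using x by simp
    also have "\<dots> \<le> x * nu_inner (f C) (f C)" using nu_ge[OF C] x by (intro mult_left_mono) auto
    finally show ?thesis .
  qed
  have "finite P" using P by (simp add: interval_families_def)
  then obtain \<phi> where \<phi>: "bij_betw \<phi> {..<card P} P"
    using ex_bij_betw_nat_finite[of P] by (auto simp: atLeast0LessThan)
  then have \<phi>P: "\<phi> i \<in> P" if "i < card P" for i using that by (auto simp: bij_betw_def)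
  have \<phi>inj: "\<phi> i \<noteq> \<phi> j" if "i < card P" "j < card P" "i \<noteq> j" for i j
    using \<phi> that by (auto simp: bij_betw_def inj_on_def)
  define w where "w i = f (\<phi> i)" for i
  have wH: "w i \<in> H10" if "i < card P" for i using fH \<phi>P that by (simp add: w_def)
  have wform: "form (lincomb (card P) a w) (lincomb (card P) a w)
      = (\<Sum>i<card P. (a i)\<^sup>2 * form (w i) (w i))" for a
    by (rule E.orthogonal_sum) (use wH ortho \<phi>P \<phi>inj in \<open>auto simp: w_def\<close>)
  have wnu: "nu_inner (lincomb (card P) a w) (lincomb (card P) a w)
      = (\<Sum>i<card P. (a i)\<^sup>2 * nu_inner (w i) (w i))" for a
    by (rule N.orthogonal_sum) (use wH ortho \<phi>P \<phi>inj in \<open>auto simp: w_def\<close>)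
  show ?thesis
  proof (rule eigen_count_ge[OF x wH])
    fix a :: "nat \<Rightarrow> real" assume a: "\<exists>i<card P. a i \<noteq> 0"
    have "0 < (\<Sum>i<card P. (a i)\<^sup>2 * nu_inner (w i) (w i))"
    proof -
      obtain j where j: "j < card P" "a j \<noteq> 0" using a by auto
      show ?thesis
      proof (rule sum_pos2[of _ j])
        show "0 < (a j)\<^sup>2 * nu_inner (w j) (w j)" using j nu_pos \<phi>P by (simp add: w_def)
        show "0 \<le> (a i)\<^sup>2 * nu_inner (w i) (w i)" if "i \<in> {..<card P}" for i
          using that nu_pos[OF \<phi>P, of i] by (simp add: w_def less_imp_le)
      qed (use j in auto)
    qed
    then show "lincomb (card P) a w \<noteq> 0"
      using wnu[of a] N.zero_left[OF N.zero] by auto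
  next
    fix a :: "nat \<Rightarrow> real"
    show "form (lincomb (card P) a w) (lincomb (card P) a w) \<le> x *
       nu_inner (lincomb (card P) a w) (lincomb (card P) a w)"
      unfolding wform wnu sum_distrib_left
    proof (rule sum_mono)
      fix i assume "i \<in> {..<card P}"
      then have "(a i)\<^sup>2 * form (w i) (w i) \<le> (a i)\<^sup>2 * (x * nu_inner (w i) (w i))"
        using ray \<phi>P by (intro mult_left_mono) (auto simp: w_def)
      then show "(a i)\<^sup>2 * form (w i) (w i) \<le> x * ((a i)\<^sup>2 * nu_inner (w i) (w i))"
        by (simp add: mult.left_commute)
    qed
  qed simp
qed

text \<open>The eigenvalue count bounds the set in \<open>reduced_count\<close> from above, which
  makes its supremum of natural numbers a true one; both claims rest on this.\<close>

lemma reduced_count_bounds: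
  assumes m: "1 < m" and x: "0 < x"
  shows "reduced_count \<nu> m x \<le> eigen_count \<nu> x"
    and "P \<in> interval_families \<nu> \<Longrightarrow>
      (\<And>C. C \<in> P \<Longrightarrow> measure \<nu> (shrink m C) * measure lborel (shrink m C) \<ge> 4 / (x * (m - 1))) \<Longrightarrow>
      card P \<le> reduced_count \<nu> m x"
proof -
  let ?S = "{card P |P. P \<in> interval_families \<nu> \<and>
     (\<forall>C\<in>P. measure \<nu> (shrink m C) * measure lborel (shrink m C) \<ge> 4 / (x * (m - 1)))}"
  have le: "n \<le> eigen_count \<nu> x" if "n \<in> ?S" for n
    using that card_interval_family_le[OF _ m x] by auto
  have "{} \<in> interval_families \<nu>" by (simp add: interval_families_def)
  then have "?S \<noteq> {}" by blast
  then show "reduced_count \<nu> m x \<le> eigen_count \<nu> x"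
    unfolding reduced_count_def by (rule cSup_least) (use le in auto)
  assume P: "P \<in> interval_families \<nu>"
    "\<And>C. C \<in> P \<Longrightarrow> measure \<nu> (shrink m C) * measure lborel (shrink m C) \<ge> 4 / (x * (m - 1))"
  show "card P \<le> reduced_count \<nu> m x"
    unfolding reduced_count_def
  proof (rule cSup_upper)
    show "bdd_above ?S" using le by (intro bdd_aboveI)
  qed (use P in blast)
qed

end

section \<open>Exponents of counting functions\<close>

text \<open>The convention \<open>ln 0 = 0\<close> makes the logarithm monotone on all naturals, so
  that vanishing counts can be compared too.\<close>

lemma ln_nat_mono: "m \<le> n \<Longrightarrow> ln (real m) \<le> ln (real n)"
  by (cases "m = 0"; cases "n = 0") (auto intro: ln_ge_zero)

lemma lower_exponent_mono:
  assumes "eventually (\<lambda>x. N x \<le> N' x) at_top"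
  shows "lower_exponent N \<le> lower_exponent N'"
  unfolding lower_exponent_def
proof (rule Liminf_mono)
  show "eventually (\<lambda>x. ereal (ln (real (N x)) / ln x) \<le> ereal (ln (real (N' x)) / ln x)) at_top"
    using assms eventually_gt_at_top[of 1]
    by eventually_elim (auto intro!: divide_right_mono ln_nat_mono)
qed

lemma upper_exponent_mono:
  assumes "eventually (\<lambda>x. N x \<le> N' x) at_top"
  shows "upper_exponent N \<le> upper_exponent N'"
  unfolding upper_exponent_def
proof (rule Limsup_mono)
  show "eventually (\<lambda>x. ereal (ln (real (N x)) / ln x) \<le> ereal (ln (real (N' x)) / ln x)) at_top"
    using assms eventually_gt_at_top[of 1]
    by eventually_elim (auto intro!: divide_right_mono ln_nat_mono)
qed

lemma lower_exponent_le_upper: "lower_exponent N \<le> upper_exponent N"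
  unfolding lower_exponent_def upper_exponent_def by (rule Liminf_le_Limsup) simp

lemma lower_exponent_nonneg: "0 \<le> lower_exponent N"
  unfolding lower_exponent_def
proof (rule Liminf_bounded)
  show "eventually (\<lambda>x. 0 \<le> ereal (ln (real (N x)) / ln x)) at_top"
    using eventually_gt_at_top[of 1]
  proof eventually_elim
    case (elim x)
    have "ln (real (N x)) \<ge> 0" by (cases "N x = 0") auto
    then show ?case using elim by simp
  qed
qed

lemma const_div_ln_tendsto: "((\<lambda>x::real. c / ln x + z) \<longlongrightarrow> z) at_top"
proof -
  have "((\<lambda>x::real. c / ln x) \<longlongrightarrow> 0) at_top"
    by (rule real_tendsto_divide_at_top[OF tendsto_const ln_at_top])
  then show ?thesis using tendsto_add[OF _ tendsto_const[of z]] by force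
qed

lemma upper_exponent_le_powr:
  assumes z: "0 \<le> z" and c: "0 < c" and le: "eventually (\<lambda>x. real (N x) \<le> c * x powr z) at_top"
  shows "upper_exponent N \<le> ereal z"
proof -
  \<comment> \<open>The absolute value covers \<open>N x = 0\<close>, where the logarithm is 0 while
    \<open>ln c\<close> may be negative.\<close>
  have "upper_exponent N \<le> Limsup at_top (\<lambda>x. ereal (\<bar>ln c\<bar> / ln x + z))"
    unfolding upper_exponent_def
  proof (rule Limsup_mono)
    show "eventually (\<lambda>x. ereal (ln (real (N x)) / ln x) \<le> ereal (\<bar>ln c\<bar> / ln x + z)) at_top"
      using le eventually_gt_at_top[of 1]
    proof eventually_elim
      case (elim x)
      have l: "0 < ln x" using elim by simp
      have "ln (real (N x)) \<le> \<bar>ln c\<bar> + z * ln x"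
      proof (cases "N x = 0")
        case True
        then show ?thesis using z l by simp
      next
        case False
        then have "ln (real (N x)) \<le> ln (c * x powr z)" using elim by (intro ln_mono) auto
        also have "\<dots> = ln c + z * ln x" using c elim by (simp add: ln_mult ln_powr)
        finally show ?thesis by simp
      qed
      then have "ln (real (N x)) / ln x \<le> (\<bar>ln c\<bar> + z * ln x) / ln x"
        using l by (intro divide_right_mono) auto
      then show ?case using l by (simp add: add_divide_distrib)
    qed
  qed
  also have "\<dots> = ereal z"
    by (intro lim_imp_Limsup tendsto_ereal const_div_ln_tendsto) simp
  finally show ?thesis .
qed

lemma ln_ratio_ge:
  assumes "1 < x" "0 < c" "c * x powr z \<le> real n"
  shows "ln c / ln x + z \<le> ln (real n) / ln x"
proof -
  have "0 < c * x powr z" using assms by simp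
  then have "ln (c * x powr z) \<le> ln (real n)" using assms by (intro ln_mono) auto
  then have "ln c + z * ln x \<le> ln (real n)" using assms by (simp add: ln_mult ln_powr)
  then have "(ln c + z * ln x) / ln x \<le> ln (real n) / ln x" using assms by (intro divide_right_mono) auto
  then show ?thesis using assms by (simp add: add_divide_distrib)
qed

lemma lower_exponent_ge_powr:
  assumes c: "0 < c" and le: "eventually (\<lambda>x. c * x powr z \<le> real (N x)) at_top"
  shows "ereal z \<le> lower_exponent N"
proof -
  have "ereal z = Liminf at_top (\<lambda>x. ereal (ln c / ln x + z))"
    by (intro lim_imp_Liminf[symmetric] tendsto_ereal const_div_ln_tendsto) simp
  also have "\<dots> \<le> lower_exponent N"
    unfolding lower_exponent_def
  proof (rule Liminf_mono)
    show "eventually (\<lambda>x. ereal (ln c / ln x + z) \<le> ereal (ln (real (N x)) / ln x)) at_top"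
      using le eventually_gt_at_top[of 1] by eventually_elim (auto intro!: ln_ratio_ge c)
  qed
  finally show ?thesis .
qed

text \<open>An upper limit is bounded below by infinitely many points of one sequence tending to
  infinity. The auxiliary exponent \<open>y < z\<close> absorbs the constant
  \<open>c\<close>.\<close>

lemma upper_exponent_ge_powr:
  fixes X :: "nat \<Rightarrow> real"
  assumes c: "0 < c" and X: "filterlim X at_top sequentially"
    and le: "frequently (\<lambda>n. c * X n powr z \<le> real (N (X n))) sequentially"
  shows "ereal z \<le> upper_exponent N"
proof (rule ccontr)
  assume "\<not> ereal z \<le> upper_exponent N"
  then have "upper_exponent N < ereal z" by simp
  from ereal_dense2[OF this] obtain y where y: "upper_exponent N < ereal y" "ereal y < ereal z" by blast
  have "eventually (\<lambda>x. ereal (ln (real (N x)) / ln x) < ereal y) at_top"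
    using y(1) unfolding upper_exponent_def by (rule Limsup_lessD)
  then have 1: "eventually (\<lambda>n. ln (real (N (X n))) / ln (X n) < y) sequentially"
    using X by (auto simp: filterlim_iff)
  have "eventually (\<lambda>x. y < ln c / ln x + z) at_top"
    using y(2) by (intro order_tendstoD(1)[OF const_div_ln_tendsto]) simp
  then have 2: "eventually (\<lambda>n. y < ln c / ln (X n) + z) sequentially"
    using X by (auto simp: filterlim_iff)
  have 3: "eventually (\<lambda>n. 1 < X n) sequentially"
    using X by (auto simp: filterlim_at_top_dense)
  have "eventually (\<lambda>n. \<not> c * X n powr z \<le> real (N (X n))) sequentially"
    using 1 2 3 by eventually_elim (use ln_ratio_ge c in fastforce)
  then show False using le by (simp add: frequently_def)
qed

section \<open>Dyadic intervals\<close>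

lemma dyadic_borel [measurable]: "dyadic n k \<in> sets borel"
  by (simp add: dyadic_def)

lemma inj_dyadic: "inj (dyadic n)"
proof (rule injI)
  fix j k assume "dyadic n j = dyadic n k"
  moreover have "real j / 2 ^ n < (real j + 1) / 2 ^ n" by (simp add: divide_strict_right_mono)
  moreover have "real k / 2 ^ n < (real k + 1) / 2 ^ n" by (simp add: divide_strict_right_mono)
  ultimately have "real j / 2 ^ n = real k / 2 ^ n" unfolding dyadic_def Ioc_inj by linarith
  then show "j = k" by simp
qed

lemma sum_indicator_dyadic: "(\<Sum>k<2 ^ n. indicator (dyadic n k) t) = (indicator {0<..1} t :: real)"
proof -
  have "(\<Sum>k\<in>{0..<2 ^ n}. indicator {real k / 2 ^ n<..real (Suc k) / 2 ^ n} t) = (indicator {0<..1} t :: real)"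
    using sum_indicator_Ioc[of 0 "2 ^ n" "\<lambda>k. real k / 2 ^ n" t] by (auto simp: divide_strict_right_mono)
  then show ?thesis by (simp add: dyadic_def atLeast0LessThan add.commute)
qed

context measure_on_01
begin

lemma sum_measure_dyadic: "(\<Sum>k<2 ^ n. measure \<nu> (dyadic n k)) = mass"
proof -
  have "(\<Sum>k<2 ^ n. measure \<nu> (dyadic n k)) = (\<integral>t. (\<Sum>k<2 ^ n. indicator (dyadic n k) t) \<partial>\<nu>)"
    by (subst Bochner_Integration.integral_sum) (auto simp: less_top[symmetric])
  also have "\<dots> = measure \<nu> {0<..1}" by (simp add: sum_indicator_dyadic)
  also have "\<dots> = mass"
  proof -
    have "emeasure \<nu> (- {0<..<1}) = 0" using finite_measure_on_01 by (simp add: finite_measure_on_01_def)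
    then have "emeasure \<nu> (- {0<..1}) = 0"
      using emeasure_mono[of "- {0<..1}" "- {0<..<1}" \<nu>] by force
    then have "measure \<nu> (UNIV - {0<..1}) = 0" by (simp add: measure_def Compl_eq_Diff_UNIV)
    then show ?thesis using finite_measure_compl[of "{0<..1}"] by simp
  qed
  finally show ?thesis .
qed

section \<open>Power sums over dyadic intervals and the bisection tree\<close>

abbreviation weight :: "nat \<Rightarrow> nat \<Rightarrow> real" where
  "weight n k \<equiv> measure \<nu> (dyadic n k) / 2 ^ n"

text \<open>For nonzero \<nu> and n >= 1 this is 2 to the power n (beta_n(q) - q), so the fixed
  points of \<open>Lq_beta\<close> are the solutions of \<open>dyadic_sum n q = 1\<close>. Uncharged
  intervals contribute \<open>0 powr q = 0\<close>, even at \<open>q = 0\<close>.\<close>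

definition dyadic_sum :: "nat \<Rightarrow> real \<Rightarrow> real" where
  "dyadic_sum n q = (\<Sum>k<2 ^ n. weight n k powr q)"

lemma dyadic_ratio: "0 \<le> weight n k" "weight n k \<le> mass / 2 ^ n"
  by (auto intro!: divide_right_mono finite_measure_mono)

text \<open>For positive \<open>e\<close> the extra factor decays geometrically in \<open>n\<close>;
  this is what makes sums over all levels converge.\<close>

lemma dyadic_sum_shift:
  assumes "0 \<le> e"
  shows "dyadic_sum n (q + e) \<le> (mass / 2 ^ n) powr e * dyadic_sum n q"
  unfolding dyadic_sum_def sum_distrib_left
proof (rule sum_mono)
  fix k
  have "weight n k powr e \<le> (mass / 2 ^ n) powr e"
    using assms dyadic_ratio by (intro powr_mono2) auto
  then show "weight n k powr (q + e) \<le> (mass / 2 ^ n) powr e * weight n k powr q"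
    unfolding powr_add by (subst mult.commute) (rule mult_right_mono, auto)
qed

lemma card_bad_dyadics:
  assumes "0 < t" "0 \<le> q"
  shows "real (card {k. k < 2 ^ n \<and> t \<le> weight n k}) * t powr q \<le> dyadic_sum n q"
proof -
  let ?B = "{k. k < 2 ^ n \<and> t \<le> weight n k}"
  have "real (card ?B) * t powr q = (\<Sum>k\<in>?B. t powr q)" by simp
  also have "\<dots> \<le> (\<Sum>k\<in>?B. weight n k powr q)"
    using assms by (intro sum_mono powr_mono2) auto
  also have "\<dots> \<le> dyadic_sum n q"
    unfolding dyadic_sum_def by (intro sum_mono2) auto
  finally show ?thesis .
qed

text \<open>Division points may be atoms here, as dyadic points can be;
  \<open>perturbed_partition\<close> moves them at the end.\<close>

definition chain :: "real \<Rightarrow> real \<Rightarrow> real \<Rightarrow> nat \<Rightarrow> bool" where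
  "chain t a b N \<longleftrightarrow> (\<exists>c::nat \<Rightarrow> real. c 0 = a \<and> c N = b \<and>
     (\<forall>k<N. c k < c (Suc k) \<and> measure \<nu> {c k<..c (Suc k)} * (c (Suc k) - c k) < t))"

lemma chain_append:
  assumes "chain t a b N" "chain t b d M"
  shows "chain t a d (N + M)"
proof -
  obtain c where c: "c 0 = a" "c N = b"
      "\<And>k. k < N \<Longrightarrow> c k < c (Suc k) \<and> measure \<nu> {c k<..c (Suc k)} * (c (Suc k) - c k) < t"
    using assms(1) by (auto simp: chain_def)
  obtain c' where c': "c' 0 = b" "c' M = d"
      "\<And>k. k < M \<Longrightarrow> c' k < c' (Suc k) \<and> measure \<nu> {c' k<..c' (Suc k)} * (c' (Suc k) - c' k) < t"
    using assms(2) by (auto simp: chain_def)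
  define e where "e k = (if k \<le> N then c k else c' (k - N))" for k
  have "e k < e (Suc k) \<and> measure \<nu> {e k<..e (Suc k)} * (e (Suc k) - e k) < t" if k: "k < N + M" for k
  proof (cases "k < N")
    case True
    then show ?thesis using c(3)[of k] by (simp add: e_def)
  next
    case False
    then have "e k = c' (k - N)" "e (Suc k) = c' (Suc (k - N))" using c(2) c'(1)
      by (auto simp: e_def Suc_diff_le)
    then show ?thesis using c'(3)[of "k - N"] k False by simp
  qed
  moreover have "e 0 = a" "e (N + M) = d" using c c' by (auto simp: e_def)
  ultimately show ?thesis unfolding chain_def by blast
qed

text \<open>The stopping-time tree of bad dyadic intervals: a binary tree has one leaf more than inner nodes.\<close>

lemma dyadic_tree_chain:
  assumes "k < 2 ^ n" "\<And>j. j < 2 ^ (n + d) \<Longrightarrow> weight (n + d) j < t"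
  shows "\<exists>N\<ge>1. N \<le> 1 + (\<Sum>i<d. card {j. j < 2 ^ (n + i) \<and> t \<le> weight (n + i) j \<and> j div 2 ^ i = k})
    \<and> chain t (real k / 2 ^ n) ((real k + 1) / 2 ^ n) N"
  using assms
proof (induction d arbitrary: n k)
  case 0
  have "chain t (real k / 2 ^ n) ((real k + 1) / 2 ^ n) 1"
    unfolding chain_def using 0(2)[of k] 0(1)
    by (intro exI[of _ "\<lambda>i. (real k + real i) / 2 ^ n"]) (auto simp: dyadic_def field_simps)
  then show ?case by auto
next
  case (Suc d)
  \<comment> \<open>\<open>j div 2 ^ i = k\<close> says that interval \<open>j\<close> of level
    \<open>n + i\<close> lies in \<open>dyadic n k\<close>; these are its bad descendants of
    generation \<open>i\<close>.\<close>
  define B where "B n k i = {j. j < 2 ^ (n + i) \<and> t \<le> weight (n + i) j \<and> j div 2 ^ i = k}" for n k i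
  have B_split: "B n k (Suc i) = B (Suc n) (2 * k) i \<union> B (Suc n) (2 * k + 1) i" for i
  proof -
    have "j div 2 ^ Suc i = k \<longleftrightarrow> j div 2 ^ i = 2 * k \<or> j div 2 ^ i = 2 * k + 1" for j
      unfolding power_Suc2 div_mult2_eq by linarith
    then show ?thesis unfolding B_def by (auto simp del: power_Suc)
  qed
  have finB: "finite (B n k i)" for n k i by (simp add: B_def)
  have card_split: "card (B n k (Suc i)) = card (B (Suc n) (2 * k) i) + card (B (Suc n) (2 * k + 1) i)" for i
    unfolding B_split by (rule card_Un_disjoint) (auto simp: finB, auto simp: B_def)
  show ?case
  proof (cases "t \<le> weight n k")
    \<comment> \<open>A good interval is a cell by itself; only bad ones are bisected.\<close>
    case False
    have "chain t (real k / 2 ^ n) ((real k + 1) / 2 ^ n) 1"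
      unfolding chain_def using False
      by (intro exI[of _ "\<lambda>i. (real k + real i) / 2 ^ n"]) (auto simp: dyadic_def field_simps)
    then show ?thesis by auto
  next
    case True
    then have "B n k 0 = {k}" using Suc.prems(1) by (auto simp: B_def)
    \<comment> \<open>The bounds of the two halves carry a 1 each; the bad root, counted in
      generation 0, accounts for the second of them.\<close>
    then have total: "(\<Sum>i<Suc d. card (B n k i)) = 1 + (\<Sum>i<d. card (B (Suc n) (2 * k) i)) + (\<Sum>i<d. card (B (Suc n) (2 * k + 1) i))"
      unfolding sum.lessThan_Suc_shift by (simp add: card_split sum.distrib)
    have lt: "2 * k < 2 ^ Suc n" "2 * k + 1 < 2 ^ Suc n" using Suc.prems(1) by auto
    have IH: "\<exists>N\<ge>1. N \<le> 1 + (\<Sum>i<d. card (B (Suc n) j i)) \<and>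
        chain t (real j / 2 ^ Suc n) ((real j + 1) / 2 ^ Suc n) N" if "j < 2 ^ Suc n" for j
      unfolding B_def by (rule Suc.IH[OF that]) (use Suc.prems(2) in simp)
    obtain N1 where N1: "N1 \<ge> 1" "N1 \<le> 1 + (\<Sum>i<d. card (B (Suc n) (2 * k) i))"
        "chain t (real (2 * k) / 2 ^ Suc n) ((real (2 * k) + 1) / 2 ^ Suc n) N1"
      using IH[OF lt(1)] by blast
    obtain N2 where N2: "N2 \<ge> 1" "N2 \<le> 1 + (\<Sum>i<d. card (B (Suc n) (2 * k + 1) i))"
        "chain t (real (2 * k + 1) / 2 ^ Suc n) ((real (2 * k + 1) + 1) / 2 ^ Suc n) N2"
      using IH[OF lt(2)] by blast
    have eq: "real (2 * k) / 2 ^ Suc n = real k / 2 ^ n" "(real (2 * k) + 1) / 2 ^ Suc n = real (2 * k + 1) / 2 ^ Suc n"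
      "(real (2 * k + 1) + 1) / 2 ^ Suc n = (real k + 1) / 2 ^ n"
      by (auto simp: field_simps)
    have "chain t (real k / 2 ^ n) ((real k + 1) / 2 ^ n) (N1 + N2)"
      using chain_append N1(3) N2(3) unfolding eq by blast
    moreover have "N1 + N2 \<ge> 1" "N1 + N2 \<le> 1 + (\<Sum>i<Suc d. card (B n k i))" using N1 N2 total by auto
    ultimately show ?thesis unfolding B_def by blast
  qed
qed

text \<open>At depth \<open>L\<close> with \<open>mass / 2 ^ L < 1 / x\<close> every interval is
  good, so the bisection ends. \<open>L\<close> depends on \<open>x\<close>, and the later estimate
  of the sum is uniform in \<open>L\<close>.\<close>

lemma partition_count_le_bad_dyadics:
  assumes "0 < x"
  shows "\<exists>L. partition_count \<nu> x \<le> 1 + (\<Sum>n<L. card {k. k < 2 ^ n \<and> 1 / x \<le> weight n k})"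
proof -
  obtain L where L: "mass * x < 2 ^ L" using real_arch_pow[of 2 "mass * x"] by auto
  have "weight (0 + L) j < 1 / x" for j
  proof -
    have "weight (0 + L) j \<le> mass / 2 ^ (0 + L)" by (rule dyadic_ratio)
    also have "\<dots> < 1 / x" using L assms by (simp add: field_simps)
    finally show ?thesis .
  qed
  then obtain N where N: "N \<ge> 1"
     "N \<le> 1 + (\<Sum>n<L. card {k. k < 2 ^ (0 + n) \<and> 1 / x \<le> weight (0 + n) k \<and> k div 2 ^ n = 0})"
     "chain (1 / x) (real 0 / 2 ^ 0) ((real 0 + 1) / 2 ^ 0) N"
    using dyadic_tree_chain[of 0 0 L "1 / x"] by auto
  obtain c where "c 0 = 0" "c N = 1"
      "\<And>k. k < N \<Longrightarrow> c k < c (Suc k) \<and> measure \<nu> {c k<..c (Suc k)} * (c (Suc k) - c k) < 1 / x"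
    using N(3) by (auto simp: chain_def)
  then obtain P where P: "P \<in> nu_partitions \<nu>" "card P \<le> N" "\<forall>C\<in>P. measure \<nu> C * measure lborel C < 1 / x"
    using perturbed_partition[OF N(1), of c "1 / x"] by auto
  have "partition_count \<nu> x \<le> N" using partition_count_le[OF P(1,3)] P(2) by linarith
  also have "\<dots> \<le> 1 + (\<Sum>n<L. card {k. k < 2 ^ n \<and> 1 / x \<le> weight n k})"
    using N(2) by (rule order_trans) (auto intro!: sum_mono card_mono)
  finally show ?thesis by blast
qed

end

section \<open>The fixed points q_n and their upper limit\<close>

locale nonzero_measure_on_01 = measure_on_01 +
  assumes nonzero: "emeasure \<nu> (space \<nu>) \<noteq> 0"
begin

lemma mass_pos: "0 < mass"
  using nonzero measure_nonneg[of \<nu> UNIV] by (simp add: emeasure_eq_measure less_le)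

lemma exists_charged_dyadic: "\<exists>k<2 ^ n. 0 < measure \<nu> (dyadic n k)"
proof (rule ccontr)
  assume "\<not> ?thesis"
  then have "measure \<nu> (dyadic n k) = 0" if "k < 2 ^ n" for k
    using that measure_nonneg[of \<nu> "dyadic n k"] by (metis less_eq_real_def)
  then have "(\<Sum>k<2 ^ n. measure \<nu> (dyadic n k)) = 0" by simp
  then show False using sum_measure_dyadic[of n] mass_pos by simp
qed

lemma dyadic_sum_pos: "0 < dyadic_sum n q"
proof -
  obtain k where "k < 2 ^ n" "0 < measure \<nu> (dyadic n k)" using exists_charged_dyadic by blast
  then show ?thesis unfolding dyadic_sum_def by (intro sum_pos2[of _ k]) auto
qed

text \<open>At such levels all weights are below 1, so every charged term drops when the exponent
  grows.\<close>

lemma dyadic_sum_strict_antimono: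
  assumes n: "mass < 2 ^ n" and q: "q < q'"
  shows "dyadic_sum n q' < dyadic_sum n q"
proof -
  have "mass / 2 ^ n < 1" using n by simp
  then have less1: "weight n k < 1" for k using dyadic_ratio(2)[of n k] by linarith
  have strict: "weight n k powr q' < weight n k powr q"
    if "0 < measure \<nu> (dyadic n k)" for k
    using less1[of k] that q by (intro powr_less_mono') auto
  have "weight n k powr q' \<le> weight n k powr q" for k
  proof (cases "measure \<nu> (dyadic n k) = 0")
    case False
    then show ?thesis by (intro less_imp_le strict) (simp add: zero_less_measure_iff)
  qed simp
  moreover obtain k where "k < 2 ^ n" "0 < measure \<nu> (dyadic n k)" using exists_charged_dyadic by blast
  ultimately show ?thesis unfolding dyadic_sum_def
    using strict by (intro sum_strict_mono_ex1) auto
qed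

lemma Lq_beta_fixed_iff:
  assumes n: "1 \<le> n"
  shows "Lq_beta \<nu> n q = q \<longleftrightarrow> dyadic_sum n q = 1"
proof -
  have l: "0 < ln (2 ^ n :: real)" using n one_less_power[of "2::real" n] by (intro ln_gt_zero) auto
  have "(\<Sum>C\<in>charged_dyadics \<nu> n. measure \<nu> C powr q) = (\<Sum>k\<in>{k. k < 2 ^ n \<and> 0 < measure \<nu> (dyadic n k)}. measure \<nu> (dyadic n k) powr q)"
  proof -
    have "charged_dyadics \<nu> n = dyadic n ` {k. k < 2 ^ n \<and> 0 < measure \<nu> (dyadic n k)}"
      by (auto simp: charged_dyadics_def)
    moreover have "inj_on (dyadic n) {k. k < 2 ^ n \<and> 0 < measure \<nu> (dyadic n k)}"
      by (rule inj_on_subset[OF inj_dyadic]) simp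
    ultimately show ?thesis by (simp add: sum.reindex)
  qed
  also have "\<dots> = (\<Sum>k<2 ^ n. measure \<nu> (dyadic n k) powr q)"
    by (rule sum.mono_neutral_left) (auto simp: zero_less_measure_iff)
  also have "\<dots> = (2 ^ n) powr q * dyadic_sum n q"
    by (simp add: dyadic_sum_def sum_distrib_left powr_divide)
  finally have "Lq_beta \<nu> n q = ln ((2 ^ n) powr q * dyadic_sum n q) / ln (2 ^ n)"
    by (simp add: Lq_beta_def)
  also have "\<dots> = (q * ln (2 ^ n) + ln (dyadic_sum n q)) / ln (2 ^ n)"
    using dyadic_sum_pos[of n q] by (simp add: ln_mult ln_powr del: ln_realpow)
  also have "\<dots> = q + ln (dyadic_sum n q) / ln (2 ^ n)"
    using l by (simp add: add_divide_distrib del: ln_realpow)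
  finally show ?thesis using l dyadic_sum_pos[of n q] by (simp del: ln_realpow)
qed

lemma dyadic_sum_0_ge: "1 \<le> dyadic_sum n 0"
proof -
  obtain k where k: "k < 2 ^ n" "0 < measure \<nu> (dyadic n k)" using exists_charged_dyadic by blast
  have "weight n k powr 0 \<le> dyadic_sum n 0"
    unfolding dyadic_sum_def using k(1) by (intro member_le_sum) auto
  then show ?thesis using k(2) by simp
qed

text \<open>The sum is at least 1 at exponent 0 and equals \<open>mass / 2 ^ n\<close> at exponent
  1. Continuity gives a solution and strict monotonicity its uniqueness, which justifies the
  \<open>THE\<close> in \<open>q_fixed\<close>.\<close>

lemma q_fixed_props:
  assumes n: "1 \<le> n" "mass < 2 ^ n"
  shows "0 \<le> q_fixed \<nu> n" "dyadic_sum n (q_fixed \<nu> n) = 1"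
proof -
  have "dyadic_sum n 1 = (\<Sum>k<2 ^ n. measure \<nu> (dyadic n k)) / 2 ^ n"
    by (simp add: dyadic_sum_def powr_one_gt_zero_iff sum_divide_distrib)
  then have le1: "dyadic_sum n 1 \<le> 1" using n by (simp add: sum_measure_dyadic)
  have cont: "continuous_on {0..1} (dyadic_sum n)"
    unfolding dyadic_sum_def
  proof (intro continuous_on_sum)
    fix k
    show "continuous_on {0..1} (\<lambda>q. weight n k powr q)"
      by (cases "measure \<nu> (dyadic n k) = 0") (auto intro!: continuous_intros)
  qed
  have "\<exists>q\<ge>0. q \<le> 1 \<and> dyadic_sum n q = 1"
    by (rule IVT2') (use le1 dyadic_sum_0_ge cont in auto)
  then obtain q where q: "0 \<le> q" "dyadic_sum n q = 1" by blast
  have unique: "q' = q" if "dyadic_sum n q' = 1" for q'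
    using dyadic_sum_strict_antimono[OF n(2), of q q'] dyadic_sum_strict_antimono[OF n(2), of q' q] q that
    by (cases q q' rule: linorder_cases) auto
  have "q_fixed \<nu> n = q"
    unfolding q_fixed_def Lq_beta_fixed_iff[OF n(1)] by (rule the_equality) (use q unique in blast)+
  then show "0 \<le> q_fixed \<nu> n" "dyadic_sum n (q_fixed \<nu> n) = 1" using q by auto
qed

lemma eventually_level: "eventually (\<lambda>n. 1 \<le> n \<and> mass < 2 ^ n) sequentially"
proof -
  obtain N where N: "mass < 2 ^ N" using real_arch_pow[of 2 mass] by auto
  have "eventually (\<lambda>n. mass < 2 ^ n) sequentially"
  proof (rule eventually_sequentiallyI)
    fix n assume "N \<le> n"
    then have "(2::real) ^ N \<le> 2 ^ n" by (intro power_increasing) auto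
    then show "mass < 2 ^ n" using N by linarith
  qed
  then show ?thesis using eventually_ge_at_top[of 1] by eventually_elim auto
qed

lemma q_fixed_less:
  assumes n: "1 \<le> n" "mass < 2 ^ n" and "dyadic_sum n q < 1"
  shows "q_fixed \<nu> n < q"
proof (rule ccontr)
  assume "\<not> q_fixed \<nu> n < q"
  then have "dyadic_sum n (q_fixed \<nu> n) \<le> dyadic_sum n q"
    using dyadic_sum_strict_antimono[OF n(2), of q "q_fixed \<nu> n"] by (cases "q = q_fixed \<nu> n") auto
  then show False using q_fixed_props[OF n] assms(3) by simp
qed

lemma mass_powr_tendsto:
  assumes "0 < e"
  shows "(\<lambda>n. (mass / 2 ^ n) powr e * c) \<longlonglongrightarrow> 0"
proof -
  have "(\<lambda>n. mass powr e * c * ((1/2) powr e) ^ n) \<longlonglongrightarrow> mass powr e * c * 0"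
    using powr_less_mono'[of "1/2" 0 e] assms by (intro tendsto_mult tendsto_const LIMSEQ_power_zero) simp
  moreover have "mass powr e * c * ((1/2) powr e) ^ n = (mass / 2 ^ n) powr e * c" for n
    using mass_pos by (simp add: powr_divide powr_power powr_realpow[symmetric] powr_powr power_one_over field_simps)
  ultimately show ?thesis by simp
qed

text \<open>At exponent 1/2 the terms are geometric means of measure and length, so their sum is at
  most \<open>(mass + 1) / 2\<close> at every level. Any larger exponent eventually pushes it below
  1.\<close>

lemma q_upper_le_half: "q_upper \<nu> \<le> ereal (1 / 2)"
proof (rule ereal_le_epsilon2)
  fix e :: real assume e: "0 < e"
  have half: "dyadic_sum n (1 / 2) \<le> (mass + 1) / 2" for n
  proof -
    have "dyadic_sum n (1 / 2) \<le> (\<Sum>k<2 ^ n. (measure \<nu> (dyadic n k) + 1 / 2 ^ n) / 2)"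
      unfolding dyadic_sum_def
    proof (rule sum_mono)
      fix k
      have "weight n k powr (1 / 2) = sqrt (measure \<nu> (dyadic n k) * (1 / 2 ^ n))"
        by (subst powr_half_sqrt) auto
      also have "\<dots> \<le> (measure \<nu> (dyadic n k) + 1 / 2 ^ n) / 2"
        by (intro arith_geo_mean_sqrt) auto
      finally show "weight n k powr (1 / 2) \<le> (measure \<nu> (dyadic n k) + 1 / 2 ^ n) / 2" .
    qed
    also have "\<dots> = (mass + 1) / 2"
      by (simp add: sum.distrib sum_measure_dyadic flip: sum_divide_distrib)
    finally show ?thesis .
  qed
  have "eventually (\<lambda>n. (mass / 2 ^ n) powr e * ((mass + 1) / 2) < 1) sequentially"
    by (rule order_tendstoD(2)[OF mass_powr_tendsto[OF e]]) simp
  then have "eventually (\<lambda>n. ereal (q_fixed \<nu> n) \<le> ereal (1 / 2 + e)) sequentially"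
    using eventually_level
  proof eventually_elim
    case (elim n)
    have "dyadic_sum n (1 / 2 + e) \<le> (mass / 2 ^ n) powr e * dyadic_sum n (1 / 2)"
      using e by (intro dyadic_sum_shift) auto
    also have "\<dots> \<le> (mass / 2 ^ n) powr e * ((mass + 1) / 2)" using half by (intro mult_left_mono) auto
    finally have "dyadic_sum n (1 / 2 + e) < 1" using elim by linarith
    then show ?case using q_fixed_less elim by (simp add: less_imp_le)
  qed
  then show "q_upper \<nu> \<le> ereal (1 / 2) + ereal e"
    unfolding q_upper_def by (simp add: Limsup_bounded)
qed

lemma q_upper_nonneg: "0 \<le> q_upper \<nu>"
proof -
  have "eventually (\<lambda>n. 0 \<le> ereal (q_fixed \<nu> n)) sequentially"
    using eventually_level by eventually_elim (simp add: q_fixed_props)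
  then have "0 \<le> liminf (\<lambda>n. ereal (q_fixed \<nu> n))" by (rule Liminf_bounded)
  also have "\<dots> \<le> q_upper \<nu>" unfolding q_upper_def by (intro Liminf_le_Limsup) simp
  finally show ?thesis .
qed

text \<open>Every bad interval contributes at least \<open>x powr (- q)\<close> to the
  \<open>dyadic_sum\<close> of its level, so the bad intervals of all levels number at most
  \<open>x powr q\<close> times the sum over the levels.\<close>

lemma upper_entropy_le_q_upper: "upper_entropy \<nu> \<le> q_upper \<nu>"
proof (rule ccontr)
  assume "\<not> upper_entropy \<nu> \<le> q_upper \<nu>"
  then have less: "q_upper \<nu> < upper_entropy \<nu>" by simp
  obtain q where q: "q_upper \<nu> < ereal q" "ereal q < upper_entropy \<nu>" using ereal_dense2[OF less] by blast
  \<comment> \<open>At \<open>q1\<close> the sums are eventually at most 1; the gap up to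
    \<open>q\<close> provides the geometric factor that makes them summable over the levels.\<close>
  obtain q1 where q1: "q_upper \<nu> < ereal q1" "ereal q1 < ereal q" using ereal_dense2[OF q(1)] by blast
  have q1': "0 < q1" "q1 < q" using q1 q_upper_nonneg by (auto dest: le_less_trans)
  define e where "e = q - q1"
  have e: "0 < e" using q1' by (simp add: e_def)
  have "eventually (\<lambda>n. ereal (q_fixed \<nu> n) < ereal q1) sequentially"
    using q1(1) unfolding q_upper_def by (rule Limsup_lessD)
  then have "eventually (\<lambda>n. norm (dyadic_sum n q) \<le> mass powr e * ((1/2) powr e) ^ n) sequentially"
    using eventually_level
  proof eventually_elim
    case (elim n)
    have "dyadic_sum n q1 \<le> 1"
      using dyadic_sum_strict_antimono[of n "q_fixed \<nu> n" q1] q_fixed_props[of n] elim by simp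
    have "dyadic_sum n q \<le> (mass / 2 ^ n) powr e * dyadic_sum n q1"
      using dyadic_sum_shift[of e n q1] e by (simp add: e_def)
    also have "\<dots> \<le> (mass / 2 ^ n) powr e * 1" by (intro mult_left_mono) (use \<open>dyadic_sum n q1 \<le> 1\<close> in auto)
    also have "\<dots> = mass powr e * ((1/2) powr e) ^ n"
      using mass_pos by (simp add: powr_divide powr_power powr_realpow[symmetric] powr_powr power_one_over field_simps)
    finally show ?case using dyadic_sum_pos[of n q] by simp
  qed
  moreover have "summable (\<lambda>n. mass powr e * ((1/2) powr e) ^ n)"
    using powr_less_mono'[of "1/2" 0 e] e by (intro summable_mult summable_geometric) simp
  ultimately have summ: "summable (\<lambda>n. dyadic_sum n q)" by (rule summable_comparison_test_ev)
  define K where "K = (\<Sum>n. dyadic_sum n q)"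
  have K: "(\<Sum>n<L. dyadic_sum n q) \<le> K" for L
    unfolding K_def using summ dyadic_sum_pos by (intro sum_le_suminf) (auto intro: less_imp_le)
  have K0: "0 \<le> K" using K[of 0] by simp
  have "upper_entropy \<nu> \<le> ereal q"
    unfolding upper_entropy_def
  proof (rule upper_exponent_le_powr[of _ "1 + K"])
    show "eventually (\<lambda>x. real (partition_count \<nu> x) \<le> (1 + K) * x powr q) at_top"
      using eventually_ge_at_top[of 1]
    proof eventually_elim
      case (elim x)
      define b where "b n = card {k. k < 2 ^ n \<and> 1 / x \<le> weight n k}" for n
      obtain L where L: "partition_count \<nu> x \<le> 1 + (\<Sum>n<L. b n)"
        using partition_count_le_bad_dyadics[of x] elim by (auto simp: b_def)
      have "real (b n) \<le> x powr q * dyadic_sum n q" for n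
      proof -
        have "real (b n) * (1 / x) powr q \<le> dyadic_sum n q"
          unfolding b_def using elim q1' by (intro card_bad_dyadics) auto
        then show ?thesis using elim by (simp add: powr_divide field_simps)
      qed
      then have "(\<Sum>n<L. real (b n)) \<le> x powr q * (\<Sum>n<L. dyadic_sum n q)"
        unfolding sum_distrib_left by (intro sum_mono)
      also have "\<dots> \<le> x powr q * K" using K by (intro mult_left_mono) auto
      finally have "(\<Sum>n<L. real (b n)) \<le> x powr q * K" .
      moreover have "real (partition_count \<nu> x) \<le> 1 + (\<Sum>n<L. real (b n))"
        using L by (metis of_nat_1 of_nat_add of_nat_le_iff of_nat_sum)
      moreover have "1 \<le> x powr q" using elim q1' by (intro ge_one_powr_ge_zero) auto
      ultimately show ?case by (simp add: algebra_simps)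
    qed
  qed (use q1' K0 in auto)
  then show False using q(2) by simp
qed

end

section \<open>The coarse multifractal dimension\<close>

lemma log_plus_nonneg: "0 \<le> log_plus t"
  by (simp add: log_plus_def)

lemma ln_le_log_plus: "ln (real n) \<le> log_plus (real n)"
  by (cases "n = 0") (auto simp: log_plus_def)

lemma log_plus_ratio_less_imp:
  assumes "log_plus (real N) / ln (2 ^ n) < a" "1 \<le> n"
  shows "real N \<le> 2 powr (a * real n)"
proof (cases "N = 0")
  case False
  have l: "ln (2 ^ n :: real) = real n * ln 2" by (simp add: ln_realpow)
  have "0 < ln (2 ^ n :: real)" using assms(2) by (simp add: l)
  then have "log_plus (real N) < a * (real n * ln 2)" using assms(1) unfolding l by (simp add: field_simps)
  then have "ln (real N) \<le> ln (2 powr (a * real n))"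
    using ln_le_log_plus[of N] by (simp add: ln_powr)
  then show ?thesis using False by (subst (asm) ln_le_cancel_iff) auto
qed simp

lemma log_plus_ratio_greater_imp:
  assumes "a < log_plus (real N) / ln (2 ^ n)" "1 \<le> n" "0 \<le> a"
  shows "2 powr (a * real n) \<le> real N"
proof -
  have l: "ln (2 ^ n :: real) = real n * ln 2" by (simp add: ln_realpow)
  have "0 < ln (2 ^ n :: real)" using assms(2) by (simp add: l)
  then have less: "a * (real n * ln 2) < log_plus (real N)" using assms(1) unfolding l by (simp add: field_simps)
  moreover have "0 \<le> a * (real n * ln 2)" using assms(3) by simp
  ultimately have "0 < log_plus (real N)" by linarith
  then have "log_plus (real N) = ln (real N)" "0 < real N"
    by (auto simp: log_plus_def max_def split: if_splits)
  then have "ln (2 powr (a * real n)) \<le> ln (real N)" using less by (simp add: ln_powr)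
  then show ?thesis using \<open>0 < real N\<close> by (subst (asm) ln_le_cancel_iff) auto
qed

lemma ereal_divide_less_iff:
  assumes "0 < c"
  shows "x < y / ereal c \<longleftrightarrow> x * ereal c < y" "y / ereal c \<le> x \<longleftrightarrow> y \<le> x * ereal c"
  using assms by (cases x; cases y; simp add: field_simps)+

context nonzero_measure_on_01
begin

abbreviation coarse_rate :: "real \<Rightarrow> nat \<Rightarrow> real" where
  "coarse_rate \<alpha> n \<equiv> log_plus (real (coarse_count \<nu> \<alpha> n)) / ln (2 ^ n)"

lemma F_upper_nonneg: "0 \<le> F_upper \<nu>"
proof -
  have "0 \<le> liminf (\<lambda>n. ereal (coarse_rate 1 n))"
    by (intro Liminf_bounded always_eventually) (simp add: log_plus_nonneg)
  also have "\<dots> \<le> F_upper_at \<nu> 1" unfolding F_upper_at_def by (intro Liminf_le_Limsup) simp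
  finally have "0 \<le> F_upper_at \<nu> 1 / ereal (1 + 1)"
    using ereal_divide_less_iff(1)[of 2 "F_upper_at \<nu> 1 / ereal 2"] by (cases "F_upper_at \<nu> 1") auto
  also have "\<dots> \<le> F_upper \<nu>" unfolding F_upper_def by (rule SUP_upper) simp
  finally show ?thesis .
qed

lemma F_upper_at_le:
  assumes "0 < \<alpha>"
  shows "F_upper_at \<nu> \<alpha> \<le> F_upper \<nu> * ereal (1 + \<alpha>)"
proof -
  have "F_upper_at \<nu> \<alpha> / ereal (1 + \<alpha>) \<le> F_upper \<nu>"
    unfolding F_upper_def by (rule SUP_upper) (use assms in simp)
  then show ?thesis using ereal_divide_less_iff(2)[of "1 + \<alpha>"] assms by simp
qed

text \<open>Slice the dyadic intervals by the size \<open>2\<^sup>-\<^sup>\<alpha>\<^sup>n\<close> of their measure, with \<open>\<alpha>\<close> in an arithmetic progression.\<close>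

lemma sum_powr_le_slices:
  assumes s: "0 < s" and d: "0 < d" and J: "1 \<le> J"
  shows "(\<Sum>k<2 ^ n. measure \<nu> (dyadic n k) powr s) \<le> 2 ^ n * 2 powr (- (real J * d) * real n * s) +
     (\<Sum>j\<in>{1..J}. real (coarse_count \<nu> (real j * d) n) * (max 1 mass powr s * 2 powr (- ((real j - 1) * d) * real n * s)))"
proof -
  \<comment> \<open>The first slice has no threshold above it; there the measure is bounded by the
    total mass. The maximum with 1 makes the factor harmless in the other slices.\<close>
  define M where "M = max 1 mass"
  define A where "A j = {k. k < 2 ^ n \<and> measure \<nu> (dyadic n k) \<ge> 2 powr (- (real j * d) * real n)}" for j :: nat
  define e where "e j = M powr s * 2 powr (- ((real j - 1) * d) * real n * s)" for j :: nat
  define e0 where "e0 = (2::real) powr (- (real J * d) * real n * s)"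
  have M1: "1 \<le> M powr s" using s by (intro ge_one_powr_ge_zero) (auto simp: M_def)
  have "measure \<nu> (dyadic n k) powr s \<le> e0 + (\<Sum>j\<in>{1..J}. if k \<in> A j then e j else 0)" if k: "k < 2 ^ n" for k
  proof (cases "\<exists>j\<in>{1..J}. k \<in> A j")
    case False
    have "measure \<nu> (dyadic n k) powr s \<le> e0"
    proof -
      have "k \<notin> A J" using False J by auto
      then have "measure \<nu> (dyadic n k) \<le> 2 powr (- (real J * d) * real n)" using k by (auto simp: A_def)
      then have "measure \<nu> (dyadic n k) powr s \<le> (2 powr (- (real J * d) * real n)) powr s"
        using s by (intro powr_mono2) auto
      then show ?thesis by (simp add: e0_def powr_powr)
    qed
    moreover have "0 \<le> (\<Sum>j\<in>{1..J}. if k \<in> A j then e j else 0)" by (intro sum_nonneg) (auto simp: e_def)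
    ultimately show ?thesis by linarith
  next
    case True
    \<comment> \<open>For the least such \<open>j\<close> the measure reaches threshold
      \<open>j\<close> but not threshold \<open>j - 1\<close>.\<close>
    define j where "j = (LEAST j. j \<in> {1..J} \<and> k \<in> A j)"
    have j: "j \<in> {1..J}" "k \<in> A j" unfolding j_def by (rule LeastI2_ex; use True in blast)+
    have min: "\<not> (i \<in> {1..J} \<and> k \<in> A i)" if "i < j" for i using not_less_Least that unfolding j_def by blast
    have "measure \<nu> (dyadic n k) powr s \<le> e j"
    proof (cases "j = 1")
      case True
      have "measure \<nu> (dyadic n k) \<le> M" unfolding M_def by (rule max.coboundedI2) (auto intro: finite_measure_mono)
      then show ?thesis using True s by (auto simp: e_def intro!: powr_mono2)
    next
      case False
      then have "k \<notin> A (j - 1)" using min[of "j - 1"] j by auto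
      then have "measure \<nu> (dyadic n k) \<le> 2 powr (- ((real j - 1) * d) * real n)"
        using k j by (auto simp: A_def of_nat_diff)
      then have "measure \<nu> (dyadic n k) powr s \<le> (2 powr (- ((real j - 1) * d) * real n)) powr s"
        using s by (intro powr_mono2) auto
      also have "\<dots> \<le> e j" using M1 by (simp add: e_def powr_powr)
      finally show ?thesis .
    qed
    also have "e j \<le> (\<Sum>j\<in>{1..J}. if k \<in> A j then e j else 0)"
    proof -
      have "(if k \<in> A j then e j else 0) \<le> (\<Sum>j\<in>{1..J}. if k \<in> A j then e j else 0)"
        using j(1) by (intro member_le_sum) (auto simp: e_def)
      then show ?thesis using j(2) by simp
    qed
    finally show ?thesis by (simp add: e0_def add_increasing)
  qed
  then have "(\<Sum>k<2 ^ n. measure \<nu> (dyadic n k) powr s) \<le> (\<Sum>k<2 ^ n. e0 + (\<Sum>j\<in>{1..J}. if k \<in> A j then e j else 0))"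
    by (intro sum_mono) auto
  also have "\<dots> = 2 ^ n * e0 + (\<Sum>j\<in>{1..J}. \<Sum>k<2 ^ n. if k \<in> A j then e j else 0)"
    by (simp add: sum.distrib) (rule sum.swap)
  also have "(\<Sum>j\<in>{1..J}. \<Sum>k<2 ^ n. if k \<in> A j then e j else 0) = (\<Sum>j\<in>{1..J}. real (coarse_count \<nu> (real j * d) n) * e j)"
  proof (rule sum.cong[OF refl])
    fix j
    have "{..<2 ^ n} \<inter> A j = A j" by (auto simp: A_def)
    then have "(\<Sum>k<2 ^ n. if k \<in> A j then e j else 0) = real (card (A j)) * e j"
      by (simp add: sum.If_cases)
    then show "(\<Sum>k<2 ^ n. if k \<in> A j then e j else 0) = real (coarse_count \<nu> (real j * d) n) * e j"
      by (simp add: A_def coarse_count_def)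
  qed
  finally show ?thesis by (simp add: e_def e0_def M_def)
qed

text \<open>Let \<open>f\<close> be the value of \<open>F_upper\<close> and \<open>f < s\<close>. Up
  to small errors in the exponent, the slice at \<open>\<alpha> = j * d\<close> holds at most
  \<open>2 powr (f * (1 + \<alpha>) * n)\<close> intervals with terms
  \<open>2 powr (- \<alpha> * s * n)\<close>, together at most \<open>2 powr (f * n)\<close>, which
  is below \<open>2 powr (s * n)\<close>.\<close>

lemma q_upper_le_F_upper: "q_upper \<nu> \<le> F_upper \<nu>"
proof (rule ccontr)
  assume "\<not> q_upper \<nu> \<le> F_upper \<nu>"
  then have less: "F_upper \<nu> < q_upper \<nu>" by simp
  obtain s where s: "F_upper \<nu> < ereal s" "ereal s < q_upper \<nu>" using ereal_dense2[OF less] by blast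
  obtain f where f: "F_upper \<nu> = ereal f" using s(1) F_upper_nonneg by (cases "F_upper \<nu>") auto
  have f0: "0 \<le> f" "f < s" using s(1) F_upper_nonneg f by auto
  then have s0: "0 < s" by simp
  \<comment> \<open>Two errors of size \<open>e\<close>, one from the upper limit and one from the
    slice width since \<open>d * s = e\<close>, leave the exponent \<open>\<rho> = f + 2 * e\<close>
    below \<open>s\<close>.\<close>
  define e where "e = (s - f) / 3"
  define d where "d = e / s"
  have ed: "0 < e" "0 < d" "d * s = e" using f0 s0 by (auto simp: e_def d_def)
  define \<rho> where "\<rho> = f + e + e"
  have \<rho>: "0 \<le> \<rho>" "\<rho> < s" using f0 ed(1) by (simp add: \<rho>_def) (use f0 in \<open>simp add: \<rho>_def e_def field_simps\<close>)
  \<comment> \<open>With \<open>J * e\<close> at least 1, the intervals below all thresholds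
    contribute at most 1 together.\<close>
  obtain J :: nat where J: "1 / e < real J" using reals_Archimedean2 by blast
  then have J0: "1 \<le> J" using ed by (cases J) (auto simp: not_less_iff_gr_or_eq)
  have J1: "1 \<le> real J * e" using J ed by (simp add: field_simps less_imp_le)
  define M where "M = max 1 mass"
  have M: "0 < M powr s" by (simp add: M_def)
  have "eventually (\<lambda>n. \<forall>j\<in>{1..J}. coarse_rate (real j * d) n < f * (1 + real j * d) + e) sequentially"
  proof (intro eventually_ball_finite ballI)
    fix j assume j: "j \<in> {1..J}"
    have "F_upper_at \<nu> (real j * d) \<le> ereal f * ereal (1 + real j * d)"
      using F_upper_at_le[of "real j * d"] j ed f by auto
    also have "\<dots> < ereal (f * (1 + real j * d) + e)" using ed by simp
    finally have "eventually (\<lambda>n. ereal (coarse_rate (real j * d) n) < ereal (f * (1 + real j * d) + e)) sequentially"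
      unfolding F_upper_at_def by (rule Limsup_lessD)
    then show "eventually (\<lambda>n. coarse_rate (real j * d) n < f * (1 + real j * d) + e) sequentially"
      by simp
  qed simp
  moreover have "eventually (\<lambda>n. real J * M powr s + 1 < (2 powr (s - \<rho>)) ^ n) sequentially"
  proof -
    have "1 < 2 powr (s - \<rho>)" using \<rho> by simp
    then obtain N where N: "real J * M powr s + 1 < (2 powr (s - \<rho>)) ^ N" using real_arch_pow by blast
    show ?thesis
    proof (rule eventually_sequentiallyI)
      fix n assume "N \<le> n"
      then have "(2 powr (s - \<rho>)) ^ N \<le> (2 powr (s - \<rho>)) ^ n"
        using \<open>1 < 2 powr (s - \<rho>)\<close> by (intro power_increasing) auto
      then show "real J * M powr s + 1 < (2 powr (s - \<rho>)) ^ n" using N by linarith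
    qed
  qed
  ultimately have "eventually (\<lambda>n. ereal (q_fixed \<nu> n) \<le> ereal s) sequentially"
    using eventually_level
  proof eventually_elim
    case (elim n)
    have "(\<Sum>k<2 ^ n. measure \<nu> (dyadic n k) powr s) \<le> 2 ^ n * 2 powr (- (real J * d) * real n * s) +
       (\<Sum>j\<in>{1..J}. real (coarse_count \<nu> (real j * d) n) * (M powr s * 2 powr (- ((real j - 1) * d) * real n * s)))"
      unfolding M_def by (rule sum_powr_le_slices[OF s0 ed(2) J0])
    also have "\<dots> \<le> 1 + (\<Sum>j\<in>{1..J}. M powr s * 2 powr (\<rho> * real n))"
    proof (rule add_mono)
      have "2 ^ n * 2 powr (- (real J * d) * real n * s) = 2 powr (real n * (1 - real J * e))"
        unfolding ed(3)[symmetric] by (simp add: powr_realpow[symmetric] powr_add[symmetric] algebra_simps)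
      also have "\<dots> \<le> 2 powr 0" using J1 by (intro powr_mono) (auto simp: mult_nonneg_nonpos)
      finally show "2 ^ n * 2 powr (- (real J * d) * real n * s) \<le> 1" by simp
      show "(\<Sum>j\<in>{1..J}. real (coarse_count \<nu> (real j * d) n) * (M powr s * 2 powr (- ((real j - 1) * d) * real n * s)))
        \<le> (\<Sum>j\<in>{1..J}. M powr s * 2 powr (\<rho> * real n))"
      proof (rule sum_mono)
        fix j assume j: "j \<in> {1..J}"
        have "real (coarse_count \<nu> (real j * d) n) \<le> 2 powr ((f * (1 + real j * d) + e) * real n)"
          using elim j by (intro log_plus_ratio_less_imp) auto
        then have "real (coarse_count \<nu> (real j * d) n) * (M powr s * 2 powr (- ((real j - 1) * d) * real n * s))
          \<le> 2 powr ((f * (1 + real j * d) + e) * real n) * (M powr s * 2 powr (- ((real j - 1) * d) * real n * s))"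
          by (intro mult_right_mono) auto
        also have "\<dots> = M powr s * 2 powr ((f * (1 + real j * d) + e) * real n + (- ((real j - 1) * d) * real n * s))"
          unfolding powr_add by simp
        also have "\<dots> \<le> M powr s * 2 powr (\<rho> * real n)"
        proof (intro mult_left_mono powr_mono)
          \<comment> \<open>Here \<open>f < s\<close> lets the decrease of the measures outweigh the
            growth of the counts, uniformly in \<open>j\<close>.\<close>
          have "f * (real j * d) \<le> s * (real j * d)" using f0 ed by (intro mult_right_mono) auto
          also have "s * (real j * d) = real j * e" unfolding ed(3)[symmetric] by simp
          finally have "f * (1 + real j * d) + e - (real j - 1) * (d * s) \<le> \<rho>"
            unfolding ed(3) by (simp add: \<rho>_def algebra_simps)
          then have "(f * (1 + real j * d) + e - (real j - 1) * (d * s)) * real n \<le> \<rho> * real n"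
            by (intro mult_right_mono) auto
          then show "(f * (1 + real j * d) + e) * real n + (- ((real j - 1) * d) * real n * s) \<le> \<rho> * real n"
            by (simp add: algebra_simps)
        qed auto
        finally show "real (coarse_count \<nu> (real j * d) n) * (M powr s * 2 powr (- ((real j - 1) * d) * real n * s))
          \<le> M powr s * 2 powr (\<rho> * real n)" .
      qed
    qed
    also have "\<dots> \<le> (1 + real J * M powr s) * 2 powr (\<rho> * real n)"
      using \<rho> ge_one_powr_ge_zero[of 2 "\<rho> * real n"] by (simp add: algebra_simps)
    also have "\<dots> < (2 powr (s - \<rho>)) ^ n * 2 powr (\<rho> * real n)"
      using elim by (intro mult_strict_right_mono) auto
    also have "\<dots> = (2 ^ n) powr s"
      by (simp add: powr_realpow[symmetric] powr_powr powr_add[symmetric] algebra_simps)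
    finally have "(\<Sum>k<2 ^ n. measure \<nu> (dyadic n k) powr s) / (2 ^ n) powr s < 1" by simp
    then have "dyadic_sum n s < 1"
      by (simp add: dyadic_sum_def powr_divide sum_divide_distrib)
    then show ?case using q_fixed_less[of n s] elim by simp
  qed
  then have "q_upper \<nu> \<le> ereal s" unfolding q_upper_def by (rule Limsup_bounded)
  then show False using s(2) by simp
qed

section \<open>Reduced families from dyadic intervals of large measure\<close>

lemma shrink_cball:
  fixes c r :: real
  assumes "0 < r" "0 < m"
  shows "shrink m {c - r..c + r} = {c - r / m..c + r / m}"
proof
  show "shrink m {c - r..c + r} \<subseteq> {c - r / m..c + r / m}"
    using shrink_subset[of "{c - r..c + r}" m] assms by simp
  show "{c - r / m..c + r / m} \<subseteq> shrink m {c - r..c + r}"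
  proof
    fix y assume y: "y \<in> {c - r / m..c + r / m}"
    have "y = (\<lambda>x. c + (x - c) / m) (c + m * (y - c))" using assms by simp
    moreover have "c + m * (y - c) \<in> {c - r..c + r}"
    proof -
      have "\<bar>y - c\<bar> \<le> r / m" using y by auto
      then have "m * \<bar>y - c\<bar> \<le> r" using assms by (simp add: field_simps)
      then have "\<bar>m * (y - c)\<bar> \<le> r" using assms by (simp add: abs_mult)
      then show ?thesis by auto
    qed
    moreover have "shrink m {c - r..c + r} = (\<lambda>x. c + (x - c) / m) ` {c - r..c + r}"
      using assms by (simp add: shrink_def Let_def)
    ultimately show "y \<in> shrink m {c - r..c + r}" by (metis (no_types, lifting) image_eqI)
  qed
qed

lemma exists_radius:
  fixes c :: real
  assumes "a < b"
  shows "\<exists>r. a < r \<and> r < b \<and> measure \<nu> {c - r} = 0 \<and> measure \<nu> {c + r} = 0"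
proof -
  let ?A = "{x. measure \<nu> {x} \<noteq> 0}"
  have "countable ((\<lambda>x. c - x) ` ?A \<union> (\<lambda>x. x - c) ` ?A)" using atoms_countable by simp
  then have "uncountable ({a<..<b} - ((\<lambda>x. c - x) ` ?A \<union> (\<lambda>x. x - c) ` ?A))"
    using assms by (intro uncountable_minus_countable uncountable_open_interval[THEN iffD2])
  then obtain r where r: "r \<in> {a<..<b}" "r \<notin> (\<lambda>x. c - x) ` ?A \<union> (\<lambda>x. x - c) ` ?A"
    by (metis DiffE countable_empty ex_in_conv)
  have "measure \<nu> {c - r} = 0" using r(2) by (auto simp: image_iff)
  moreover have "measure \<nu> {c + r} = 0" using r(2) by (auto simp: image_iff algebra_simps)
  ultimately show ?thesis using r(1) by auto
qed

text \<open>Every \<open>R\<close>-th charged dyadic interval, enlarged by a factor between \<open>m\<close> and \<open>R\<close>.\<close>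

lemma card_separated_le_reduced_count:
  assumes m: "1 < m" and R: "m < real R"
    and x: "4 / (m - 1) * 2 powr ((1 + \<alpha>) * real n) \<le> x"
    and K: "\<And>k. k \<in> K \<Longrightarrow> measure \<nu> (dyadic n k) \<ge> 2 powr (- \<alpha> * real n)"
    and bounds: "\<And>k. k \<in> K \<Longrightarrow> R \<le> k \<and> k + R \<le> 2 ^ n"
    and sep: "\<And>k l. k \<in> K \<Longrightarrow> l \<in> K \<Longrightarrow> k < l \<Longrightarrow> k + R \<le> l"
  shows "card K \<le> reduced_count \<nu> m x"
proof -
  have finK: "finite K" using bounds by (intro finite_subset[of K "{..2 ^ n}"]) force+
  have x0: "0 < x" using x m by (smt (verit) divide_pos_pos mult_pos_pos powr_gt_zero)
  define c where "c k = (real k + 1 / 2) / 2 ^ n" for k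
  \<comment> \<open>\<open>c k\<close> is the midpoint of \<open>dyadic n k\<close>. A radius above
    \<open>m / 2 / 2 ^ n\<close> keeps the dyadic interval inside after shrinking by
    \<open>m\<close>; below \<open>R / 2 / 2 ^ n\<close>, intervals with indices at least
    \<open>R\<close> apart are disjoint.\<close>
  have "\<exists>r. m / 2 / 2 ^ n < r \<and> r < real R / 2 / 2 ^ n \<and> measure \<nu> {c k - r} = 0 \<and> measure \<nu> {c k + r} = 0" for k
    using R by (intro exists_radius divide_strict_right_mono) auto
  then obtain r where r: "\<And>k. m / 2 / 2 ^ n < r k" "\<And>k. r k < real R / 2 / 2 ^ n"
      "\<And>k. measure \<nu> {c k - r k} = 0" "\<And>k. measure \<nu> {c k + r k} = 0" by metis
  have r0: "0 < r k" for k using r(1)[of k] m by (smt (verit) divide_pos_pos zero_less_power)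
  define C where "C k = {c k - r k..c k + r k}" for k
  have disj: "C k \<inter> C l = {}" if "k \<in> K" "l \<in> K" "k < l" for k l
  proof -
    have "real k + real R \<le> real l" using sep[OF that] by linarith
    then have "(real k + 1 / 2 + real R) / 2 ^ n \<le> (real l + 1 / 2) / 2 ^ n" by (intro divide_right_mono) auto
    then have "c k + real R / 2 ^ n \<le> c l" by (simp add: c_def add_divide_distrib)
    moreover have "r k + r l < real R / 2 ^ n" using r(2)[of k] r(2)[of l] by simp
    ultimately show ?thesis by (auto simp: C_def)
  qed
  have disj': "C k \<inter> C l = {}" if "k \<in> K" "l \<in> K" "k \<noteq> l" for k l
    using disj[of k l] disj[of l k] that by (cases k l rule: linorder_cases) auto
  have ne: "C k \<noteq> {}" for k using r0[of k] by (auto simp: C_def)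
  have inj: "inj_on C K"
    by (rule inj_onI) (use disj' ne in \<open>metis Int_absorb\<close>)
  have sub: "C k \<subseteq> {0..1}" if "k \<in> K" for k
  proof -
    have "real R \<le> real k" "real (k + R) \<le> real (2 ^ n)" using bounds[OF that] by (simp_all only: of_nat_le_iff)
    then have "0 \<le> (real k + 1 / 2 - real R / 2) / 2 ^ n" "(real k + 1 / 2 + real R / 2) / 2 ^ n \<le> 1"
      using m R by (auto simp: divide_le_eq)
    then have "r k \<le> c k" "c k + r k \<le> 1" using r(2)[of k] by (auto simp: c_def add_divide_distrib diff_divide_distrib)
    then show ?thesis by (auto simp: C_def)
  qed
  have "C ` K \<in> interval_families \<nu>"
    unfolding interval_families_def
  proof (intro CollectI conjI ballI)
    show "disjoint (C ` K)"
      unfolding disjoint_def using disj' by blast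
    fix D assume "D \<in> C ` K"
    then obtain k where k: "k \<in> K" "D = C k" by auto
    show "is_interval D" "D \<noteq> {}" "D \<subseteq> {0..1}" using k ne sub by (auto simp: C_def is_interval_cc)
    show "measure \<nu> {Inf D} = 0" "measure \<nu> {Sup D} = 0" using k r r0[of k] by (auto simp: C_def)
  qed (use finK in auto)
  moreover have "measure \<nu> (shrink m D) * measure lborel (shrink m D) \<ge> 4 / (x * (m - 1))" if D: "D \<in> C ` K" for D
  proof -
    obtain k where k: "k \<in> K" "D = C k" using D by auto
    have shr: "shrink m D = {c k - r k / m..c k + r k / m}"
      unfolding k(2) C_def using r0 m by (intro shrink_cball) auto
    have rm: "1 / 2 / 2 ^ n < r k / m" using r(1)[of k] m by (simp add: field_simps)
    \<comment> \<open>The lower bound on \<open>x\<close> is matched to measure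
      \<open>2 powr (- \<alpha> * n)\<close> times length \<open>2 powr (- n)\<close>.\<close>
    have "4 / (x * (m - 1)) \<le> 2 powr (- (1 + \<alpha>) * real n)"
    proof -
      have "4 * 2 powr ((1 + \<alpha>) * real n) \<le> x * (m - 1)" using x m by (simp add: field_simps)
      then have "4 / (x * (m - 1)) \<le> 1 / 2 powr ((1 + \<alpha>) * real n)"
        using x0 m by (simp add: field_simps)
      then show ?thesis unfolding minus_mult_left[symmetric] powr_minus_divide .
    qed
    also have "\<dots> = 2 powr (- \<alpha> * real n) * (1 / 2 ^ n)"
    proof -
      have "1 / 2 ^ n = (2::real) powr (- real n)" by (simp add: powr_minus_divide powr_realpow)
      moreover have "- (1 + \<alpha>) * real n = - \<alpha> * real n + - real n" by (simp add: algebra_simps)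
      ultimately show ?thesis by (simp only: powr_add)
    qed
    also have "\<dots> \<le> measure \<nu> (shrink m D) * measure lborel (shrink m D)"
    proof (rule mult_mono)
      have "dyadic n k \<subseteq> shrink m D"
      proof
        fix t assume "t \<in> dyadic n k"
        then have "\<bar>t - c k\<bar> \<le> 1 / 2 / 2 ^ n" by (auto simp: dyadic_def c_def field_simps abs_le_iff)
        then show "t \<in> shrink m D" using rm unfolding shr by auto
      qed
      then have "measure \<nu> (dyadic n k) \<le> measure \<nu> (shrink m D)"
        by (rule finite_measure_mono) (simp add: shr)
      then show "2 powr (- \<alpha> * real n) \<le> measure \<nu> (shrink m D)" using K[OF k(1)] by linarith
      have "measure lborel (shrink m D) = 2 * (r k / m)" unfolding shr using r0[of k] m by (simp add: field_simps)
      then show "1 / 2 ^ n \<le> measure lborel (shrink m D)" using rm by simp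
    qed auto
    finally show ?thesis .
  qed
  ultimately have "card (C ` K) \<le> reduced_count \<nu> m x"
    by (rule reduced_count_bounds(2)[OF m x0])
  then show ?thesis using inj by (simp add: card_image)
qed

text \<open>Each of the \<open>R\<close> residue classes modulo \<open>R\<close> is separated. The
  two ends of [0,1], where enlarged intervals could stick out, cost at most \<open>R\<close> indices
  each.\<close>

lemma coarse_count_le_reduced_count:
  assumes m: "1 < m" and R: "m < real R"
    and x: "4 / (m - 1) * 2 powr ((1 + \<alpha>) * real n) \<le> x"
  shows "coarse_count \<nu> \<alpha> n \<le> R * reduced_count \<nu> m x + 2 * R"
proof -
  define A where "A = {k. k < 2 ^ n \<and> measure \<nu> (dyadic n k) \<ge> 2 powr (- \<alpha> * real n)}"
  define K where "K \<rho> = {k \<in> A. R \<le> k \<and> k + R \<le> 2 ^ n \<and> k mod R = \<rho>}" for \<rho>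
  have "R > 0" using R m by (cases R) auto
  have "A \<subseteq> (\<Union>\<rho><R. K \<rho>) \<union> {..<R} \<union> {2 ^ n - R..<2 ^ n}"
    using \<open>R > 0\<close> by (auto simp: A_def K_def)
  then have "card A \<le> card ((\<Union>\<rho><R. K \<rho>) \<union> {..<R} \<union> {2 ^ n - R..<2 ^ n})"
    by (intro card_mono) (auto simp: K_def A_def)
  also have "\<dots> \<le> card (\<Union>\<rho><R. K \<rho>) + R + R"
    by (intro order_trans[OF card_Un_le] add_mono) auto
  also have "card (\<Union>\<rho><R. K \<rho>) \<le> (\<Sum>\<rho><R. card (K \<rho>))"
    by (rule card_UN_le) simp
  also have "\<dots> \<le> (\<Sum>\<rho><R. reduced_count \<nu> m x)"
  proof (rule sum_mono)
    fix \<rho> assume "\<rho> \<in> {..<R}"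
    show "card (K \<rho>) \<le> reduced_count \<nu> m x"
    proof (rule card_separated_le_reduced_count[OF m R x])
      fix k l assume "k \<in> K \<rho>" "l \<in> K \<rho>" "k < l"
      then have "k mod R = l mod R" "k < l" by (auto simp: K_def)
      then have "R dvd l - k" by (metis less_imp_le_nat mod_eq_dvd_iff_nat)
      then have "R \<le> l - k" using \<open>k < l\<close> by (intro dvd_imp_le) auto
      then show "k + R \<le> l" using \<open>k < l\<close> by linarith
    qed (auto simp: K_def A_def)
  qed
  finally show ?thesis by (simp add: A_def coarse_count_def)
qed

text \<open>Valid for every \<open>x\<close> above the threshold, so that it serves both the upper
  limit, taken along the thresholds, and the lower limit, taken over all \<open>x\<close>.\<close>

lemma reduced_count_ge_powr:
  assumes m: "1 < m" and y: "0 < y"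
  obtains c N where "0 < c" "\<And>n x. N \<le> n \<Longrightarrow> 4 / (m - 1) * 2 powr ((1 + \<alpha>) * real n) \<le> x \<Longrightarrow>
    y < coarse_rate \<alpha> n \<Longrightarrow> c * 2 powr (y * real n) \<le> real (reduced_count \<nu> m x)"
proof -
  obtain R where R: "m < real R" using reals_Archimedean2 by blast
  have R0: "0 < real R" using R m by simp
  have "1 < 2 powr y" using y by simp
  \<comment> \<open>From level \<open>N\<close> on, the additive loss \<open>2 * R\<close> is at
    most half of \<open>2 powr (y * n)\<close>.\<close>
  then obtain N where N: "4 * real R < (2 powr y) ^ N" using real_arch_pow by blast
  show thesis
  proof (rule that[of "1 / (2 * real R)" "max 1 N"])
    fix n x assume n: "max 1 N \<le> n" and x: "4 / (m - 1) * 2 powr ((1 + \<alpha>) * real n) \<le> x"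
      and less: "y < coarse_rate \<alpha> n"
    have "2 powr (y * real n) \<le> real (coarse_count \<nu> \<alpha> n)"
      using less n y by (intro log_plus_ratio_greater_imp) auto
    also have "\<dots> \<le> real R * real (reduced_count \<nu> m x) + 2 * real R"
      using coarse_count_le_reduced_count[OF m R x] by (metis of_nat_add of_nat_le_iff of_nat_mult of_nat_numeral)
    finally have 1: "2 powr (y * real n) \<le> real R * real (reduced_count \<nu> m x) + 2 * real R" .
    have "(2 powr y) ^ N \<le> (2 powr y) ^ n" using n \<open>1 < 2 powr y\<close> by (intro power_increasing) auto
    also have "\<dots> = 2 powr (y * real n)" by (simp add: powr_realpow[symmetric] powr_powr)
    finally have "4 * real R \<le> 2 powr (y * real n)" using N by linarith
    then have "2 powr (y * real n) / 2 \<le> real R * real (reduced_count \<nu> m x)" using 1 by linarith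
    then show "1 / (2 * real R) * 2 powr (y * real n) \<le> real (reduced_count \<nu> m x)"
      using R0 by (simp add: field_simps)
  qed (use R0 in simp)
qed

text \<open>Along \<open>X n\<close> of order \<open>2 powr ((1 + \<alpha>) * n)\<close> the count
  is infinitely often at least of order \<open>2 powr (y * n)\<close>, which is \<open>X n\<close>
  to the power \<open>y / (1 + \<alpha>) = z\<close>.\<close>

lemma F_upper_le_upper_reduced_entropy:
  assumes m: "1 < m"
  shows "F_upper \<nu> \<le> upper_reduced_entropy \<nu> m"
  unfolding F_upper_def
proof (rule SUP_least)
  fix \<alpha> :: real assume "\<alpha> \<in> {0<..}"
  then have \<alpha>: "0 < \<alpha>" by simp
  show "F_upper_at \<nu> \<alpha> / ereal (1 + \<alpha>) \<le> upper_reduced_entropy \<nu> m"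
  proof (rule ccontr)
    assume "\<not> ?thesis"
    then have "upper_reduced_entropy \<nu> m < F_upper_at \<nu> \<alpha> / ereal (1 + \<alpha>)" by simp
    from ereal_dense2[OF this] obtain z where z: "upper_reduced_entropy \<nu> m < ereal z" "ereal z < F_upper_at \<nu> \<alpha> / ereal (1 + \<alpha>)"
      by blast
    have "0 \<le> upper_reduced_entropy \<nu> m"
      unfolding upper_reduced_entropy_def by (rule order_trans[OF lower_exponent_nonneg lower_exponent_le_upper])
    then have "0 \<le> ereal z" using z(1) by (meson le_less_trans less_imp_le)
    then have z0: "0 < z" using z(1) \<open>0 \<le> upper_reduced_entropy \<nu> m\<close>
      by (cases "z = 0") (auto simp: zero_ereal_def[symmetric])
    define y where "y = z * (1 + \<alpha>)"
    have y: "0 < y" "ereal y < F_upper_at \<nu> \<alpha>"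
      using z(2) z0 \<alpha> ereal_divide_less_iff(1)[of "1 + \<alpha>" "ereal z"] by (auto simp: y_def)
    have freq: "frequently (\<lambda>n. y < coarse_rate \<alpha> n) sequentially"
    proof (rule ccontr)
      assume "\<not> ?thesis"
      then have "eventually (\<lambda>n. ereal (coarse_rate \<alpha> n) \<le> ereal y) sequentially"
        by (simp add: frequently_def not_less)
      then have "F_upper_at \<nu> \<alpha> \<le> ereal y" unfolding F_upper_at_def by (rule Limsup_bounded)
      then show False using y(2) by simp
    qed
    define K0 where "K0 = 4 / (m - 1)"
    have K0: "0 < K0" using m by (simp add: K0_def)
    obtain c N where c: "0 < c" "\<And>n x. N \<le> n \<Longrightarrow> K0 * 2 powr ((1 + \<alpha>) * real n) \<le> x \<Longrightarrow>
       y < coarse_rate \<alpha> n \<Longrightarrow> c * 2 powr (y * real n) \<le> real (reduced_count \<nu> m x)"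
      using reduced_count_ge_powr[OF m y(1)] unfolding K0_def by blast
    define X where "X n = K0 * 2 powr ((1 + \<alpha>) * real n)" for n
    have X: "filterlim X at_top sequentially"
    proof -
      have "filterlim (\<lambda>n. (2 powr (1 + \<alpha>)) ^ n) at_top sequentially"
        using \<alpha> by (intro filterlim_at_infinity_imp_filterlim_at_top filterlim_realpow_sequentially_gt1)
          (auto intro!: always_eventually)
      then have "filterlim (\<lambda>n. K0 * (2 powr (1 + \<alpha>)) ^ n) at_top sequentially"
        by (rule filterlim_tendsto_pos_mult_at_top[OF tendsto_const K0])
      moreover have "K0 * (2 powr (1 + \<alpha>)) ^ n = X n" for n
        by (simp add: X_def powr_realpow[symmetric] powr_powr)
      ultimately show ?thesis by simp
    qed
    have Xz: "X n powr z = K0 powr z * 2 powr (y * real n)" for n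
      using K0 by (simp add: X_def powr_mult powr_powr y_def mult_ac)
    have "frequently (\<lambda>n. c / K0 powr z * X n powr z \<le> real (reduced_count \<nu> m (X n))) sequentially"
    proof (rule frequently_elim1[OF frequently_eventually_conj[OF freq eventually_ge_at_top[of N]]])
      fix n assume "N \<le> n \<and> y < coarse_rate \<alpha> n"
      then have "c * 2 powr (y * real n) \<le> real (reduced_count \<nu> m (X n))"
        by (intro c(2)) (auto simp: X_def)
      then show "c / K0 powr z * X n powr z \<le> real (reduced_count \<nu> m (X n))"
        unfolding Xz using K0 by simp
    qed
    from upper_exponent_ge_powr[OF _ X this] have "ereal z \<le> upper_reduced_entropy \<nu> m"
      unfolding upper_reduced_entropy_def using c(1) K0 by simp
    then show False using z(1) by simp
  qed
qed

lemma F_lower_le_lower_reduced_entropy: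
  assumes m: "1 < m"
  shows "F_lower \<nu> \<le> lower_reduced_entropy \<nu> m"
  unfolding F_lower_def
proof (rule SUP_least)
  fix \<alpha> :: real assume "\<alpha> \<in> {0<..}"
  then have \<alpha>: "0 < \<alpha>" by simp
  show "F_lower_at \<nu> \<alpha> / ereal (1 + \<alpha>) \<le> lower_reduced_entropy \<nu> m"
  proof (rule ccontr)
    assume "\<not> ?thesis"
    then have "lower_reduced_entropy \<nu> m < F_lower_at \<nu> \<alpha> / ereal (1 + \<alpha>)" by simp
    from ereal_dense2[OF this] obtain z where z: "lower_reduced_entropy \<nu> m < ereal z" "ereal z < F_lower_at \<nu> \<alpha> / ereal (1 + \<alpha>)"
      by blast
    have nn: "0 \<le> lower_reduced_entropy \<nu> m"
      unfolding lower_reduced_entropy_def by (rule lower_exponent_nonneg)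
    then have "0 \<le> ereal z" using z(1) by (meson le_less_trans less_imp_le)
    then have z0: "0 < z" using z(1) nn by (cases "z = 0") (auto simp: zero_ereal_def[symmetric])
    define y where "y = z * (1 + \<alpha>)"
    have y: "0 < y" "ereal y < F_lower_at \<nu> \<alpha>"
      using z(2) z0 \<alpha> ereal_divide_less_iff(1)[of "1 + \<alpha>" "ereal z"] by (auto simp: y_def)
    have ev: "eventually (\<lambda>n. y < coarse_rate \<alpha> n) sequentially"
      using less_LiminfD[OF y(2)[unfolded F_lower_at_def]] by simp
    define K0 where "K0 = 4 / (m - 1)"
    have K0: "0 < K0" using m by (simp add: K0_def)
    obtain c N1 where c: "0 < c" "\<And>n x. N1 \<le> n \<Longrightarrow> K0 * 2 powr ((1 + \<alpha>) * real n) \<le> x \<Longrightarrow>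
       y < coarse_rate \<alpha> n \<Longrightarrow> c * 2 powr (y * real n) \<le> real (reduced_count \<nu> m x)"
      using reduced_count_ge_powr[OF m y(1)] unfolding K0_def by blast
    obtain N where N: "\<And>n x. N \<le> n \<Longrightarrow> K0 * 2 powr ((1 + \<alpha>) * real n) \<le> x \<Longrightarrow> c * 2 powr (y * real n) \<le> real (reduced_count \<nu> m x)"
      using eventually_conj[OF ev eventually_ge_at_top[of N1]] c(2) unfolding eventually_sequentially by blast
    define c' where "c' = c * 2 powr (- y) / K0 powr z"
    have "eventually (\<lambda>x. c' * x powr z \<le> real (reduced_count \<nu> m x)) at_top"
      using eventually_ge_at_top[of "K0 * 2 powr ((1 + \<alpha>) * real N)"] eventually_gt_at_top[of 0]
    proof eventually_elim
      case (elim x)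
      \<comment> \<open>The real level \<open>L\<close> solves
        \<open>K0 * 2 powr ((1 + \<alpha>) * L) = x\<close>. Rounding it down to \<open>n\<close>
        costs at most the factor \<open>2 powr y\<close>, which \<open>c'\<close> allows
        for.\<close>
      define L where "L = log 2 (x / K0) / (1 + \<alpha>)"
      have xK: "2 powr ((1 + \<alpha>) * L) = x / K0" using elim K0 \<alpha> by (simp add: L_def)
      have "2 powr ((1 + \<alpha>) * real N) \<le> 2 powr ((1 + \<alpha>) * L)" unfolding xK using elim K0 by (simp add: field_simps)
      then have NL: "real N \<le> L" using \<alpha> by (simp add: powr_le_cancel_iff)
      define n where "n = nat \<lfloor>L\<rfloor>"
      have n: "real n \<le> L" "L < real n + 1" "N \<le> n" using NL by (auto simp: n_def le_nat_floor)
      have "2 powr ((1 + \<alpha>) * real n) \<le> 2 powr ((1 + \<alpha>) * L)" using n \<alpha> by simp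
      then have "K0 * 2 powr ((1 + \<alpha>) * real n) \<le> x" unfolding xK using K0 by (simp add: field_simps)
      then have ge: "c * 2 powr (y * real n) \<le> real (reduced_count \<nu> m x)" using N n(3) by blast
      have "c' * x powr z = c * 2 powr (- y) * (x / K0) powr z"
        using elim K0 by (simp add: c'_def powr_divide)
      also have "\<dots> = c * 2 powr (- y) * 2 powr (y * L)"
        unfolding xK[symmetric] by (simp add: powr_powr y_def mult_ac)
      also have "\<dots> = c * 2 powr (y * L - y)" by (simp add: powr_diff powr_minus_divide)
      also have "\<dots> \<le> c * 2 powr (y * real n)"
      proof (intro mult_left_mono powr_mono)
        have "y * L \<le> y * (real n + 1)" using n(2) y(1) by (intro mult_left_mono) auto
        then show "y * L - y \<le> y * real n" by (simp add: algebra_simps)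
      qed (use c in auto)
      finally show ?case using ge by linarith
    qed
    then have "ereal z \<le> lower_reduced_entropy \<nu> m"
      unfolding lower_reduced_entropy_def using c(1) K0 by (intro lower_exponent_ge_powr[of c']) (auto simp: c'_def)
    then show False using z(1) by simp
  qed
qed

section \<open>From inequalities between counts to the chain of dimensions\<close>

lemma reduced_entropy_le_spectral_dim:
  assumes m: "1 < m"
  shows "lower_reduced_entropy \<nu> m \<le> lower_spectral_dim \<nu>" "upper_reduced_entropy \<nu> m \<le> upper_spectral_dim \<nu>"
proof -
  have "eventually (\<lambda>x. reduced_count \<nu> m x \<le> eigen_count \<nu> x) at_top"
    using eventually_gt_at_top[of 0] by eventually_elim (rule reduced_count_bounds(1)[OF m])
  then show "lower_reduced_entropy \<nu> m \<le> lower_spectral_dim \<nu>" "upper_reduced_entropy \<nu> m \<le> upper_spectral_dim \<nu>"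
    unfolding lower_reduced_entropy_def lower_spectral_dim_def upper_reduced_entropy_def upper_spectral_dim_def
    by (intro lower_exponent_mono upper_exponent_mono; assumption)+
qed

lemma spectral_dim_le_entropy:
  "lower_spectral_dim \<nu> \<le> lower_entropy \<nu>" "upper_spectral_dim \<nu> \<le> upper_entropy \<nu>"
proof -
  have "eventually (\<lambda>x. eigen_count \<nu> x \<le> partition_count \<nu> x) at_top"
    using eventually_gt_at_top[of 0] by eventually_elim (intro less_imp_le eigen_count_less_partition_count)
  then show "lower_spectral_dim \<nu> \<le> lower_entropy \<nu>" "upper_spectral_dim \<nu> \<le> upper_entropy \<nu>"
    unfolding lower_entropy_def lower_spectral_dim_def upper_entropy_def upper_spectral_dim_def
    by (intro lower_exponent_mono upper_exponent_mono; assumption)+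
qed

end

theorem theorem1p1:
  fixes \<nu> :: "real measure"
  assumes "finite_measure_on_01 \<nu>"
    and "emeasure \<nu> (space \<nu>) \<noteq> 0"
  shows
    "(\<forall>m::real. 1 < m \<and> m \<le> 3 \<longrightarrow>
        F_lower \<nu> \<le> lower_reduced_entropy \<nu> m \<and>
        lower_reduced_entropy \<nu> m \<le> lower_spectral_dim \<nu> \<and>
        lower_spectral_dim \<nu> \<le> lower_entropy \<nu> \<and>
        lower_entropy \<nu> \<le> upper_entropy \<nu> \<and>
        upper_entropy \<nu> = upper_reduced_entropy \<nu> m \<and>
        upper_reduced_entropy \<nu> m = upper_spectral_dim \<nu> \<and>
        upper_spectral_dim \<nu> = q_upper \<nu> \<and>
        q_upper \<nu> = F_upper \<nu>) \<and>
     q_upper \<nu> \<le> ereal (1 / 2) \<and>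
     (lower_spectral_dim \<nu> = upper_spectral_dim \<nu> \<longrightarrow>
        lower_entropy \<nu> = lower_spectral_dim \<nu> \<and>
        upper_entropy \<nu> = lower_spectral_dim \<nu>) \<and>
     ((SUP m\<in>{1<..}. lower_reduced_entropy \<nu> m) = upper_entropy \<nu> \<longrightarrow>
        lower_spectral_dim \<nu> = upper_spectral_dim \<nu> \<and>
        upper_spectral_dim \<nu> = upper_entropy \<nu>) \<and>
     (F_lower \<nu> = F_upper \<nu> \<longrightarrow>
        (\<forall>m::real. 1 < m \<and> m \<le> 3 \<longrightarrow>
           F_lower \<nu> = lower_reduced_entropy \<nu> m \<and>
           lower_reduced_entropy \<nu> m = lower_spectral_dim \<nu> \<and>
           lower_spectral_dim \<nu> = lower_entropy \<nu> \<and>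
           lower_entropy \<nu> = upper_entropy \<nu> \<and>
           upper_entropy \<nu> = upper_reduced_entropy \<nu> m \<and>
           upper_reduced_entropy \<nu> m = upper_spectral_dim \<nu> \<and>
           upper_spectral_dim \<nu> = q_upper \<nu> \<and>
           q_upper \<nu> = F_upper \<nu>) \<and>
        (SUP m\<in>{1<..}. lower_reduced_entropy \<nu> m) = upper_entropy \<nu>) \<and>
     ((\<exists>m::real. 1 < m \<and> lower_reduced_entropy \<nu> m \<ge> ereal (1 / 2)) \<longrightarrow>
        lower_spectral_dim \<nu> = ereal (1 / 2) \<and>
        upper_spectral_dim \<nu> = ereal (1 / 2) \<and>
        upper_entropy \<nu> = ereal (1 / 2))"
proof -
  interpret nonzero_measure_on_01 \<nu>
    using assms by unfold_locales
  have low: "F_lower \<nu> \<le> lower_reduced_entropy \<nu> m" "lower_reduced_entropy \<nu> m \<le> lower_spectral_dim \<nu>" if "1 < m" for m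
    using that by (rule F_lower_le_lower_reduced_entropy reduced_entropy_le_spectral_dim)+
  have ent: "lower_spectral_dim \<nu> \<le> lower_entropy \<nu>" "lower_entropy \<nu> \<le> upper_entropy \<nu>"
    using spectral_dim_le_entropy lower_exponent_le_upper unfolding lower_entropy_def upper_entropy_def by auto
  \<comment> \<open>The upper quantities form a cycle of inequalities: partition entropy, q, F,
    reduced entropy, spectral dimension, and back to partition entropy.\<close>
  have up: "upper_entropy \<nu> = q_upper \<nu>" "upper_reduced_entropy \<nu> m = q_upper \<nu>" "upper_spectral_dim \<nu> = q_upper \<nu>"
    "F_upper \<nu> = q_upper \<nu>" if "1 < m" for m
    using upper_entropy_le_q_upper q_upper_le_F_upper F_upper_le_upper_reduced_entropy[OF that]
      reduced_entropy_le_spectral_dim(2)[OF that] spectral_dim_le_entropy(2) by order+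
  \<comment> \<open>The value 2 is one admissible \<open>m\<close> from which to read off the
    equalities that do not mention \<open>m\<close>.\<close>
  have two: "(1::real) < 2" by simp
  note up' = up(1)[OF two] up(3)[OF two] up(4)[OF two]
  \<comment> \<open>The lower spectral dimension does not depend on \<open>m\<close>, so its bound
    passes to the supremum; with \<open>spec\<close> this squeezes the case (ii).\<close>
  have sup_le: "(SUP m\<in>{1<..}. lower_reduced_entropy \<nu> m) \<le> lower_spectral_dim \<nu>"
    by (rule SUP_least) (use low(2) in auto)
  have le_sup: "lower_reduced_entropy \<nu> m \<le> (SUP m\<in>{1<..}. lower_reduced_entropy \<nu> m)" if "1 < m" for m
    by (rule SUP_upper) (use that in auto)
  have spec: "lower_spectral_dim \<nu> \<le> upper_spectral_dim \<nu>" using ent up' by order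
  show ?thesis
  proof (intro conjI impI allI)
    show "q_upper \<nu> \<le> ereal (1 / 2)" by (rule q_upper_le_half)
  next
    assume "(SUP m\<in>{1<..}. lower_reduced_entropy \<nu> m) = upper_entropy \<nu>"
    then show "lower_spectral_dim \<nu> = upper_spectral_dim \<nu>" "upper_spectral_dim \<nu> = upper_entropy \<nu>"
      using sup_le ent up' by order+
  next
    assume F: "F_lower \<nu> = F_upper \<nu>"
    then show "(SUP m\<in>{1<..}. lower_reduced_entropy \<nu> m) = upper_entropy \<nu>"
      using sup_le le_sup[OF two] low[OF two] ent up' by order
    fix m :: real assume "1 < m \<and> m \<le> 3"
    then have m: "1 < m" by simp
    show "F_lower \<nu> = lower_reduced_entropy \<nu> m" "lower_reduced_entropy \<nu> m = lower_spectral_dim \<nu>"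
      "lower_spectral_dim \<nu> = lower_entropy \<nu>" "lower_entropy \<nu> = upper_entropy \<nu>"
      using F low[OF m] ent up[OF m] by order+
  next
    assume "\<exists>m::real. 1 < m \<and> lower_reduced_entropy \<nu> m \<ge> ereal (1 / 2)"
    then obtain m where m: "1 < m" "lower_reduced_entropy \<nu> m \<ge> ereal (1 / 2)" by blast
    \<comment> \<open>Everything lies between the reduced entropy, at least 1/2, and
      \<open>q_upper\<close>, at most 1/2.\<close>
    then show "lower_spectral_dim \<nu> = ereal (1 / 2)" "upper_spectral_dim \<nu> = ereal (1 / 2)"
        "upper_entropy \<nu> = ereal (1 / 2)"
      using low(2)[OF m(1)] ent up' q_upper_le_half by order+
  qed (use low ent up up' in \<open>simp_all\<close>)
qed

end
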